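(* Let $f:\mathbf{P}^2\to\mathbf{P}^2$ be a noninvertible holomorphic map (of algebraic degree $d\ge 2$) of the complex projective plane, and let $C\subset\check{\mathbf{P}}^2$ be a reduced algebraic curve such that the algebraic web associated to $C$ is invariant for $f$. If $C$ is reducible, then $C$ is of one of the following types: (i) the union of two lines; (ii) the union of three lines in general position; (iii) the union of a conic and a line in general position.
   Context: $\mathbf{P}^2$ is the complex projective plane and $\check{\mathbf{P}}^2$ is the dual projective plane, whose points are the complex lines in $\mathbf{P}^2$. A holomorphic map $f:\mathbf{P}^2\to\mathbf{P}^2$ is written in homogeneous coordinates as $f=[P:Q:R]$ with $P,Q,R$ homogeneous polynomials on $\mathbf{C}^3$ of the same degree $d$ and $\{P=Q=R=0\}=\{0\}$; $d$ is the algebraic degree of $f$, and noninvertible means $d\ge2$. A reduced algebraic curve $C\subset\check{\mathbf{P}}^2$ defines an algebraic web on $\mathbf{P}^2$, whose leaves are exactly the lines in $\mathbf{P}^2$ corresponding to the points of $C$ (the lines "belonging to $C$"). The web is invariant for $f$ if the image under $f$ of every line in $\mathbf{P}^2$ belonging to $C$ is again a line belonging to $C$. Three (distinct) lines in $\check{\mathbf{P}}^2$ are in general position if they have no common point. In (iii) the conic is irreducible (equivalently smooth), and a conic and a line are in general position if they meet in two distinct points. *)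

theory Defs
  imports "HOL-Analysis.Analysis" "HOL-Computational_Algebra.Computational_Algebra"
begin

typedef proj_plane = "{V :: (complex^3) set. vec.subspace V \<and> vec.dim V = 1}"
proof -
  have "vec.subspace (vec.span {1 :: complex^3})"
    by (rule vec.subspace_span)
  moreover have "vec.dim (vec.span {1 :: complex^3}) = 1"
    by (simp add: vec.dim_span vec.dim_eq_card_independent vec.independent_insert)
  ultimately show ?thesis by blast
qed

text \<open>
  The point \<open>[a : b : c]\<close> of the dual plane is the line \<open>a x + b y + c z = 0\<close>; in these
  coordinates the dual plane is a second copy of the plane.
\<close>

type_synonym dual_plane = proj_plane

definition line_of :: "proj_plane \<Rightarrow> proj_plane set" where
  "line_of l = {p. \<forall>u\<in>Rep_proj_plane l. \<forall>v\<in>Rep_proj_plane p. (\<Sum>i\<in>UNIV. u $ i * v $ i) = 0}"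

definition is_line :: "proj_plane set \<Rightarrow> bool" where
  "is_line L \<longleftrightarrow> (\<exists>l. L = line_of l)"

text \<open>
  Polynomials in three variables as iterated univariate polynomials: the coefficient of
  \<open>x\<^sup>i y\<^sup>j z\<^sup>k\<close> in \<open>F\<close> is \<open>coeff (coeff (coeff F i) j) k\<close>.
\<close>

type_synonym poly3 = "complex poly poly poly"

definition eval3 :: "poly3 \<Rightarrow> complex^3 \<Rightarrow> complex" where
  "eval3 F v = poly (poly (poly F [:[:v $ 1:]:]) [:v $ 2:]) (v $ 3)"

definition homogeneous :: "nat \<Rightarrow> poly3 \<Rightarrow> bool" where
  "homogeneous d F \<longleftrightarrow> (\<forall>i j k. coeff (coeff (coeff F i) j) k \<noteq> 0 \<longrightarrow> i + j + k = d)"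

definition zero_set :: "poly3 \<Rightarrow> proj_plane set" where
  "zero_set F = {p. \<forall>v\<in>Rep_proj_plane p. eval3 F v = 0}"

text \<open>
  Since \<open>(P v, Q v, R v)\<close> is nonzero for \<open>v \<noteq> 0\<close>, the last clause says
  \<open>f [v] = [P v : Q v : R v]\<close>.
\<close>

definition holomorphic_map :: "nat \<Rightarrow> (proj_plane \<Rightarrow> proj_plane) \<Rightarrow> bool" where
  "holomorphic_map d f \<longleftrightarrow> (\<exists>P Q R.
     homogeneous d P \<and> homogeneous d Q \<and> homogeneous d R \<and>
     {v. eval3 P v = 0 \<and> eval3 Q v = 0 \<and> eval3 R v = 0} = {0} \<and>
     (\<forall>p. \<forall>v\<in>Rep_proj_plane p. v \<noteq> 0 \<longrightarrow>
        vector [eval3 P v, eval3 Q v, eval3 R v] \<in> Rep_proj_plane (f p)))"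

text \<open>
  A reduced curve is identified with its set of points; its reduced equation is unique up to a
  nonzero constant factor, so reducibility does not depend on the choice of equation.
\<close>

definition reduced_equation :: "proj_plane set \<Rightarrow> poly3 \<Rightarrow> bool" where
  "reduced_equation C F \<longleftrightarrow> (\<exists>n\<ge>1. homogeneous n F) \<and> squarefree F \<and> C = zero_set F"

definition reduced_curve :: "proj_plane set \<Rightarrow> bool" where
  "reduced_curve C \<longleftrightarrow> (\<exists>F. reduced_equation C F)"

definition reducible_curve :: "proj_plane set \<Rightarrow> bool" where
  "reducible_curve C \<longleftrightarrow> (\<exists>F. reduced_equation C F \<and> \<not> irreducible F)"

definition irreducible_conic :: "proj_plane set \<Rightarrow> bool" where
  "irreducible_conic D \<longleftrightarrow> (\<exists>F. homogeneous 2 F \<and> irreducible F \<and> D = zero_set F)"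

definition web_invariant :: "(proj_plane \<Rightarrow> proj_plane) \<Rightarrow> dual_plane set \<Rightarrow> bool" where
  "web_invariant f C \<longleftrightarrow> (\<forall>l\<in>C. \<exists>l'\<in>C. f ` line_of l = line_of l')"

end

theory Submission
  imports Defs "Subresultants.Subresultant_Gcd" "HOL-Computational_Algebra.Field_as_Ring"
begin

text \<open>
  Let \<open>F\<close> be a squarefree equation, of degree \<open>n\<close>, of the curve in the dual plane, and let \<open>f\<close>
  also denote a homogeneous lift of the given map to \<open>\<complex>\<^sup>3\<close>. Linear forms on \<open>\<complex>\<^sup>3\<close> are identified
  with vectors by the bilinear product \<open>dot\<close>; a vector \<open>u\<close> stands for the line \<open>dot u v = 0\<close>.

  The pull-back identity. The lines of the web through a general point \<open>v\<close> are the \<open>n\<close> distinct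
  zeros of \<open>F\<close> on the pencil of linear forms vanishing at \<open>v\<close>. A self-map of the plane is onto, so
  by Sard's theorem it is a local isomorphism at a general point, and the transposed differential
  \<open>tdiff f v\<close> carries the \<open>n\<close> lines of the web through \<open>f v\<close> to those through \<open>v\<close>. Two binary forms
  with the same \<open>n\<close> distinct zeros are proportional; hence \<open>F (tdiff f v w) / F w\<close> does not depend on
  the form \<open>w\<close> vanishing at \<open>f v\<close>. Cleared of denominators this holds at every point \<open>v\<close>
  (\<open>pullback_identity\<close>).

  A totally invariant line. Two components of a reducible curve meet in a singular point \<open>l\<close> of it
  (\<open>reducible_form_singular\<close>). If a general point moves to a point \<open>v\<close> such that \<open>f v\<close> lies on the
  line \<open>l\<close>, two of the \<open>n\<close> lines through its image merge into \<open>l\<close>, so two lines through \<open>v\<close> are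
  sent to \<open>l\<close>; if these coincide, the curve is tangent there to the pencil through \<open>v\<close>
  (\<open>singular_preimages\<close>). Applied at the points of one line \<open>u\<close> sent to \<open>l\<close>, this shows that \<open>u\<close>
  is singular too (\<open>preimage_sing\<close>). The curve has finitely many singular points, so \<open>f\<close> permutes
  them, and \<open>l\<close> is the only line that a suitable iterate of \<open>f\<close> sends to \<open>l\<close>
  (\<open>totally_invariant_iterate\<close>). Replacing \<open>f\<close> by that iterate and choosing coordinates in
  which \<open>l\<close> is the line \<open>x = 0\<close>, the first component of \<open>f\<close> becomes \<open>c x\<^sup>d\<close> with \<open>d \<ge> 3\<close>
  (\<open>first_component\<close>).

  The local form at \<open>l\<close>. Write the equation of the curve as a polynomial of degree \<open>k\<close> in the first
  dual coordinate and let \<open>T\<close> be its leading coefficient, a binary form of degree \<open>n - k \<ge> 2\<close> whose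
  zeros are the tangents of the curve at \<open>l\<close>. Let the point \<open>v\<close> of the pull-back identity approach
  the line \<open>x = 0\<close>. (a) Through a general point of this line passes only one other line of the web,
  because its direction is determined by the differential of \<open>f\<close>; since \<open>F\<close> is squarefree,
  \<open>k \<le> 1\<close> (\<open>k_le_1\<close>). (b) A double zero of \<open>T\<close> would, by comparison of the terms of first and second
  order in \<open>x\<close>, make \<open>F\<close> divisible by a square (\<open>no_double_tangent\<close>). (c) The differential of \<open>f\<close>
  along the line permutes the zeros of \<open>T\<close> (\<open>T_identity\<close>); where its determinant vanishes, three
  different zeros would make it vanish altogether, which is impossible for a map without base
  points. So \<open>T\<close> has exactly two zeros (\<open>two_tangents\<close>), and \<open>n\<close> is 2 or 3.

  Conclusion. Up to a change of coordinates \<open>F\<close> is therefore either \<open>a b\<close> or \<open>a b c + p a\<^sup>3 + q b\<^sup>3\<close>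
  for independent linear forms \<open>a\<close>, \<open>b\<close>, \<open>c\<close> (\<open>singular_web_normal_form\<close>). The first is a pair of
  lines. A reducible cubic has a linear factor, which forces \<open>p = 0\<close> or \<open>q = 0\<close> (\<open>cubic_plane\<close>):
  what remains is a triangle, or the product of \<open>a\<close> and \<open>b c + p a\<^sup>2\<close>, a conic met by the line \<open>a = 0\<close>
  in the two points \<open>b = 0\<close> and \<open>c = 0\<close>.
\<close>

(* the symbol $ is reserved for vector components *)
no_notation vec_index (infixl "$" 100)
no_notation scalar_prod (infix "\<bullet>" 70)
no_notation fps_nth (infixl "$" 75)
hide_const (open) Matrix.vec Determinant.det Module.smult

section \<open>Vectors in three-space\<close>

definition v3 :: "complex \<Rightarrow> complex \<Rightarrow> complex \<Rightarrow> complex^3" where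
  "v3 a b c = vector [a, b, c]"

lemma v3_nth [simp]: "v3 a b c $ 1 = a" "v3 a b c $ 2 = b" "v3 a b c $ 3 = c"
  by (simp_all add: v3_def)

lemma cvec3_eq_iff: "u = (v :: complex^3) \<longleftrightarrow> u $ 1 = v $ 1 \<and> u $ 2 = v $ 2 \<and> u $ 3 = v $ 3"
  by (simp add: Finite_Cartesian_Product.vec_eq_iff forall_3)

lemma v3_collapse [simp]: "v3 (v $ 1) (v $ 2) (v $ 3) = v"
  by (simp add: cvec3_eq_iff)

text \<open>The pairing is bilinear, not hermitian: its first argument is a linear form written as a vector.
  Likewise \<open>crs u w\<close> is, for two linear forms, their common zero, and for two points the line
  joining them.\<close>

definition dot :: "complex^3 \<Rightarrow> complex^3 \<Rightarrow> complex" where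
  "dot u v = u $ 1 * v $ 1 + u $ 2 * v $ 2 + u $ 3 * v $ 3"

definition crs :: "complex^3 \<Rightarrow> complex^3 \<Rightarrow> complex^3" where
  "crs u v = v3 (u $ 2 * v $ 3 - u $ 3 * v $ 2) (u $ 3 * v $ 1 - u $ 1 * v $ 3)
                (u $ 1 * v $ 2 - u $ 2 * v $ 1)"

lemma dot_sum: "dot u v = (\<Sum>i\<in>UNIV. u $ i * v $ i)"
  by (simp add: dot_def sum_3)

lemma dot_commute: "dot u v = dot v u"
  by (simp add: dot_def)

lemma dot_add_left: "dot (u + w) v = dot u v + dot w v"
  and dot_add_right: "dot v (u + w) = dot v u + dot v w"
  and dot_diff_left: "dot (u - w) v = dot u v - dot w v"
  and dot_diff_right: "dot v (u - w) = dot v u - dot v w"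
  and dot_scale_left: "dot (c *s u) v = c * dot u v"
  and dot_scale_right: "dot u (c *s v) = c * dot u v"
  and dot_zero_left: "dot 0 v = 0"
  and dot_zero_right: "dot v 0 = 0"
  by (simp_all add: dot_def algebra_simps)

lemmas dot_lin = dot_add_left dot_add_right dot_diff_left dot_diff_right dot_scale_left
  dot_scale_right dot_zero_left dot_zero_right

lemma dot_crs_self [simp]: "dot (crs u v) u = 0" "dot (crs u v) v = 0"
   "dot u (crs u v) = 0" "dot v (crs u v) = 0"
  by (simp_all add: dot_def crs_def algebra_simps)

lemma crs_add_left: "crs (u + w) v = crs u v + crs w v"
  and crs_add_right: "crs v (u + w) = crs v u + crs v w"
  and crs_diff_left: "crs (u - w) v = crs u v - crs w v"
  and crs_diff_right: "crs v (u - w) = crs v u - crs v w"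
  and crs_scale_left: "crs (c *s u) v = c *s crs u v"
  and crs_scale_right: "crs u (c *s v) = c *s crs u v"
  and crs_zero_left: "crs 0 v = 0"
  and crs_zero_right: "crs v 0 = 0"
  by (simp_all add: cvec3_eq_iff crs_def algebra_simps)

lemmas crs_lin = crs_add_left crs_add_right crs_diff_left crs_diff_right crs_scale_left
  crs_scale_right crs_zero_left crs_zero_right

lemma crs_self [simp]: "crs u u = 0"
  by (simp add: cvec3_eq_iff crs_def)

lemma crs_swap: "crs v u = - crs u v"
  by (simp add: cvec3_eq_iff crs_def)

lemma crs_eq_0_commute: "crs v u = 0 \<longleftrightarrow> crs u v = 0"
  by (subst crs_swap) simp

lemma triple_product: "crs u (crs v w) = dot u w *s v - dot u v *s w"
  by (simp add: cvec3_eq_iff crs_def dot_def algebra_simps)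

lemma triple_product': "crs (crs u v) w = dot u w *s v - dot v w *s u"
  by (simp add: cvec3_eq_iff crs_def dot_def algebra_simps)

lemma exists_dot_ne_0: assumes "u \<noteq> 0" obtains v where "dot u v \<noteq> 0"
proof -
  have "u $ 1 \<noteq> 0 \<or> u $ 2 \<noteq> 0 \<or> u $ 3 \<noteq> 0"
    using assms by (auto simp: cvec3_eq_iff)
  moreover have "dot u (v3 1 0 0) = u $ 1" "dot u (v3 0 1 0) = u $ 2" "dot u (v3 0 0 1) = u $ 3"
    by (simp_all add: dot_def)
  ultimately show ?thesis using that by metis
qed

lemma parallel_iff:
  assumes "u \<noteq> 0" shows "crs u w = 0 \<longleftrightarrow> (\<exists>c. w = c *s u)"
proof
  assume c: "crs u w = 0"
  obtain v where v: "dot u v \<noteq> 0" using assms exists_dot_ne_0 by blast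
  have "0 = crs (crs u w) v" using c by (simp add: crs_lin)
  also have "\<dots> = dot u v *s w - dot w v *s u" by (rule triple_product')
  finally have "dot u v *s w = dot w v *s u" by simp
  hence "w = (dot w v / dot u v) *s u"
    using v by (auto simp: cvec3_eq_iff field_simps)
  thus "\<exists>c. w = c *s u" ..
qed (auto simp: crs_lin)

lemma parallelE:
  assumes "crs u w = 0" "u \<noteq> 0" "w \<noteq> 0"
  obtains c where "c \<noteq> 0" "w = c *s u"
  using assms parallel_iff[OF assms(2)] by fastforce

lemma orth_crs:
  assumes "dot u a = 0" "dot u b = 0" "crs a b \<noteq> 0" obtains c where "u = c *s crs a b"
proof -
  have "crs (crs a b) u = dot a u *s b - dot b u *s a" by (rule triple_product')
  also have "\<dots> = 0" using assms by (simp add: dot_commute)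
  finally show ?thesis using parallel_iff[OF assms(3)] that by auto
qed

lemma orth_parallel:
  assumes "dot u a = 0" "dot u b = 0" "dot w a = 0" "dot w b = 0" "crs a b \<noteq> 0"
  shows "crs u w = 0"
proof -
  obtain c where "u = c *s crs a b" using orth_crs[OF assms(1,2,5)] .
  moreover obtain c' where "w = c' *s crs a b" using orth_crs[OF assms(3,4,5)] .
  ultimately show ?thesis by (simp add: crs_lin)
qed

lemma orth_is_crs:
  assumes "v \<noteq> 0" "dot u v = 0" obtains a where "u = crs v a"
proof -
  obtain b where b: "dot v b \<noteq> 0" using assms(1) exists_dot_ne_0 by blast
  have "crs v (crs u b) = dot v b *s u - dot v u *s b" by (rule triple_product)
  also have "\<dots> = dot v b *s u" using assms(2) by (simp add: dot_commute)
  finally have "crs v ((1 / dot v b) *s crs u b) = u"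
    using b by (simp add: crs_lin cvec3_eq_iff)
  thus ?thesis using that by metis
qed

text \<open>Every form vanishing at \<open>v\<close> is of the shape \<open>crs v b\<close>. With \<open>v\<close> itself written as \<open>crs p p'\<close>, the
  triple product expands it in \<open>p\<close> and \<open>p'\<close>.\<close>

lemma orth_basis:
  assumes "v \<noteq> 0" "dot p v = 0" "p \<noteq> 0"
  obtains p' where "dot p' v = 0" "crs p p' \<noteq> 0" "crs p p' = v"
    "\<And>w. dot w v = 0 \<Longrightarrow> \<exists>a b. w = a *s p + b *s p'"
proof -
  have "dot v p = 0" using assms(2) by (simp add: dot_commute)
  then obtain p' where p': "v = crs p p'" using orth_is_crs[OF assms(3), of v] by blast
  have "dot p' v = 0" by (simp add: p')
  moreover have "\<exists>a b. w = a *s p + b *s p'" if w: "dot w v = 0" for w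
  proof -
    obtain e where e: "dot v e \<noteq> 0" using assms(1) exists_dot_ne_0 by blast
    obtain b where b: "w = crs v b" using orth_is_crs[OF assms(1) w] .
    have "w = dot p b *s p' - dot p' b *s p" unfolding b p' by (rule triple_product')
    also have "\<dots> = (- dot p' b) *s p + dot p b *s p'"
      by (simp add: cvec3_eq_iff)
    finally show ?thesis by blast
  qed
  ultimately show ?thesis using that p' assms(1) by metis
qed

lemma exists_orth: assumes "v \<noteq> 0" obtains p where "p \<noteq> 0" "dot p v = 0"
proof -
  have "crs v (v3 1 0 0) \<noteq> 0 \<or> crs v (v3 0 1 0) \<noteq> 0"
    using assms by (auto simp: crs_def cvec3_eq_iff)
  thus ?thesis using that by (metis dot_crs_self(1))
qed

lemma tendsto_dot:
  assumes "(f \<longlongrightarrow> a) F" "(g \<longlongrightarrow> b) F" shows "((\<lambda>x. dot (f x) (g x)) \<longlongrightarrow> dot a b) F"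
  unfolding dot_def using assms by (intro tendsto_intros)

lemma tendsto_cvec3:
  assumes "((\<lambda>x. f x $ 1) \<longlongrightarrow> a $ 1) F" "((\<lambda>x. f x $ 2) \<longlongrightarrow> a $ 2) F" "((\<lambda>x. f x $ 3) \<longlongrightarrow> a $ 3) F"
  shows "(f \<longlongrightarrow> (a::complex^3)) F"
proof (rule vec_tendstoI)
  show "((\<lambda>x. f x $ i) \<longlongrightarrow> a $ i) F" for i
    using assms exhaust_3[of i] by auto
qed

lemma tendsto_crs:
  assumes "(f \<longlongrightarrow> a) F" "(g \<longlongrightarrow> b) F" shows "((\<lambda>x. crs (f x) (g x)) \<longlongrightarrow> crs a b) F"
  by (rule tendsto_cvec3) (simp_all add: crs_def, (intro tendsto_intros assms)+)

lemma tendsto_smult_cvec: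
  assumes "(f \<longlongrightarrow> a) F" "(g \<longlongrightarrow> (b::complex^3)) F" shows "((\<lambda>x. f x *s g x) \<longlongrightarrow> a *s b) F"
  by (rule tendsto_cvec3) (simp_all, (intro tendsto_intros assms)+)

section \<open>Polynomial functions on three-space\<close>

text \<open>Polynomial functions rather than polynomials are the basic objects of what follows: they can be
  differentiated, restricted to lines, composed and passed to the limit without change of
  representation. As \<open>\<complex>\<close> is infinite, \<open>eval3_inj\<close> recovers the polynomial.\<close>

definition polyfun :: "(complex^3 \<Rightarrow> complex) \<Rightarrow> bool" where
  "polyfun h \<longleftrightarrow> (\<exists>G. h = eval3 G)"

lemma eval3_add: "eval3 (F + G) v = eval3 F v + eval3 G v"
  and eval3_mult: "eval3 (F * G) v = eval3 F v * eval3 G v"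
  and eval3_uminus: "eval3 (- F) v = - eval3 F v"
  and eval3_0 [simp]: "eval3 0 v = 0"
  and eval3_1 [simp]: "eval3 1 v = 1"
  and eval3_const: "eval3 [:[:[:c:]:]:] v = c"
  and eval3_x: "eval3 [:0, 1:] v = v $ 1"
  and eval3_y: "eval3 [:[:0, 1:]:] v = v $ 2"
  and eval3_z: "eval3 [:[:[:0, 1:]:]:] v = v $ 3"
  and eval3_pCons: "eval3 (pCons a F) v = poly (poly a [:v $ 2:]) (v $ 3) + v $ 1 * eval3 F v"
  by (simp_all add: eval3_def)

lemma eval3_power: "eval3 (F ^ n) v = eval3 F v ^ n"
  by (induction n) (simp_all add: eval3_mult)

lemma eval3_v3: "eval3 F (v3 a b c) = poly (poly (poly F [:[:a:]:]) [:b:]) c"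
  by (simp add: eval3_def)

lemma polyfun_eval3 [intro, simp]: "polyfun (eval3 G)"
  by (auto simp: polyfun_def)

lemma polyfun_const [intro, simp]: "polyfun (\<lambda>_. c)"
  unfolding polyfun_def by (rule exI[of _ "[:[:[:c:]:]:]"]) (simp add: fun_eq_iff eval3_const)

lemma polyfun_add: "polyfun f \<Longrightarrow> polyfun g \<Longrightarrow> polyfun (\<lambda>v. f v + g v)"
  unfolding polyfun_def by (elim exE, rename_tac F G, rule_tac x = "F + G" in exI) (simp add: fun_eq_iff eval3_add)

lemma polyfun_mult: "polyfun f \<Longrightarrow> polyfun g \<Longrightarrow> polyfun (\<lambda>v. f v * g v)"
  unfolding polyfun_def by (elim exE, rename_tac F G, rule_tac x = "F * G" in exI) (simp add: fun_eq_iff eval3_mult)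

lemma polyfun_uminus: "polyfun f \<Longrightarrow> polyfun (\<lambda>v. - f v)"
  unfolding polyfun_def by (elim exE, rename_tac F, rule_tac x = "- F" in exI) (simp add: fun_eq_iff eval3_uminus)

lemma polyfun_diff: "polyfun f \<Longrightarrow> polyfun g \<Longrightarrow> polyfun (\<lambda>v. f v - g v)"
  using polyfun_add[OF _ polyfun_uminus, of f g] by simp

lemma polyfun_power: "polyfun f \<Longrightarrow> polyfun (\<lambda>v. f v ^ n)"
  by (induction n) (auto intro: polyfun_mult)

lemma polyfun_sum: "(\<And>i. i \<in> I \<Longrightarrow> polyfun (f i)) \<Longrightarrow> polyfun (\<lambda>v. \<Sum>i\<in>I. f i v)"
  by (induction I rule: infinite_finite_induct) (auto intro: polyfun_add)

lemma polyfun_prod: "(\<And>i. i \<in> I \<Longrightarrow> polyfun (f i)) \<Longrightarrow> polyfun (\<lambda>v. \<Prod>i\<in>I. f i v)"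
  by (induction I rule: infinite_finite_induct) (auto intro: polyfun_mult)

lemma polyfun_nth [intro, simp]: "polyfun (\<lambda>v. v $ i)"
proof -
  have "polyfun (\<lambda>v. v $ 1)" "polyfun (\<lambda>v. v $ 2)" "polyfun (\<lambda>v. v $ 3)"
    using polyfun_eval3[of "[:0, 1:]"] polyfun_eval3[of "[:[:0, 1:]:]"]
      polyfun_eval3[of "[:[:[:0, 1:]:]:]"]
    by (simp_all only: eval3_x[abs_def] eval3_y[abs_def] eval3_z[abs_def])
  thus ?thesis using exhaust_3[of i] by auto
qed

lemmas polyfun_intros = polyfun_add polyfun_mult polyfun_uminus polyfun_diff polyfun_power
  polyfun_sum polyfun_prod

lemma polyfun_induct [consumes 1, case_names const nth add mult]:
  assumes "polyfun h"
    and const: "\<And>c. P (\<lambda>_. c)"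
    and nth: "\<And>i. P (\<lambda>v. v $ i)"
    and add: "\<And>f g. polyfun f \<Longrightarrow> polyfun g \<Longrightarrow> P f \<Longrightarrow> P g \<Longrightarrow> P (\<lambda>v. f v + g v)"
    and mult: "\<And>f g. polyfun f \<Longrightarrow> polyfun g \<Longrightarrow> P f \<Longrightarrow> P g \<Longrightarrow> P (\<lambda>v. f v * g v)"
  shows "P h"
proof -
  have 1: "P (\<lambda>v. poly a (v $ 3)) \<and> polyfun (\<lambda>v. poly a (v $ 3))" for a
  proof (induction a)
    case (pCons c a)
    thus ?case
      unfolding poly_pCons by (intro conjI add mult polyfun_add polyfun_mult const nth polyfun_const polyfun_nth; blast)
  qed (simp add: const)
  have 2: "P (\<lambda>v. poly (poly a [:v $ 2:]) (v $ 3)) \<and> polyfun (\<lambda>v. poly (poly a [:v $ 2:]) (v $ 3))" for a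
  proof (induction a)
    case (pCons c a)
    thus ?case
      using 1[of c] add[OF _ polyfun_mult[OF polyfun_nth] _ mult[OF polyfun_nth _ nth]]
        polyfun_add[OF _ polyfun_mult[OF polyfun_nth]]
      by simp
  qed (simp add: const)
  have 3: "P (eval3 a)" for a
  proof (induction a)
    case 0
    show ?case using const[of 0] by (simp add: eval3_def[abs_def])
  next
    case (pCons a F)
    have "eval3 (pCons a F) = (\<lambda>v. poly (poly a [:v $ 2:]) (v $ 3) + v $ 1 * eval3 F v)"
      by (simp add: fun_eq_iff eval3_pCons)
    moreover have "P (\<lambda>v. v $ 1 * eval3 F v)" using pCons by (intro mult nth) auto
    ultimately show ?case using 2[of a] by (simp add: add polyfun_mult)
  qed
  thus ?thesis using assms(1) by (auto simp: polyfun_def)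
qed

lemma polyfun_compose:
  assumes "polyfun h" "\<And>i. polyfun (\<lambda>v. \<psi> v $ i)"
  shows "polyfun (\<lambda>v. h (\<psi> v))"
  using assms(1) by (induction rule: polyfun_induct) (auto intro: assms polyfun_intros)

lemma polyfun_v3:
  assumes "polyfun h" "polyfun f" "polyfun g" "polyfun k"
  shows "polyfun (\<lambda>v. h (v3 (f v) (g v) (k v)))"
proof (rule polyfun_compose[OF assms(1)])
  show "polyfun (\<lambda>v. v3 (f v) (g v) (k v) $ i)" for i
    using assms exhaust_3[of i] by auto
qed

lemma polyfun_dot:
  assumes "\<And>i. polyfun (\<lambda>v. f v $ i)" "\<And>i. polyfun (\<lambda>v. g v $ i)"
  shows "polyfun (\<lambda>v. dot (f v) (g v))"
  unfolding dot_def by (intro polyfun_intros assms)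

lemma polyfun_crs:
  assumes "\<And>i. polyfun (\<lambda>v. f v $ i)" "\<And>i. polyfun (\<lambda>v. g v $ i)"
  shows "polyfun (\<lambda>v. crs (f v) (g v) $ i)"
proof -
  have "polyfun (\<lambda>v. crs (f v) (g v) $ 1)" "polyfun (\<lambda>v. crs (f v) (g v) $ 2)"
     "polyfun (\<lambda>v. crs (f v) (g v) $ 3)"
    unfolding crs_def v3_nth by (intro polyfun_intros assms)+
  thus ?thesis using exhaust_3[of i] by auto
qed

lemma polyfun_curve:
  assumes "polyfun h" "\<And>i. \<exists>p. \<forall>t. c t $ i = poly p t"
  shows "\<exists>p. \<forall>t. h (c t) = poly p t"
  using assms(1)
proof (induction rule: polyfun_induct)
  case (const c)
  show ?case by (rule exI[of _ "[:c:]"]) simp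
next
  case (nth i)
  show ?case by (rule assms(2))
next
  case (add f g)
  then obtain p q where "\<forall>t. f (c t) = poly p t" "\<forall>t. g (c t) = poly q t" by blast
  thus ?case by (intro exI[of _ "p + q"]) simp
next
  case (mult f g)
  then obtain p q where "\<forall>t. f (c t) = poly p t" "\<forall>t. g (c t) = poly q t" by blast
  thus ?case by (intro exI[of _ "p * q"]) simp
qed

lemma polyfun_line:
  assumes "polyfun h" shows "\<exists>p. \<forall>t. h (a + t *s b) = poly p t"
proof (rule polyfun_curve[OF assms])
  show "\<exists>p. \<forall>t. (a + t *s b) $ i = poly p t" for i
    by (rule exI[of _ "[:a $ i, b $ i:]"]) simp
qed

lemma infinitely_many_roots_0:
  fixes p :: "('a :: idom) poly"
  assumes "\<And>b::'b. poly p (f b) = 0" "inj f" "infinite (UNIV :: 'b set)"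
  shows "p = 0"
proof (rule ccontr)
  assume "p \<noteq> 0"
  hence "finite {x. poly p x = 0}" by (rule poly_roots_finite)
  moreover have "range f \<subseteq> {x. poly p x = 0}" using assms(1) by auto
  ultimately have "finite (range f)" by (rule rev_finite_subset)
  thus False using assms(2,3) by (simp add: finite_image_iff)
qed

lemma eval3_eq_0_iff: "(\<forall>v. eval3 G v = 0) \<longleftrightarrow> G = 0"
proof
  assume *: "\<forall>v. eval3 G v = 0"
  have inf: "infinite (UNIV :: complex set)" by (rule infinite_UNIV_char_0)
  have "poly (poly (poly G [:[:a:]:]) [:b:]) c = 0" for a b c
    using * by (metis eval3_v3)
  hence "poly (poly G [:[:a:]:]) [:b:] = 0" for a b
    using infinitely_many_roots_0[of _ "\<lambda>x. x"] inf by (metis inj_on_id2)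
  hence "poly G [:[:a:]:] = 0" for a
    using infinitely_many_roots_0[of "poly G [:[:a:]:]" "\<lambda>b. [:b:]"] inf by (simp add: inj_def)
  thus "G = 0"
    using infinitely_many_roots_0[of G "\<lambda>b. [:[:b:]:]"] inf by (simp add: inj_def)
qed simp

lemma eval3_inj: "eval3 G = eval3 H \<Longrightarrow> G = H"
proof -
  assume "eval3 G = eval3 H"
  hence "\<forall>v. eval3 (G + - H) v = 0" by (simp only: eval3_add eval3_uminus) simp
  thus "G = H" using eval3_eq_0_iff[of "G + - H"] by simp
qed

lemma polyfun_no_zero_divisors:
  assumes "polyfun f" "polyfun g" "\<And>v. f v * g v = 0"
  shows "(\<forall>v. f v = 0) \<or> (\<forall>v. g v = 0)"
proof -
  obtain F G where FG: "f = eval3 F" "g = eval3 G" using assms by (auto simp: polyfun_def)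
  have "\<forall>v. eval3 (F * G) v = 0" using assms FG by (simp add: eval3_mult)
  hence "F * G = 0" by (simp only: eval3_eq_0_iff)
  thus ?thesis using FG by auto
qed

lemma polyfun_prod_ne_0:
  assumes "finite I" "\<And>i. i \<in> I \<Longrightarrow> polyfun (f i)" "\<And>i. i \<in> I \<Longrightarrow> \<exists>v. f i v \<noteq> 0"
  shows "\<exists>v. \<forall>i\<in>I. f i v \<noteq> 0"
proof -
  have "\<exists>v. (\<Prod>i\<in>I. f i v) \<noteq> 0" using assms
  proof (induction I rule: finite_induct)
    case (insert i I)
    have "polyfun (f i)" "polyfun (\<lambda>v. \<Prod>i\<in>I. f i v)" using insert by (auto intro: polyfun_prod)
    moreover have "\<not> (\<forall>v. f i v = 0)" "\<not> (\<forall>v. (\<Prod>i\<in>I. f i v) = 0)" using insert by auto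
    ultimately have "\<exists>v. f i v * (\<Prod>i\<in>I. f i v) \<noteq> 0" using polyfun_no_zero_divisors by blast
    thus ?case using insert by simp
  qed auto
  thus ?thesis using assms(1) by auto
qed

lemma polyfun_common_ne_0:
  assumes "polyfun f" "polyfun g" "\<exists>v. f v \<noteq> 0" "\<exists>v. g v \<noteq> 0"
  shows "\<exists>v. f v \<noteq> 0 \<and> g v \<noteq> 0"
  using polyfun_no_zero_divisors[OF assms(1,2)] assms(3,4) by fastforce

text \<open>On the line joining a given point to a point where \<open>h\<close> does not vanish, \<open>h\<close> has finitely
  many zeros, so the given point is a limit of points where \<open>h\<close> does not vanish.\<close>

lemma polyfun_dense:
  assumes "polyfun h" "\<exists>v. h v \<noteq> 0"
  obtains v where "\<And>k. h (v k) \<noteq> 0" "v \<longlonglongrightarrow> v0"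
proof -
  obtain v1 where v1: "h v1 \<noteq> 0" using assms(2) by blast
  obtain p where p: "\<And>t. h (v0 + t *s (v1 - v0)) = poly p t"
    using polyfun_line[OF assms(1), of v0 "v1 - v0"] by blast
  have "poly p 1 \<noteq> 0" using v1 p[of 1] by simp
  hence "p \<noteq> 0" by auto
  hence fin: "finite {t. poly p t = 0}" by (rule poly_roots_finite)
  have "inj (\<lambda>k::nat. (1 / of_nat (Suc k) :: complex))"
    by (rule injI) (simp add: field_simps del: of_nat_Suc)
  hence "finite {k. poly p (1 / of_nat (Suc k)) = 0}"
    using finite_vimageI[OF fin, of "\<lambda>k. 1 / of_nat (Suc k)"] by (simp add: vimage_def)
  then obtain K where K: "\<And>k. k \<ge> K \<Longrightarrow> poly p (1 / of_nat (Suc k)) \<noteq> 0"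
    by (metis (mono_tags, lifting) finite_nat_set_iff_bounded mem_Collect_eq not_less)
  define v where "v k = v0 + (1 / of_nat (Suc (k + K))) *s (v1 - v0)" for k
  have "h (v k) \<noteq> 0" for k using K[of "k + K"] p by (simp add: v_def)
  moreover have "(\<lambda>k. 1 / of_nat (Suc (k + K)) :: complex) \<longlonglongrightarrow> 0"
    using LIMSEQ_ignore_initial_segment[OF lim_1_over_n[where 'a=complex], of "Suc K"] by simp
  hence "(\<lambda>k. v0 + (1 / of_nat (Suc (k + K))) *s (v1 - v0)) \<longlonglongrightarrow> v0 + 0 *s (v1 - v0)"
    by (intro tendsto_intros tendsto_smult_cvec)
  hence "v \<longlonglongrightarrow> v0" by (simp add: v_def[abs_def])
  ultimately show ?thesis using that by blast
qed

text \<open>An identity of polynomials may be checked at the points where another polynomial does not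
  vanish. This is how identities at general points extend to all points.\<close>

lemma polyfun_zero_of_mult:
  assumes "polyfun f" "polyfun g" "\<exists>v. g v \<noteq> 0" "\<And>v. g v \<noteq> 0 \<Longrightarrow> f v = 0"
  shows "f v = 0"
proof -
  have "\<And>v. f v * g v = 0" using assms(4) by auto
  thus ?thesis using polyfun_no_zero_divisors[OF assms(1,2)] assms(3) by blast
qed

lemma polyfun_tendsto:
  assumes "polyfun h" "(c \<longlongrightarrow> a) F" shows "((\<lambda>k. h (c k)) \<longlongrightarrow> h a) F"
  using assms(1) by (induction rule: polyfun_induct) (auto intro!: tendsto_intros assms)

lemma polyfun_continuous: "polyfun h \<Longrightarrow> continuous_on A h"
  by (auto simp: continuous_on_def intro: polyfun_tendsto tendsto_ident_at)

section \<open>Gradients\<close>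

text \<open>Hadamard's lemma: a difference of values is a combination, with continuous coefficients, of the
  differences of the coordinates. The gradient is the value of these coefficients on the diagonal;
  the two-point version is needed for secants of the curve that become tangents.\<close>

definition hadamard :: "(complex^3 \<Rightarrow> complex) \<Rightarrow> (complex^3 \<Rightarrow> complex^3 \<Rightarrow> complex^3) \<Rightarrow> bool" where
  "hadamard h B \<longleftrightarrow> (\<forall>p q. h p - h q = dot (B p q) (p - q)) \<and>
     continuous_on UNIV (\<lambda>x. B (fst x) (snd x)) \<and> (\<forall>i. polyfun (\<lambda>p. B p p $ i))"

definition grad :: "(complex^3 \<Rightarrow> complex) \<Rightarrow> complex^3 \<Rightarrow> complex^3" where
  "grad h v = (SOME B. hadamard h B) v v"

lemma cont_cvec3:
  assumes "continuous_on S (\<lambda>x. f x $ 1)" "continuous_on S (\<lambda>x. f x $ 2)" "continuous_on S (\<lambda>x. f x $ 3)"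
  shows "continuous_on S (f :: _ \<Rightarrow> complex^3)"
  using assms unfolding continuous_on_def by (auto intro: tendsto_cvec3)

lemma hadamard_exists: "polyfun h \<Longrightarrow> \<exists>B. hadamard h B"
proof (induction rule: polyfun_induct)
  case (const c)
  show ?case by (rule exI[of _ "\<lambda>_ _. 0"]) (simp add: hadamard_def dot_lin)
next
  case (nth i)
  have "dot (axis i 1) v = v $ i" for v
    using exhaust_3[of i] by (auto simp: dot_def axis_def)
  thus ?case by (intro exI[of _ "\<lambda>_ _. axis i 1"]) (simp add: hadamard_def)
next
  case (add f g)
  then obtain B C where "hadamard f B" "hadamard g C" by blast
  hence "hadamard (\<lambda>v. f v + g v) (\<lambda>p q. B p q + C p q)"
    unfolding hadamard_def
    by (auto simp: dot_add_left intro!: continuous_intros polyfun_intros) (metis add_diff_add)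
  thus ?case by blast
next
  case (mult f g)
  then obtain B C where BC: "hadamard f B" "hadamard g C" by blast
  have cf: "continuous_on UNIV (\<lambda>x. f (fst x))"  "continuous_on UNIV (\<lambda>x. g (snd x))"
    using continuous_on_compose2[OF polyfun_continuous[OF mult(1)] continuous_on_fst[OF continuous_on_id] subset_UNIV]
       continuous_on_compose2[OF polyfun_continuous[OF mult(2)] continuous_on_snd[OF continuous_on_id] subset_UNIV]
    by blast+
  have "hadamard (\<lambda>v. f v * g v) (\<lambda>p q. f p *s C p q + g q *s B p q)"
    unfolding hadamard_def
  proof (intro conjI allI)
    fix p q
    have "f p * g p - f q * g q = f p * (g p - g q) + g q * (f p - f q)" by (simp add: algebra_simps)
    also have "\<dots> = dot (f p *s C p q + g q *s B p q) (p - q)"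
      using BC unfolding hadamard_def by (simp add: dot_add_left dot_scale_left)
    finally show "f p * g p - f q * g q = \<dots>" .
  next
    have "continuous_on UNIV (\<lambda>x. B (fst x) (snd x))" "continuous_on UNIV (\<lambda>x. C (fst x) (snd x))"
      using BC by (auto simp: hadamard_def)
    thus "continuous_on UNIV (\<lambda>x. f (fst x) *s C (fst x) (snd x) + g (snd x) *s B (fst x) (snd x))"
      using cf by (intro cont_cvec3) (auto intro!: continuous_intros)
  next
    show "polyfun (\<lambda>p. (f p *s C p p + g p *s B p p) $ i)" for i
      using BC mult by (auto simp: hadamard_def intro!: polyfun_intros)
  qed
  thus ?case by blast
qed

lemma hadamardE:
  assumes "polyfun h" obtains B where "hadamard h B" "\<And>v. grad h v = B v v"
proof -
  have "hadamard h (SOME B. hadamard h B)" using hadamard_exists[OF assms] by (rule someI_ex)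
  thus ?thesis using that by (simp add: grad_def)
qed

lemma hadamard_tendsto:
  assumes "hadamard h B" "(p \<longlongrightarrow> a) F" "(q \<longlongrightarrow> b) F"
  shows "((\<lambda>x. B (p x) (q x)) \<longlongrightarrow> B a b) F"
proof -
  have c: "continuous_on UNIV (\<lambda>x. B (fst x) (snd x))" using assms(1) by (simp add: hadamard_def)
  have "((\<lambda>x. (p x, q x)) \<longlongrightarrow> (a, b)) F" by (intro tendsto_Pair assms)
  from continuous_on_tendsto_compose[OF c this] show ?thesis by simp
qed

lemma polyfun_grad [intro]: assumes "polyfun h" shows "polyfun (\<lambda>v. grad h v $ i)"
proof -
  obtain B where "hadamard h B" "\<And>v. grad h v = B v v" using hadamardE[OF assms] by blast
  thus ?thesis by (simp add: hadamard_def)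
qed

lemma grad_field_derivative:
  assumes "polyfun h"
  shows "((\<lambda>s. h (v + s *s t)) has_field_derivative dot (grad h v) t) (at 0)"
proof -
  obtain B where B: "hadamard h B" "\<And>v. grad h v = B v v" using hadamardE[OF assms] by blast
  have eq: "(h (v + s *s t) - h v) / s = dot (B (v + s *s t) v) t" if "s \<noteq> 0" for s
  proof -
    have "h (v + s *s t) - h v = dot (B (v + s *s t) v) (v + s *s t - v)"
      using B(1) unfolding hadamard_def by blast
    thus ?thesis using that by (simp add: dot_lin)
  qed
  have "((\<lambda>s. v + s *s t) \<longlongrightarrow> v + 0 *s t) (at 0)"
    by (intro tendsto_intros tendsto_smult_cvec)
  hence "((\<lambda>s. dot (B (v + s *s t) v) t) \<longlongrightarrow> dot (B v v) t) (at 0)"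
    by (intro tendsto_dot hadamard_tendsto[OF B(1)] tendsto_const) simp
  hence "((\<lambda>s. (h (v + s *s t) - h v) / s) \<longlongrightarrow> dot (B v v) t) (at 0)"
    by (rule Lim_transform_eventually) (auto simp: eq eventually_at_filter)
  thus ?thesis by (simp add: has_field_derivative_iff B(2))
qed

lemma dot_ext: assumes "\<And>t. dot u t = dot w t" shows "u = w"
  using assms[of "v3 1 0 0"] assms[of "v3 0 1 0"] assms[of "v3 0 0 1"]
  by (simp add: dot_def cvec3_eq_iff)

lemma grad_unique:
  assumes "polyfun h" "\<And>t. ((\<lambda>s. h (v + s *s t)) has_field_derivative dot w t) (at 0)"
  shows "grad h v = w"
  using DERIV_unique[OF grad_field_derivative[OF assms(1)] assms(2)] by (rule dot_ext)

text \<open>The real differential of the same function, needed for Sard's theorem.\<close>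

lemma grad_has_derivative:
  assumes "polyfun h" shows "(h has_derivative (\<lambda>t. dot (grad h v) t)) (at v)"
proof -
  obtain B where B: "hadamard h B" "\<And>v. grad h v = B v v" using hadamardE[OF assms] by blast
  have bl: "bounded_linear (\<lambda>t. dot (grad h v) t)"
    unfolding dot_def by (intro bounded_linear_add bounded_linear_mult_right bounded_linear_vec_nth
      bounded_linear_compose[OF bounded_linear_mult_right bounded_linear_vec_nth])
  have "((\<lambda>y. B y v - B v v) \<longlongrightarrow> B v v - B v v) (at v)"
    by (intro tendsto_intros hadamard_tendsto[OF B(1)])
  hence "((\<lambda>y. norm (B y v - B v v)) \<longlongrightarrow> 0) (at v)"
    using tendsto_norm_zero by fastforce
  hence lim: "((\<lambda>y. 3 * norm (B y v - B v v)) \<longlongrightarrow> 0) (at v)"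
    using tendsto_mult_right_zero by blast
  have dotb: "norm (dot a b) \<le> 3 * norm a * norm b" for a b
  proof -
    have "norm (a $ i * b $ i) \<le> norm a * norm b" for i
      by (simp add: norm_mult mult_mono Finite_Cartesian_Product.norm_nth_le)
    from this[of 1] this[of 2] this[of 3] have "norm (a $ 1 * b $ 1) + norm (a $ 2 * b $ 2) + norm (a $ 3 * b $ 3) \<le> 3 * norm a * norm b"
      by linarith
    thus ?thesis unfolding dot_def using norm_triangle_ineq[of "a $ 1 * b $ 1 + a $ 2 * b $ 2" "a $ 3 * b $ 3"]
      norm_triangle_ineq[of "a $ 1 * b $ 1" "a $ 2 * b $ 2"] by linarith
  qed
  have "((\<lambda>y. norm (h y - h v - dot (grad h v) (y - v)) / norm (y - v)) \<longlongrightarrow> 0) (at v)"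
  proof (rule Lim_null_comparison[OF _ lim])
    show "\<forall>\<^sub>F y in at v. norm (norm (h y - h v - dot (grad h v) (y - v)) / norm (y - v))
       \<le> 3 * norm (B y v - B v v)"
      unfolding eventually_at_filter
    proof (intro always_eventually allI impI)
      fix y assume "y \<noteq> v"
      have "h y - h v = dot (B y v) (y - v)" using B(1) unfolding hadamard_def by blast
      hence "h y - h v - dot (grad h v) (y - v) = dot (B y v - B v v) (y - v)"
        using B by (simp add: dot_diff_left)
      thus "norm (norm (h y - h v - dot (grad h v) (y - v)) / norm (y - v)) \<le> 3 * norm (B y v - B v v)"
        using dotb[of "B y v - B v v" "y - v"] \<open>y \<noteq> v\<close> by (simp add: divide_le_eq)
    qed
  qed
  thus ?thesis using bl by (simp add: has_derivative_iff_norm)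
qed

definition homog :: "nat \<Rightarrow> (complex^3 \<Rightarrow> complex) \<Rightarrow> bool" where
  "homog n h \<longleftrightarrow> (\<forall>t v. h (t *s v) = t ^ n * h v)"

lemma homogD: "homog n h \<Longrightarrow> h (t *s v) = t ^ n * h v"
  by (simp add: homog_def)

lemma homog_zero: "homog n h \<Longrightarrow> n \<ge> 1 \<Longrightarrow> h 0 = 0"
  using homogD[of n h 0 0] by (simp add: zero_power)

lemma euler:
  assumes "polyfun h" "homog n h" shows "dot (grad h v) v = of_nat n * h v"
proof -
  have "v + s *s v = (1 + s) *s v" for s by (simp add: cvec3_eq_iff algebra_simps)
  hence "h (v + s *s v) = (1 + s) ^ n * h v" for s using homogD[OF assms(2)] by metis
  hence "((\<lambda>s. h (v + s *s v)) has_field_derivative of_nat n * h v) (at 0)"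
    by (auto intro!: derivative_eq_intros)
  thus ?thesis using DERIV_unique[OF grad_field_derivative[OF assms(1)]] by blast
qed

lemma grad_homog:
  assumes "polyfun h" "homog n h" shows "s *s grad h (s *s v) = s ^ n *s grad h v"
proof (rule dot_ext)
  fix t
  have "((\<lambda>r. h (s *s v + r *s (s *s t))) has_field_derivative dot (grad h (s *s v)) (s *s t)) (at 0)"
    by (rule grad_field_derivative[OF assms(1)])
  moreover have "h (s *s v + r *s (s *s t)) = s ^ n * h (v + r *s t)" for r
  proof -
    have "s *s v + r *s (s *s t) = s *s (v + r *s t)" by (simp add: cvec3_eq_iff algebra_simps)
    thus ?thesis using homogD[OF assms(2)] by metis
  qed
  moreover have "((\<lambda>r. s ^ n * h (v + r *s t)) has_field_derivative s ^ n * dot (grad h v) t) (at 0)"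
    by (intro DERIV_cmult grad_field_derivative[OF assms(1)])
  ultimately have "dot (grad h (s *s v)) (s *s t) = s ^ n * dot (grad h v) t"
    using DERIV_unique by fastforce
  thus "dot (s *s grad h (s *s v)) t = dot (s ^ n *s grad h v) t" by (simp add: dot_lin)
qed

lemma grad_orth:
  assumes "polyfun h" "dot u v = 0" "\<And>t. dot u t = 0 \<Longrightarrow> h t = 0" "dot u t = 0"
  shows "dot (grad h v) t = 0"
proof -
  have "h (v + s *s t) = 0" for s using assms by (simp add: dot_lin)
  hence "((\<lambda>s. h (v + s *s t)) has_field_derivative 0) (at 0)" by simp
  thus ?thesis using DERIV_unique[OF grad_field_derivative[OF assms(1)]] by blast
qed

lemma orth_complement_parallel:
  assumes "u \<noteq> 0" "\<And>t. dot u t = 0 \<Longrightarrow> dot w t = 0" shows "\<exists>c. w = c *s u"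
proof -
  obtain b where b: "dot u b \<noteq> 0" using assms(1) exists_dot_ne_0 by blast
  have "dot w t = dot ((dot w b / dot u b) *s u) t" for t
  proof -
    have "dot u (t - (dot u t / dot u b) *s b) = 0" using b by (simp add: dot_lin)
    hence "dot w (t - (dot u t / dot u b) *s b) = 0" by (rule assms(2))
    thus ?thesis by (simp add: dot_lin)
  qed
  thus ?thesis using dot_ext by blast
qed

section \<open>Binary and ternary forms\<close>

definition bform :: "nat \<Rightarrow> (complex \<Rightarrow> complex \<Rightarrow> complex) \<Rightarrow> bool" where
  "bform n T \<longleftrightarrow> polyfun (\<lambda>v. T (v $ 1) (v $ 2)) \<and> (\<forall>t a b. T (t * a) (t * b) = t ^ n * T a b)"

definition tform :: "nat \<Rightarrow> (complex^3 \<Rightarrow> complex) \<Rightarrow> bool" where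
  "tform n F \<longleftrightarrow> polyfun F \<and> homog n F"

lemma monomial_sum_0:
  fixes c :: "nat \<Rightarrow> nat \<Rightarrow> nat \<Rightarrow> complex"
  assumes "\<And>x y z. (\<Sum>i\<le>N. \<Sum>j\<le>N. \<Sum>k\<le>N. c i j k * x ^ i * y ^ j * z ^ k) = 0"
    and "i \<le> N" "j \<le> N" "k \<le> N"
  shows "c i j k = 0"
proof -
  have "(\<Sum>i\<le>N. (\<Sum>j\<le>N. \<Sum>k\<le>N. c i j k * y ^ j * z ^ k) * x ^ i) = 0" for x y z
    using assms(1)[of x y z] by (simp add: sum_distrib_right sum_distrib_left mult_ac)
  hence "(\<Sum>j\<le>N. \<Sum>k\<le>N. c i j k * y ^ j * z ^ k) = 0" for y z
    using polyfun_eq_0[of "\<lambda>i. \<Sum>j\<le>N. \<Sum>k\<le>N. c i j k * y ^ j * z ^ k" N] assms(2) by blast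
  hence "(\<Sum>j\<le>N. (\<Sum>k\<le>N. c i j k * z ^ k) * y ^ j) = 0" for y z
    by (simp add: sum_distrib_right sum_distrib_left mult_ac)
  hence "(\<Sum>k\<le>N. c i j k * z ^ k) = 0" for z
    using polyfun_eq_0[of "\<lambda>j. \<Sum>k\<le>N. c i j k * z ^ k" N] assms(3) by blast
  thus ?thesis using polyfun_eq_0[of "\<lambda>k. c i j k" N] assms(4) by blast
qed

lemma poly_le_degree_sum:
  fixes p :: "'a :: comm_semiring_1 poly"
  assumes "degree p \<le> N" shows "poly p x = (\<Sum>i\<le>N. coeff p i * x ^ i)"
proof -
  have "(\<Sum>i\<le>degree p. coeff p i * x ^ i) = (\<Sum>i\<le>N. coeff p i * x ^ i)"
    using assms by (intro sum.mono_neutral_left) (auto simp: coeff_eq_0)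
  thus ?thesis by (simp add: poly_altdef)
qed

lemma eval3_monomials:
  obtains N where "\<And>i j k. coeff (coeff (coeff G i) j) k \<noteq> 0 \<Longrightarrow> i \<le> N \<and> j \<le> N \<and> k \<le> N"
    "\<And>v. eval3 G v = (\<Sum>i\<le>N. \<Sum>j\<le>N. \<Sum>k\<le>N. coeff (coeff (coeff G i) j) k * v $ 1 ^ i * v $ 2 ^ j * v $ 3 ^ k)"
    "M \<le> N"
proof -
  define N1 where "N1 = Max (insert 0 (degree ` coeff G ` {..degree G}))"
  define N2 where "N2 = Max (insert 0 ((\<lambda>(i, j). degree (coeff (coeff G i) j)) ` ({..degree G} \<times> {..N1})))"
  define N where "N = M + degree G + N1 + N2"
  have d1: "degree (coeff G i) \<le> N1" for i
  proof (cases "i \<le> degree G")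
    case True
    thus ?thesis unfolding N1_def by (intro Max_ge) auto
  qed (simp add: coeff_eq_0)
  have d2: "degree (coeff (coeff G i) j) \<le> N2" for i j
  proof (cases "i \<le> degree G \<and> j \<le> N1")
    case True
    thus ?thesis unfolding N2_def by (intro Max_ge) (auto intro!: image_eqI[of _ _ "(i, j)"])
  next
    case False
    hence "coeff (coeff G i) j = 0" using d1[of i] by (auto intro: coeff_eq_0 simp: coeff_eq_0)
    thus ?thesis by simp
  qed
  show ?thesis
  proof
    fix i j k assume "coeff (coeff (coeff G i) j) k \<noteq> 0"
    hence "coeff (coeff G i) j \<noteq> 0" "k \<le> N2"
      using d2[of i j] le_degree[of "coeff (coeff G i) j" k] by (auto intro: order_trans)
    moreover from this(1) have "coeff G i \<noteq> 0" "j \<le> N1"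
      using d1[of i] le_degree[of "coeff G i" j] by (auto intro: order_trans)
    moreover from this(1) have "i \<le> degree G" by (rule le_degree)
    ultimately show "i \<le> N \<and> j \<le> N \<and> k \<le> N" by (simp add: N_def)
  next
    fix v
    have d: "degree G \<le> N" "degree (coeff G i) \<le> N" "degree (coeff (coeff G i) j) \<le> N" for i j
      using d1[of i] d2[of i j] by (simp_all add: N_def)
    show "eval3 G v = (\<Sum>i\<le>N. \<Sum>j\<le>N. \<Sum>k\<le>N. coeff (coeff (coeff G i) j) k * v $ 1 ^ i * v $ 2 ^ j * v $ 3 ^ k)"
      unfolding eval3_def poly_le_degree_sum[OF d(1)]
      by (simp add: poly_sum poly_power poly_le_degree_sum[OF d(2)] poly_le_degree_sum[OF d(3)]
           sum_distrib_right sum_distrib_left mult_ac)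
  qed (simp add: N_def)
qed

lemma homogeneous_coeff_0:
  "homogeneous n G \<Longrightarrow> i + j + k \<noteq> n \<Longrightarrow> coeff (coeff (coeff G i) j) k = 0"
  unfolding homogeneous_def by blast

lemma homogeneous_imp_homog:
  assumes "homogeneous n G" shows "homog n (eval3 G)"
proof -
  obtain N where "\<And>i j k. coeff (coeff (coeff G i) j) k \<noteq> 0 \<Longrightarrow> i \<le> N \<and> j \<le> N \<and> k \<le> N"
    and N: "\<And>v. eval3 G v = (\<Sum>i\<le>N. \<Sum>j\<le>N. \<Sum>k\<le>N. coeff (coeff (coeff G i) j) k * v $ 1 ^ i * v $ 2 ^ j * v $ 3 ^ k)" and "0 \<le> N"
    by (rule eval3_monomials[where G = G and M = 0]) blast
  have "coeff (coeff (coeff G i) j) k * (t * v $ 1) ^ i * (t * v $ 2) ^ j * (t * v $ 3) ^ k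
      = t ^ n * (coeff (coeff (coeff G i) j) k * v $ 1 ^ i * v $ 2 ^ j * v $ 3 ^ k)" for i j k t and v :: "complex^3"
  proof (cases "coeff (coeff (coeff G i) j) k = 0")
    case False
    hence "n = i + j + k" using assms by (auto simp: homogeneous_def)
    thus ?thesis by (simp add: power_add power_mult_distrib)
  qed simp
  thus ?thesis unfolding homog_def N
    by (simp only: vector_smult_component sum_distrib_left) simp
qed

text \<open>Comparing values at \<open>v\<close> and \<open>2 v\<close> suffices, since \<open>2\<^sup>i = 2\<^sup>n\<close> only for \<open>i = n\<close>.\<close>

lemma homog_imp_homogeneous:
  assumes "homog n (eval3 G)" shows "homogeneous n G"
  unfolding homogeneous_def
proof (intro allI impI)
  fix i j k assume nz: "coeff (coeff (coeff G i) j) k \<noteq> 0"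
  define c where "c i j k = coeff (coeff (coeff G i) j) k * (2 ^ (i + j + k) - 2 ^ n)" for i j k
  obtain N where N0: "\<And>i j k. coeff (coeff (coeff G i) j) k \<noteq> 0 \<Longrightarrow> i \<le> N \<and> j \<le> N \<and> k \<le> N"
    and N: "\<And>v. eval3 G v = (\<Sum>i\<le>N. \<Sum>j\<le>N. \<Sum>k\<le>N. coeff (coeff (coeff G i) j) k * v $ 1 ^ i * v $ 2 ^ j * v $ 3 ^ k)" and "0 \<le> N"
    by (rule eval3_monomials[where G = G and M = 0]) blast
  have "(\<Sum>i\<le>N. \<Sum>j\<le>N. \<Sum>k\<le>N. c i j k * x ^ i * y ^ j * z ^ k) = 0" for x y z
  proof -
    have "eval3 G (2 *s v3 x y z) - 2 ^ n * eval3 G (v3 x y z) = 0"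
      using homogD[OF assms, of 2 "v3 x y z"] by simp
    moreover have "eval3 G (2 *s v3 x y z) - 2 ^ n * eval3 G (v3 x y z) =
        (\<Sum>i\<le>N. \<Sum>j\<le>N. \<Sum>k\<le>N. c i j k * x ^ i * y ^ j * z ^ k)"
      unfolding N sum_distrib_left sum_subtractf[symmetric]
      by (intro sum.cong refl) (simp add: c_def power_add power_mult_distrib algebra_simps)
    ultimately show ?thesis by simp
  qed
  hence "c i j k = 0" using N0[OF nz] by (intro monomial_sum_0[of c N]) auto
  hence "(2::complex) ^ (i + j + k) = 2 ^ n" using nz by (simp add: c_def)
  hence "norm ((2::complex) ^ (i + j + k)) = norm ((2::complex) ^ n)" by simp
  hence "(2::real) ^ (i + j + k) = 2 ^ n" by (simp only: norm_power norm_numeral)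
  thus "i + j + k = n" by simp
qed

lemma bform_coeffs:
  assumes "bform n T" obtains c where "\<And>a b. T a b = (\<Sum>i\<le>n. c i * a ^ i * b ^ (n - i))"
proof -
  obtain G where G: "(\<lambda>v. T (v $ 1) (v $ 2)) = eval3 G" using assms by (auto simp: bform_def polyfun_def)
  have "homog n (eval3 G)" using assms unfolding G[symmetric] by (simp add: bform_def homog_def)
  hence hG: "homogeneous n G" by (rule homog_imp_homogeneous)
  obtain N where "\<And>i j k. coeff (coeff (coeff G i) j) k \<noteq> 0 \<Longrightarrow> i \<le> N \<and> j \<le> N \<and> k \<le> N"
    and N: "\<And>v. eval3 G v = (\<Sum>i\<le>N. \<Sum>j\<le>N. \<Sum>k\<le>N. coeff (coeff (coeff G i) j) k * v $ 1 ^ i * v $ 2 ^ j * v $ 3 ^ k)" and "n \<le> N"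
    by (rule eval3_monomials[where G = G and M = n]) blast
  have "T a b = (\<Sum>i\<le>n. coeff (coeff (coeff G i) (n - i)) 0 * a ^ i * b ^ (n - i))" for a b
  proof -
    have "T a b = eval3 G (v3 a b 0)" unfolding G[symmetric] by simp
    also have "\<dots> = (\<Sum>i\<le>N. \<Sum>j\<le>N. coeff (coeff (coeff G i) j) 0 * a ^ i * b ^ j)"
    proof -
      have "(\<Sum>k\<le>N. c k * 0 ^ k) = c 0" for c :: "nat \<Rightarrow> complex"
        using sum.remove[of "{..N}" 0 "\<lambda>k. c k * 0 ^ k"] by (auto intro!: sum.neutral)
      thus ?thesis unfolding N v3_nth by simp
    qed
    also have "\<dots> = (\<Sum>i\<le>n. \<Sum>j\<le>N. coeff (coeff (coeff G i) j) 0 * a ^ i * b ^ j)"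
      using \<open>n \<le> N\<close> by (intro sum.mono_neutral_right) (auto simp: homogeneous_coeff_0[OF hG] intro!: sum.neutral)
    also have "\<dots> = (\<Sum>i\<le>n. coeff (coeff (coeff G i) (n - i)) 0 * a ^ i * b ^ (n - i))"
    proof (intro sum.cong refl)
      fix i assume "i \<in> {..n}"
      hence "(\<Sum>j\<le>N. coeff (coeff (coeff G i) j) 0 * a ^ i * b ^ j) =
         (\<Sum>j\<in>{n - i}. coeff (coeff (coeff G i) j) 0 * a ^ i * b ^ j)"
        using \<open>n \<le> N\<close> by (intro sum.mono_neutral_right) (auto simp: homogeneous_coeff_0[OF hG])
      thus "(\<Sum>j\<le>N. coeff (coeff (coeff G i) j) 0 * a ^ i * b ^ j) =
         coeff (coeff (coeff G i) (n - i)) 0 * a ^ i * b ^ (n - i)" by simp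
    qed
    finally show ?thesis .
  qed
  thus ?thesis by (rule that)
qed

lemma bform_polyfun: "bform n T \<Longrightarrow> polyfun f \<Longrightarrow> polyfun g \<Longrightarrow> polyfun (\<lambda>v. T (f v) (g v))"
  using polyfun_v3[of "\<lambda>v. T (v $ 1) (v $ 2)" f g "\<lambda>_. 0"] by (simp add: bform_def)

lemma bform_scale: "bform n T \<Longrightarrow> T (t * a) (t * b) = t ^ n * T a b"
  by (simp add: bform_def)

lemma bform_const: "bform 0 (\<lambda>_ _. c)"
  by (simp add: bform_def)

lemma bform_cmult: "bform n T \<Longrightarrow> bform n (\<lambda>a b. c * T a b)"
  by (auto simp: bform_def intro!: polyfun_intros)

lemma bform_mult: "bform m T \<Longrightarrow> bform n S \<Longrightarrow> bform (m + n) (\<lambda>a b. T a b * S a b)"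
  by (auto simp: bform_def power_add intro!: polyfun_intros)

lemma bform_subst: "bform n T \<Longrightarrow> bform n (\<lambda>a b. T (a * p + b * q) (a * r + b * s))"
proof -
  assume T: "bform n T"
  have "T (t * a * p + t * b * q) (t * a * r + t * b * s) = t ^ n * T (a * p + b * q) (a * r + b * s)" for t a b
    using bform_scale[OF T, of t "a * p + b * q" "a * r + b * s"] by (simp add: algebra_simps)
  moreover have "polyfun (\<lambda>v. T (v $ 1 * p + v $ 2 * q) (v $ 1 * r + v $ 2 * s))"
    by (intro bform_polyfun[OF T] polyfun_intros polyfun_nth polyfun_const)
  ultimately show ?thesis by (simp add: bform_def)
qed

lemma bform_linear: "bform 1 (\<lambda>a b. a * t - b * s)"
  by (auto simp: bform_def algebra_simps intro!: polyfun_diff polyfun_mult)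

lemma bform_prod:
  "finite I \<Longrightarrow> bform (card I) (\<lambda>a b. \<Prod>l\<in>I. a * t l - b * s l)"
proof (induction I rule: finite_induct)
  case (insert i I)
  thus ?case using bform_mult[OF bform_linear[of "t i" "s i"] insert.IH] by simp
qed (simp add: bform_const)

lemma tform_bform:
  assumes "tform n F" shows "bform n (\<lambda>a b. F (a *s p + b *s q))"
proof -
  have "F ((t * a) *s p + (t * b) *s q) = t ^ n * F (a *s p + b *s q)" for t a b
  proof -
    have "(t * a) *s p + (t * b) *s q = t *s (a *s p + b *s q)" by (simp add: cvec3_eq_iff algebra_simps)
    thus ?thesis using assms homogD unfolding tform_def by metis
  qed
  moreover have "polyfun (\<lambda>v. F (v $ 1 *s p + v $ 2 *s q))"
    by (rule polyfun_compose[of F]) (use assms in \<open>auto simp: tform_def intro!: polyfun_intros\<close>)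
  ultimately show ?thesis by (simp add: bform_def)
qed

lemma tform_mult: "tform n f \<Longrightarrow> tform m g \<Longrightarrow> tform (n + m) (\<lambda>v. f v * g v)"
  by (simp add: tform_def homog_def power_add polyfun_mult)

lemma tform_diff: "tform n f \<Longrightarrow> tform n g \<Longrightarrow> tform n (\<lambda>v. f v - g v)"
  by (simp add: tform_def homog_def polyfun_diff algebra_simps)

lemma grad_at_0:
  assumes "tform n h" "n \<ge> 2" shows "grad h 0 = 0"
proof (rule grad_unique)
  show "polyfun h" using assms by (simp add: tform_def)
  fix t
  have "h (0 + s *s t) = s ^ n * h t" for s using assms by (simp add: tform_def homog_def)
  thus "((\<lambda>s. h (0 + s *s t)) has_field_derivative dot 0 t) (at 0)"
    using assms(2) by (auto intro!: derivative_eq_intros simp: dot_lin)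
qed

lemma grad_tform:
  assumes "tform n h" "n \<ge> 2" shows "tform (n - 1) (\<lambda>v. grad h v $ i)"
proof -
  have h: "polyfun h" "homog n h" using assms by (auto simp: tform_def)
  have "grad h (s *s v) = s ^ (n - 1) *s grad h v" for s v
  proof (cases "s = 0")
    case True
    thus ?thesis using grad_at_0[OF assms] assms(2) by (simp add: zero_power cvec3_eq_iff)
  next
    case False
    have "s ^ n = s * s ^ (n - 1)" using assms(2) by (metis One_nat_def Suc_1 Suc_le_D diff_Suc_1 power_Suc)
    thus ?thesis using grad_homog[OF h, of s v] False by (simp add: cvec3_eq_iff)
  qed
  thus ?thesis using polyfun_grad[OF h(1)] by (simp add: tform_def homog_def)
qed

lemma tform_dot: "tform 1 (dot u)"
  unfolding tform_def homog_def dot_def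
  by (auto simp: algebra_simps intro!: polyfun_intros)

lemma v3_basis: "a *s v3 0 1 0 + b *s v3 0 0 1 = v3 0 a b"
  by (simp add: cvec3_eq_iff)

text \<open>After a linear substitution the zero is \<open>(0, 1)\<close>, and the form has no term without the first
  variable.\<close>

lemma bform_div:
  assumes "bform (Suc m) T" "T s t = 0" "s \<noteq> 0 \<or> t \<noteq> 0"
  obtains T' where "bform m T'" "\<And>a b. T a b = (a * t - b * s) * T' a b"
proof -
  obtain e1 e2 where e: "e1 * t - e2 * s = 1"
  proof (cases "t = 0")
    case True
    thus ?thesis using that[of 0 "- 1 / s"] assms(3) by simp
  next
    case False
    thus ?thesis using that[of "1 / t" 0] by simp
  qed
  define U where "U \<alpha> \<beta> = T (\<alpha> * e1 + \<beta> * s) (\<alpha> * e2 + \<beta> * t)" for \<alpha> \<beta>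
  have "bform (Suc m) U" unfolding U_def[abs_def] by (rule bform_subst[OF assms(1)])
  then obtain c where c: "\<And>a b. U a b = (\<Sum>i\<le>Suc m. c i * a ^ i * b ^ (Suc m - i))"
    using bform_coeffs by blast
  have "(\<Sum>i\<in>{..Suc m}. c i * 0 ^ i * 1 ^ (Suc m - i)) = c 0"
    by (simp add: sum.atMost_Suc_shift del: sum.atMost_Suc)
  hence "U 0 1 = c 0" unfolding c .
  moreover have "U 0 1 = 0" using assms(2) by (simp add: U_def)
  ultimately have c0: "c 0 = 0" by simp
  define U' where "U' a b = (\<Sum>i\<le>m. c (Suc i) * a ^ i * b ^ (m - i))" for a b
  have U': "U a b = a * U' a b" for a b
    unfolding c U'_def by (simp add: sum.atMost_Suc_shift c0 sum_distrib_left mult_ac del: sum.atMost_Suc)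
  have "bform m U'" unfolding bform_def
  proof (intro conjI allI)
    show "polyfun (\<lambda>v. U' (v $ 1) (v $ 2))" unfolding U'_def
      by (intro polyfun_intros polyfun_nth polyfun_const)
    have "c (Suc i) * (t * a) ^ i * (t * b) ^ (m - i) = t ^ m * (c (Suc i) * a ^ i * b ^ (m - i))"
      if "i \<le> m" for t a b i
    proof -
      have "t ^ m = t ^ i * t ^ (m - i)" using that by (simp flip: power_add)
      thus ?thesis by (simp add: power_mult_distrib)
    qed
    thus "U' (t * a) (t * b) = t ^ m * U' a b" for t a b
      unfolding U'_def sum_distrib_left by (intro sum.cong) auto
  qed
  hence "bform m (\<lambda>a b. U' (a * t + b * (- s)) (a * (- e2) + b * e1))" by (rule bform_subst)
  moreover have "T a b = (a * t - b * s) * U' (a * t + b * (- s)) (a * (- e2) + b * e1)" for a b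
  proof -
    have "(a * t + b * (- s)) * e1 + (a * (- e2) + b * e1) * s = a * (e1 * t - e2 * s)"
         "(a * t + b * (- s)) * e2 + (a * (- e2) + b * e1) * t = b * (e1 * t - e2 * s)"
      by (simp_all add: algebra_simps)
    hence "T a b = U (a * t + b * (- s)) (a * (- e2) + b * e1)" by (simp add: U_def e)
    thus ?thesis by (simp add: U')
  qed
  ultimately show ?thesis using that by blast
qed

lemma poly_no_zero_const:
  fixes p :: "complex poly" assumes "\<And>x. poly p x \<noteq> 0" shows "poly p x = poly p y"
  using fundamental_theorem_of_algebra[of p] assms unfolding constant_def by metis

text \<open>If \<open>T\<close> has no zero with second coordinate 1, then \<open>T a 1\<close> is constant by the fundamental theorem
  of algebra, and letting \<open>b\<close> tend to 0 in \<open>T 1 b = b\<^sup>n T (1/b) 1\<close> gives a zero at \<open>(1, 0)\<close>.\<close>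

lemma bform_root:
  assumes "bform n T" "n \<ge> 1" obtains s t where "s \<noteq> 0 \<or> t \<noteq> 0" "T s t = 0"
proof (cases "\<exists>a. T a 1 = 0")
  case False
  obtain p where p: "\<And>a. T a 1 = poly p a"
    using polyfun_curve[of "\<lambda>v. T (v $ 1) (v $ 2)" "\<lambda>t. v3 t 1 0"] assms(1)
  proof -
    have "\<exists>p. \<forall>t. v3 t 1 0 $ i = poly p t" for i
      using exhaust_3[of i] by (auto intro: exI[of _ "[:0, 1:]"] exI[of _ 1] exI[of _ 0])
    thus ?thesis using polyfun_curve[of "\<lambda>v. T (v $ 1) (v $ 2)" "\<lambda>t. v3 t 1 0"] assms(1) that
      by (auto simp: bform_def)
  qed
  have eq: "T 1 b = b ^ n * T 0 1" if "b \<noteq> 0" for b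
  proof -
    have "T 1 b = b ^ n * T (1 / b) 1" using bform_scale[OF assms(1), of b "1 / b" 1] that by simp
    thus ?thesis using poly_no_zero_const[of p] False p by metis
  qed
  have "((\<lambda>b. T (v3 1 b 0 $ 1) (v3 1 b 0 $ 2)) \<longlongrightarrow> T (v3 1 0 0 $ 1) (v3 1 0 0 $ 2)) (at 0)"
    using assms(1) unfolding bform_def
    by (intro polyfun_tendsto[of "\<lambda>v. T (v $ 1) (v $ 2)"] tendsto_cvec3) (auto intro: tendsto_intros)
  hence 1: "((\<lambda>b. T 1 b) \<longlongrightarrow> T 1 0) (at 0)" by simp
  have "((\<lambda>b. b ^ n * T 0 1) \<longlongrightarrow> 0 ^ n * T 0 1) (at 0)" by (intro tendsto_intros)
  hence "((\<lambda>b. T 1 b) \<longlongrightarrow> 0 ^ n * T 0 1) (at 0)"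
    by (rule Lim_transform_eventually) (auto simp: eq eventually_at_filter)
  hence "T 1 0 = 0" using LIM_unique[OF 1] assms(2) by (simp add: zero_power)
  thus ?thesis using that[of 1 0] by simp
qed (use that[of _ 1] in auto)

lemma bform_factor:
  assumes "bform n T"
  obtains \<kappa> s t where "\<And>j. s j \<noteq> 0 \<or> t j \<noteq> (0::complex)" "\<And>a b. T a b = \<kappa> * (\<Prod>j<n. a * t j - b * s j)"
proof -
  have "\<exists>\<kappa> s t. (\<forall>j. s j \<noteq> 0 \<or> t j \<noteq> (0::complex)) \<and> (\<forall>a b. T a b = \<kappa> * (\<Prod>j<n. a * t j - b * s j))"
    using assms
  proof (induction n arbitrary: T)
    case 0
    have "T a b = T 0 0" for a b using bform_scale[OF 0, of 0 a b] by simp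
    thus ?case by (intro exI[of _ "T 0 0"] exI[of _ "\<lambda>_. 1"]) auto
  next
    case (Suc n)
    obtain s0 t0 where st: "s0 \<noteq> 0 \<or> t0 \<noteq> 0" "T s0 t0 = 0" using bform_root[OF Suc.prems] by auto
    obtain T' where T': "bform n T'" "\<And>a b. T a b = (a * t0 - b * s0) * T' a b"
      using bform_div[OF Suc.prems st(2,1)] by blast
    obtain \<kappa> s t where IH: "\<forall>j. s j \<noteq> 0 \<or> t j \<noteq> (0::complex)" "\<forall>a b. T' a b = \<kappa> * (\<Prod>j<n. a * t j - b * s j)"
      using Suc.IH[OF T'(1)] by blast
    have "(\<Prod>j<n. a * (t(n := t0)) j - b * (s(n := s0)) j) = (\<Prod>j<n. a * t j - b * s j)" for a b
      by (intro prod.cong) auto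
    hence "T a b = \<kappa> * (\<Prod>j<Suc n. a * (t(n := t0)) j - b * (s(n := s0)) j)" for a b
      using T'(2) IH(2) by simp
    moreover have "\<forall>j. (s(n := s0)) j \<noteq> 0 \<or> (t(n := t0)) j \<noteq> 0" using IH(1) st(1) by simp
    ultimately show ?case by blast
  qed
  thus ?thesis using that by blast
qed

lemma bform_distinct_roots:
  fixes s t :: "nat \<Rightarrow> complex"
  assumes "bform n T" "\<And>i. i < n \<Longrightarrow> T (s i) (t i) = 0" "\<And>i. i < n \<Longrightarrow> s i \<noteq> 0 \<or> t i \<noteq> 0"
    and "\<And>i j. i < j \<Longrightarrow> j < n \<Longrightarrow> s i * t j \<noteq> t i * s j"
  shows "\<exists>c. \<forall>a b. T a b = c * (\<Prod>j<n. a * t j - b * s j)"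
  using assms
proof (induction n arbitrary: T)
  case 0
  have "T a b = T 0 0" for a b using bform_scale[OF 0(1), of 0 a b] by simp
  thus ?case by (intro exI[of _ "T 0 0"]) auto
next
  case (Suc n)
  obtain T' where T': "bform n T'" "\<And>a b. T a b = (a * t n - b * s n) * T' a b"
    using bform_div[OF Suc.prems(1), of "s n" "t n"] Suc.prems by blast
  have "T' (s i) (t i) = 0" if "i < n" for i
    using T'(2)[of "s i" "t i"] Suc.prems(2)[of i] Suc.prems(4)[of i n] that by auto
  then obtain c where "\<forall>a b. T' a b = c * (\<Prod>j<n. a * t j - b * s j)"
    using Suc.IH[OF T'(1)] Suc.prems by auto
  thus ?case using T'(2) by auto
qed

text \<open>A zero of a polynomial in two variables is never isolated. A polynomial without zeros outside the
  origin is constant on every line that avoids the origin, by the fundamental theorem of algebra.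
  Since these lines connect all other points, it is constant, also at the origin by continuity.\<close>

lemma poly2_nonvanishing:
  assumes "polyfun (\<lambda>v. r (v $ 1) (v $ 2))" "\<And>y z. y \<noteq> 0 \<or> z \<noteq> 0 \<Longrightarrow> r y z \<noteq> (0::complex)"
  shows "r 0 0 \<noteq> 0"
proof -
  have pol: "\<exists>p. \<forall>t. r (a + b * t) (c + d * t) = poly p t" for a b c d
  proof -
    have "\<exists>p. \<forall>t. v3 (a + b * t) (c + d * t) 0 $ i = poly p t" for i
      using exhaust_3[of i] by (auto intro: exI[of _ "[:a, b:]"] exI[of _ "[:c, d:]"] exI[of _ 0])
    from polyfun_curve[OF assms(1) this] show ?thesis by simp
  qed
  have const: "r (a + b * x) (c + d * x) = r (a + b * y) (c + d * y)"
    if "\<And>t. a + b * t \<noteq> 0 \<or> c + d * t \<noteq> 0" for a b c d x y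
  proof -
    obtain p where p: "\<forall>t. r (a + b * t) (c + d * t) = poly p t" using pol by blast
    hence "poly p t \<noteq> 0" for t using assms(2) that by metis
    thus ?thesis using p poly_no_zero_const by metis
  qed
  have 1: "r 1 z = r 1 0" for z using const[of 1 0 0 1 z 0] by simp
  have 2: "r 0 z = r 1 0" if "z \<noteq> 0" for z using const[of 0 1 z 0 0 1] that 1 by simp
  have "((\<lambda>z. r (v3 0 z 0 $ 1) (v3 0 z 0 $ 2)) \<longlongrightarrow> r (v3 0 0 0 $ 1) (v3 0 0 0 $ 2)) (at 0)"
    by (intro polyfun_tendsto[OF assms(1)] tendsto_cvec3) (auto intro: tendsto_intros)
  hence "((\<lambda>z. r 0 z) \<longlongrightarrow> r 0 0) (at 0)" by simp
  moreover have "((\<lambda>z. r 0 z) \<longlongrightarrow> r 1 0) (at 0)"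
    by (rule Lim_transform_eventually[OF tendsto_const]) (auto simp: 2 eventually_at_filter)
  ultimately have "r 0 0 = r 1 0" using LIM_unique by blast
  thus ?thesis using assms(2) by simp
qed

section \<open>Linear changes of coordinates\<close>

definition lin3 :: "complex^3 \<Rightarrow> complex^3 \<Rightarrow> complex^3 \<Rightarrow> complex^3 \<Rightarrow> complex^3" where
  "lin3 p q r v = v $ 1 *s p + v $ 2 *s q + v $ 3 *s r"

lemma tform_lin3: assumes "tform n F" shows "tform n (\<lambda>v. F (lin3 p q r v))"
proof -
  have "lin3 p q r (t *s v) = t *s lin3 p q r v" for t v
    by (simp add: lin3_def cvec3_eq_iff algebra_simps)
  moreover have "polyfun (\<lambda>v. F (lin3 p q r v))"
    unfolding lin3_def
    by (rule polyfun_compose[of F]) (use assms in \<open>auto simp: tform_def intro!: polyfun_intros\<close>)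
  ultimately show ?thesis using assms by (simp add: tform_def homog_def)
qed

lemma lin3_inj:
  assumes "dot p (crs q r) \<noteq> 0" "lin3 p q r v = 0" shows "v = 0"
proof -
  have "dot (lin3 p q r v) (crs q r) = v $ 1 * dot p (crs q r)"
       "dot (lin3 p q r v) (crs r p) = v $ 2 * dot p (crs q r)"
       "dot (lin3 p q r v) (crs p q) = v $ 3 * dot p (crs q r)"
    by (simp_all add: lin3_def dot_def crs_def algebra_simps)
  thus ?thesis using assms by (simp add: cvec3_eq_iff dot_lin)
qed

lemma exists_basis:
  assumes "p \<noteq> 0" obtains q r where "dot p (crs q r) \<noteq> 0"
proof -
  obtain e where e: "dot p e \<noteq> 0" using exists_dot_ne_0[OF assms] .
  hence "e \<noteq> 0" by (auto simp: dot_lin)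
  then obtain q where "q \<noteq> 0" "dot q e = 0" using exists_orth by blast
  then obtain r where "crs q r = e" using orth_basis[OF \<open>e \<noteq> 0\<close>] by metis
  thus ?thesis using that e by metis
qed

lemma lin3_first [simp]: "lin3 p q r (v3 1 0 0) = p"
  by (simp add: lin3_def)

definition coords3 :: "complex^3 \<Rightarrow> complex^3 \<Rightarrow> complex^3 \<Rightarrow> complex^3 \<Rightarrow> complex^3" where
  "coords3 p q r v = (1 / dot p (crs q r)) *s v3 (dot v (crs q r)) (dot v (crs r p)) (dot v (crs p q))"

lemma coords3_lin3:
  assumes "dot p (crs q r) \<noteq> 0" shows "coords3 p q r (lin3 p q r v) = v"
proof -
  have "dot (lin3 p q r v) (crs q r) = v $ 1 * dot p (crs q r)"
       "dot (lin3 p q r v) (crs r p) = v $ 2 * dot p (crs q r)"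
       "dot (lin3 p q r v) (crs p q) = v $ 3 * dot p (crs q r)"
    by (simp_all add: lin3_def dot_def crs_def algebra_simps)
  thus ?thesis using assms by (simp add: cvec3_eq_iff coords3_def)
qed

lemma lin3_diff: "lin3 p q r (v - w) = lin3 p q r v - lin3 p q r w"
  by (simp add: lin3_def cvec3_eq_iff algebra_simps)

lemma lin3_coords3:
  assumes D: "dot p (crs q r) \<noteq> 0" shows "lin3 p q r (coords3 p q r v) = v"
proof -
  define w where "w = dot v (crs q r) *s p + dot v (crs r p) *s q + dot v (crs p q) *s r"
  have "w $ 1 = dot p (crs q r) * v $ 1" "w $ 2 = dot p (crs q r) * v $ 2" "w $ 3 = dot p (crs q r) * v $ 3"
    unfolding w_def by (simp_all add: dot_def crs_def algebra_simps)
  moreover have "lin3 p q r (coords3 p q r v) = (1 / dot p (crs q r)) *s w"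
    by (simp add: lin3_def coords3_def w_def cvec3_eq_iff algebra_simps)
  ultimately show ?thesis using D by (simp add: cvec3_eq_iff)
qed

lemma polyfun_coords3: "polyfun (\<lambda>v. coords3 p q r v $ i)"
proof -
  have d: "polyfun (\<lambda>v. dot v w)" for w by (intro polyfun_dot) auto
  have "polyfun (\<lambda>v. coords3 p q r v $ 1)" "polyfun (\<lambda>v. coords3 p q r v $ 2)" "polyfun (\<lambda>v. coords3 p q r v $ 3)"
    using polyfun_mult[OF polyfun_const d, of "1 / dot p (crs q r)"] by (simp_all add: coords3_def)
  thus ?thesis using exhaust_3[of i] by auto
qed

section \<open>Elimination\<close>

text \<open>Specialisation of the second and third variable, leaving a polynomial in the first one.\<close>

definition spec :: "complex \<Rightarrow> complex \<Rightarrow> complex poly poly \<Rightarrow> complex" where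
  "spec y z P = poly (poly P [:y:]) z"

lemma spec_hom: "comm_ring_hom (spec y z)"
  by unfold_locales (simp_all add: spec_def)

lemma poly_map_spec: "poly (map_poly (spec y z) G) x = eval3 G (v3 x y z)"
proof (induction G)
  case (pCons a G)
  interpret comm_ring_hom "spec y z" by (rule spec_hom)
  show ?case using pCons
    by (simp add: map_poly_pCons eval3_pCons spec_def)
qed simp

lemma polyfun_spec: "polyfun (\<lambda>v. spec (v $ 1) (v $ 2) P)"
proof -
  have "polyfun (\<lambda>v. eval3 [:P:] (v3 0 (v $ 1) (v $ 2)))"
    by (rule polyfun_v3) auto
  thus ?thesis by (simp add: eval3_pCons spec_def)
qed

text \<open>The coefficient of the \<open>i\<close>-th power of the first variable is a form of degree \<open>n - i\<close> in the other
  two. So it is zero for \<open>i > n\<close> and a constant for \<open>i = n\<close>, the value at \<open>(1, 0, 0)\<close>.\<close>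

lemma homogeneous_lead:
  assumes "homogeneous n G" "eval3 G (v3 1 0 0) \<noteq> 0"
  shows "degree G = n" "lead_coeff G = [:[:eval3 G (v3 1 0 0):]:]"
proof -
  have z: "coeff G i = 0" if "i > n" for i
    using that by (intro poly_eqI) (simp add: homogeneous_coeff_0[OF assms(1)])
  have c: "coeff G n = [:[:coeff (coeff (coeff G n) 0) 0:]:]"
  proof -
    have "coeff (coeff (coeff G n) j) k = 0" if "j > 0 \<or> k > 0" for j k
      using that by (intro homogeneous_coeff_0[OF assms(1)]) auto
    thus ?thesis by (intro poly_eqI) (auto simp: coeff_pCons split: nat.splits)
  qed
  have "degree G \<le> n" using z by (meson degree_le)
  have "eval3 G (v3 1 0 0) = spec 0 0 (poly G 1)" by (simp only: eval3_v3 spec_def one_pCons[symmetric])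
  also have "poly G 1 = (\<Sum>i\<le>n. coeff G i)"
    using poly_le_degree_sum[OF \<open>degree G \<le> n\<close>, of 1] by simp
  also have "spec 0 0 \<dots> = (\<Sum>i\<le>n. spec 0 0 (coeff G i))"
    by (simp add: spec_def poly_sum)
  also have "\<dots> = (\<Sum>i\<in>{n}. spec 0 0 (coeff G i))"
  proof (rule sum.mono_neutral_right)
    show "\<forall>i\<in>{..n} - {n}. spec 0 0 (coeff G i) = 0"
    proof
      fix i assume "i \<in> {..n} - {n}"
      hence "coeff (coeff (coeff G i) 0) 0 = 0" by (intro homogeneous_coeff_0[OF assms(1)]) auto
      moreover have "spec 0 0 P = coeff (coeff P 0) 0" for P
        by (simp add: spec_def poly_0_coeff_0)
      ultimately show "spec 0 0 (coeff G i) = 0" by simp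
    qed
  qed auto
  finally have e: "eval3 G (v3 1 0 0) = coeff (coeff (coeff G n) 0) 0"
    by (simp add: spec_def poly_0_coeff_0)
  hence "coeff G n \<noteq> 0" using assms(2) by auto
  hence "degree G \<ge> n" by (rule le_degree)
  thus "degree G = n" using \<open>degree G \<le> n\<close> by simp
  thus "lead_coeff G = [:[:eval3 G (v3 1 0 0):]:]" using c e by simp
qed

lemma map_spec_degree:
  assumes "lead_coeff G = [:[:c:]:]" "c \<noteq> 0"
  shows "degree (map_poly (spec y z) G) = degree G"
proof -
  have "spec y z (lead_coeff G) \<noteq> 0" unfolding assms(1) using assms(2) by (simp add: spec_def)
  moreover have "spec y z 0 = 0" by (simp add: spec_def)
  ultimately have "coeff (map_poly (spec y z) G) (degree G) \<noteq> 0" by (simp add: coeff_map_poly)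
  hence "degree G \<le> degree (map_poly (spec y z) G)" by (rule le_degree)
  thus ?thesis using degree_map_poly_le[of "spec y z" G] by simp
qed

lemma gcd_root:
  fixes p q :: "complex poly"
  assumes "degree (gcd p q) \<noteq> 0" obtains x where "poly p x = 0" "poly q x = 0"
proof -
  have "\<not> constant (poly (gcd p q))" using assms by (simp add: constant_degree)
  then obtain x where "poly (gcd p q) x = 0" using fundamental_theorem_of_algebra by blast
  thus ?thesis using that by (metis gcd_dvd1 gcd_dvd2 dvdE mult_zero_left poly_mult)
qed

lemma root_gcd:
  fixes p q :: "complex poly"
  assumes "poly p x = 0" "poly q x = 0" "p \<noteq> 0"
  shows "degree (gcd p q) \<noteq> 0"
proof
  assume d: "degree (gcd p q) = 0"
  have "[:-x, 1:] dvd gcd p q" using assms by (simp add: poly_eq_0_iff_dvd)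
  moreover have "gcd p q \<noteq> 0" using assms by simp
  ultimately have "degree [:-x, 1:] \<le> degree (gcd p q)" by (rule dvd_imp_degree_le)
  thus False using d by simp
qed

text \<open>Two curves in the projective plane meet. As neither curve passes through \<open>(1, 0, 0)\<close>, the
  degrees in the first variable do not drop under specialisation, so the zeros of the resultant are
  the points over which there is a common zero. It vanishes at the origin, and a polynomial in two
  variables cannot vanish at the origin only.\<close>

lemma common_zero_of_forms_off_vertex:
  assumes "homogeneous a A" "homogeneous b B" "a \<ge> 1" "b \<ge> 1"
    and "eval3 A (v3 1 0 0) \<noteq> 0" "eval3 B (v3 1 0 0) \<noteq> 0"
  shows "\<exists>v. v \<noteq> 0 \<and> eval3 A v = 0 \<and> eval3 B v = 0"
proof -
  note lA = homogeneous_lead[OF assms(1,5)] and lB = homogeneous_lead[OF assms(2,6)]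
  define r where "r y z = spec y z (resultant A B)" for y z
  have r: "r y z = 0 \<longleftrightarrow> degree (gcd (map_poly (spec y z) A) (map_poly (spec y z) B)) \<noteq> 0" for y z
  proof -
    interpret comm_ring_hom "spec y z" by (rule spec_hom)
    have "r y z = resultant (map_poly (spec y z) A) (map_poly (spec y z) B)"
      unfolding r_def by (intro resultant_map_poly[symmetric] map_spec_degree[OF lA(2) assms(5)]
          map_spec_degree[OF lB(2) assms(6)])
    thus ?thesis by (simp add: resultant_0_gcd)
  qed
  \<comment> \<open>at the origin both specialised polynomials are multiples of a power of the first variable\<close>
  have "r 0 0 = 0"
  proof -
    have 0: "v3 0 0 0 = 0" by (simp add: cvec3_eq_iff)
    have "eval3 A (v3 0 0 0) = 0" "eval3 B (v3 0 0 0) = 0" unfolding 0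
      using homog_zero[OF homogeneous_imp_homog] assms by blast+
    moreover have "map_poly (spec 0 0) A \<noteq> 0"
      using assms(3,5) lA map_spec_degree[OF lA(2) assms(5), of 0 0] by force
    ultimately show ?thesis unfolding r by (intro root_gcd[of _ 0]) (simp_all add: poly_map_spec)
  qed
  moreover have "polyfun (\<lambda>v. r (v $ 1) (v $ 2))" unfolding r_def by (rule polyfun_spec)
  ultimately obtain y z where yz: "y \<noteq> 0 \<or> z \<noteq> 0" "r y z = 0" using poly2_nonvanishing[of r] by blast
  then obtain x where "poly (map_poly (spec y z) A) x = 0" "poly (map_poly (spec y z) B) x = 0"
    using r gcd_root by metis
  hence "eval3 A (v3 x y z) = 0" "eval3 B (v3 x y z) = 0" by (simp_all add: poly_map_spec)
  moreover have "v3 x y z \<noteq> 0" using yz by (auto simp: cvec3_eq_iff)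
  ultimately show ?thesis by blast
qed

lemma common_zero_of_forms:
  assumes "tform a A" "tform b B" "a \<ge> 1" "b \<ge> 1"
  shows "\<exists>v. v \<noteq> 0 \<and> A v = 0 \<and> B v = 0"
proof -
  have zero: "\<exists>v. v \<noteq> 0 \<and> H v = 0" if H: "tform k H" "k \<ge> 1" for H k
  proof -
    have "bform k (\<lambda>a b. H (a *s v3 1 0 0 + b *s v3 0 1 0))" by (rule tform_bform[OF H(1)])
    from bform_root[OF this H(2)] obtain s t
      where "s \<noteq> 0 \<or> t \<noteq> 0" "H (s *s v3 1 0 0 + t *s v3 0 1 0) = 0" by blast
    moreover from this(1) have "s *s v3 1 0 0 + t *s v3 0 1 0 \<noteq> 0" by (auto simp: cvec3_eq_iff)
    ultimately show ?thesis by blast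
  qed
  show ?thesis
  proof (cases "(\<exists>v. A v \<noteq> 0) \<and> (\<exists>v. B v \<noteq> 0)")
    case True
    then obtain p where p: "A p \<noteq> 0" "B p \<noteq> 0"
      using polyfun_common_ne_0[of A B] assms by (auto simp: tform_def)
    have "p \<noteq> 0" using p assms homog_zero[of a A] by (auto simp: tform_def)
    then obtain q r where qr: "dot p (crs q r) \<noteq> 0" using exists_basis by blast
    have t: "tform a (\<lambda>v. A (lin3 p q r v))" "tform b (\<lambda>v. B (lin3 p q r v))"
      using assms by (auto intro: tform_lin3)
    then obtain GA GB where G: "(\<lambda>v. A (lin3 p q r v)) = eval3 GA" "(\<lambda>v. B (lin3 p q r v)) = eval3 GB"
      by (auto simp: tform_def polyfun_def)
    have "homogeneous a GA" "homogeneous b GB"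
      using t unfolding G tform_def by (auto intro: homog_imp_homogeneous)
    moreover have "eval3 GA (v3 1 0 0) \<noteq> 0" "eval3 GB (v3 1 0 0) \<noteq> 0"
      unfolding G[symmetric] using p by simp_all
    ultimately obtain v where "v \<noteq> 0" "eval3 GA v = 0" "eval3 GB v = 0"
      using common_zero_of_forms_off_vertex assms(3,4) by blast
    thus ?thesis unfolding G[symmetric] using lin3_inj[OF qr] by blast
  next
    case False
    thus ?thesis using zero[OF assms(1,3)] zero[OF assms(2,4)] by blast
  qed
qed

lemma zero_on_plane:
  assumes "tform n H" "n \<ge> 1" shows "\<exists>v. v \<noteq> 0 \<and> dot u v = 0 \<and> H v = 0"
  using common_zero_of_forms[OF tform_dot[of u] assms(1)] assms(2) by auto

text \<open>Factors of forms are forms. On the ray through a point where the product does not vanish, a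
  factor is a monomial; its exponent cannot jump, because finitely many of the closed conditions
  \<open>A (2 v) = 2\<^sup>k A v\<close> cover the space.\<close>

lemma factor_ray:
  fixes p q :: "complex poly"
  assumes "\<And>t. poly p t * poly q t = t ^ n * c" "c \<noteq> 0"
  obtains k where "k \<le> n" "\<And>t. poly p t = t ^ k * poly p 1"
proof -
  have "poly (p * q) t = poly (monom c n) t" for t using assms(1) by (simp add: poly_monom)
  hence pq: "p * q = monom c n" using poly_eq_poly_eq_iff by blast
  hence "p \<noteq> 0" "q \<noteq> 0" using assms(2) by auto
  obtain r where r: "p = [:- 0, 1:] ^ order 0 p * r" "\<not> [:- 0, 1:] dvd r"
    using order_decomp[OF \<open>p \<noteq> 0\<close>] by blast
  define k where "k = order 0 p"
  have pk: "poly p t = t ^ k * poly r t" for t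
    by (subst r(1)) (simp add: k_def poly_power)
  have r0: "poly r t \<noteq> 0" for t
  proof
    assume z: "poly r t = 0"
    hence "t ^ n * c = 0" using assms(1)[of t] pk by simp
    hence "t = 0" using assms(2) by simp
    thus False using z r(2) by (simp add: poly_eq_0_iff_dvd)
  qed
  hence pt: "poly p t = t ^ k * poly p 1" for t
  proof -
    have "poly p t = t ^ k * poly r 1" using pk[of t] poly_no_zero_const[of r t 1, OF r0] by simp
    moreover have "poly p 1 = poly r 1" using pk[of 1] by simp
    ultimately show ?thesis by (simp only:)
  qed
  have "degree p = k"
  proof -
    have "poly p t = poly (monom (poly p 1) k) t" for t using pt[of t] by (simp add: poly_monom)
    hence "p = monom (poly p 1) k" using poly_eq_poly_eq_iff by blast
    thus ?thesis using \<open>p \<noteq> 0\<close> degree_monom_eq[of "poly p 1" k] by (metis monom_eq_0)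
  qed
  moreover have "degree p + degree q = n" using pq \<open>p \<noteq> 0\<close> \<open>q \<noteq> 0\<close> assms(2)
    by (metis degree_mult_eq degree_monom_eq)
  ultimately have "k \<le> n" by simp
  thus ?thesis using pt by (rule that)
qed

lemma factor_of_form:
  assumes A: "polyfun A" and B: "polyfun B" and F: "homog n (\<lambda>v. A v * B v)" "\<exists>v. A v * B v \<noteq> 0"
  shows "\<exists>k. homog k A"
proof -
  have ray: "\<exists>k\<le>n. \<forall>t. A (t *s v) = t ^ k * A v" if nz: "A v * B v \<noteq> 0" for v
  proof -
    obtain p q where "\<forall>t. A (0 + t *s v) = poly p t" "\<forall>t. B (0 + t *s v) = poly q t"
      using polyfun_line[OF A] polyfun_line[OF B] by blast
    hence pq: "\<And>t. A (t *s v) = poly p t" "\<And>t. B (t *s v) = poly q t" by auto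
    have "poly p t * poly q t = t ^ n * (A v * B v)" for t
      using homogD[OF F(1), of t v] by (simp add: pq)
    then obtain k where "k \<le> n" "\<And>t. poly p t = t ^ k * poly p 1" using factor_ray[OF _ nz] by metis
    moreover have "poly p 1 = A v" using pq(1)[of 1] by simp
    ultimately show ?thesis using pq(1) by metis
  qed
  have sc: "polyfun (\<lambda>v. A (t *s v) - t ^ k * A v)" for t k
  proof (rule polyfun_diff)
    have "polyfun (\<lambda>v. (t *s v) $ i)" for i by (simp add: polyfun_mult)
    thus "polyfun (\<lambda>v. A (t *s v))" by (rule polyfun_compose[OF A])
    show "polyfun (\<lambda>v. t ^ k * A v)" by (rule polyfun_mult[OF polyfun_const A])
  qed
  have "(\<Prod>k\<le>n. A (2 *s v) - 2 ^ k * A v) = 0" for v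
  proof (rule polyfun_zero_of_mult[of "\<lambda>v. \<Prod>k\<le>n. A (2 *s v) - 2 ^ k * A v" "\<lambda>v. A v * B v"])
    fix v assume "A v * B v \<noteq> 0"
    then obtain k where "k \<le> n" "A (2 *s v) = 2 ^ k * A v" using ray by blast
    thus "(\<Prod>k\<le>n. A (2 *s v) - 2 ^ k * A v) = 0" by (intro prod_zero) auto
  qed (use A B F sc in \<open>auto intro!: polyfun_prod polyfun_mult\<close>)
  hence *: "\<not> (\<exists>v. \<forall>k\<in>{..n}. A (2 *s v) - 2 ^ k * A v \<noteq> 0)" by (auto simp: prod_zero_iff)
  have "\<exists>k. \<forall>v. A (2 *s v) - 2 ^ k * A v = 0"
  proof (rule ccontr)
    assume "\<not> ?thesis"
    hence "\<exists>v. \<forall>k\<in>{..n}. A (2 *s v) - 2 ^ k * A v \<noteq> 0"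
      by (intro polyfun_prod_ne_0 sc) auto
    thus False using * by blast
  qed
  then obtain k where k: "\<And>v. A (2 *s v) = 2 ^ k * A v" by auto
  have "A (t *s v) - t ^ k * A v = 0" for t v
  proof (rule polyfun_zero_of_mult[of "\<lambda>v. A (t *s v) - t ^ k * A v" "\<lambda>v. A v * B v"])
    fix v assume nz: "A v * B v \<noteq> 0"
    then obtain l where l: "\<forall>t. A (t *s v) = t ^ l * A v" using ray by blast
    have "(2::complex) ^ l = 2 ^ k" using l k[of v] nz by auto
    hence "norm ((2::complex) ^ l) = norm ((2::complex) ^ k)" by simp
    hence "l = k" by (simp add: norm_power)
    thus "A (t *s v) - t ^ k * A v = 0" using l by simp
  qed (use A B F sc in \<open>auto intro!: polyfun_mult\<close>)
  thus ?thesis by (auto simp: homog_def intro!: exI[of _ k])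
qed

lemma homog_0_const: assumes "homog 0 h" shows "h v = h 0"
  using homogD[OF assms, of 0 v] by simp

lemma factors_of_form:
  assumes A: "polyfun A" and B: "polyfun B" and F: "homog n (\<lambda>v. A v * B v)" "\<exists>v. A v * B v \<noteq> 0"
  obtains a b where "tform a A" "tform b B" "a + b = n"
proof -
  obtain a where a: "homog a A" using factor_of_form[OF assms] by blast
  have "\<exists>b. homog b B" using factor_of_form[of B A n] assms by (simp add: mult.commute)
  then obtain b where b: "homog b B" by blast
  obtain v where v: "A v * B v \<noteq> 0" using F by blast
  have "2 ^ n * (A v * B v) = 2 ^ (a + b) * (A v * B v)"
  proof -
    have "2 ^ n * (A v * B v) = A (2 *s v) * B (2 *s v)" using homogD[OF F(1), of 2 v] by simp
    also have "\<dots> = (2 ^ a * A v) * (2 ^ b * B v)" by (simp only: homogD[OF a] homogD[OF b])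
    finally show ?thesis by (simp only: power_add mult_ac)
  qed
  hence "(2::complex) ^ n = 2 ^ (a + b)" using v by simp
  hence "norm ((2::complex) ^ n) = norm ((2::complex) ^ (a + b))" by simp
  hence "(2::real) ^ n = 2 ^ (a + b)" by (simp only: norm_power norm_numeral)
  hence "a + b = n" by simp
  thus ?thesis using that a b A B by (simp add: tform_def)
qed

section \<open>Squarefree forms have generically distinct zeros\<close>

text \<open>Squarefreeness in terms of functions, so that it can be transported along linear changes of
  coordinates; by \<open>sqfree_iff_squarefree\<close> it is the usual notion.\<close>

definition sqfree :: "(complex^3 \<Rightarrow> complex) \<Rightarrow> bool" where
  "sqfree F \<longleftrightarrow> (\<exists>v. F v \<noteq> 0) \<and>
     (\<forall>h k. polyfun h \<longrightarrow> polyfun k \<longrightarrow> (\<forall>v. F v = h v ^ 2 * k v) \<longrightarrow> (\<exists>c. \<forall>v. h v = c))"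

lemma unit_polyfun_const:
  assumes "polyfun h" "polyfun k" "\<And>v. h v * k v = 1" shows "h v = h 0"
proof -
  have "homog 0 (\<lambda>v. h v * k v)" using assms(3) by (simp add: homog_def)
  then obtain a b where ab: "tform a h" "tform b k" "a + b = 0"
    using factors_of_form[OF assms(1,2), of 0] assms(3) by force
  hence "homog 0 h" by (simp add: tform_def)
  thus ?thesis by (rule homog_0_const)
qed

lemma eval3_unit_iff: "(\<exists>c. \<forall>v. eval3 H v = c) \<and> H \<noteq> 0 \<longleftrightarrow> H dvd 1"
proof
  assume a: "(\<exists>c. \<forall>v. eval3 H v = c) \<and> H \<noteq> 0"
  then obtain c where c: "\<And>v. eval3 H v = c" by blast
  hence "c \<noteq> 0" using a eval3_eq_0_iff[of H] by auto
  have "eval3 1 = eval3 (H * [:[:[:1 / c:]:]:])"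
    using c \<open>c \<noteq> 0\<close> by (simp only: fun_eq_iff eval3_mult eval3_const eval3_1) simp
  thus "H dvd 1" using eval3_inj dvdI by blast
next
  assume "H dvd 1"
  then obtain K where K: "1 = H * K" by (auto elim: dvdE)
  have "eval3 H v * eval3 K v = 1" for v using eval3_mult[of H K v] by (simp flip: K)
  hence "\<forall>v. eval3 H v = eval3 H 0" using unit_polyfun_const[of "eval3 H" "eval3 K"] by blast
  moreover have "H \<noteq> 0" using K by auto
  ultimately show "(\<exists>c. \<forall>v. eval3 H v = c) \<and> H \<noteq> 0" by blast
qed

lemma sqfree_iff_squarefree: "sqfree (eval3 G) \<longleftrightarrow> squarefree G"
proof
  assume s: "sqfree (eval3 G)"
  show "squarefree G"
  proof (rule squarefreeI)
    fix x assume "x ^ 2 dvd G"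
    then obtain k where k: "G = x ^ 2 * k" by (auto elim: dvdE)
    have "G \<noteq> 0" using s eval3_eq_0_iff[of G] by (auto simp: sqfree_def)
    hence "x \<noteq> 0" using k by auto
    have "\<forall>v. eval3 G v = eval3 x v ^ 2 * eval3 k v" by (simp add: k eval3_mult eval3_power)
    hence "\<exists>c. \<forall>v. eval3 x v = c" using s unfolding sqfree_def by (meson polyfun_eval3)
    thus "x dvd 1" using \<open>x \<noteq> 0\<close> eval3_unit_iff by blast
  qed
next
  assume s: "squarefree G"
  hence "G \<noteq> 0" by auto
  hence "\<exists>v. eval3 G v \<noteq> 0" using eval3_eq_0_iff by blast
  moreover have "\<exists>c. \<forall>v. h v = c" if "polyfun h" "polyfun k" "\<forall>v. eval3 G v = h v ^ 2 * k v" for h k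
  proof -
    obtain H K where HK: "h = eval3 H" "k = eval3 K" using \<open>polyfun h\<close> \<open>polyfun k\<close> by (auto simp: polyfun_def)
    have "eval3 G = eval3 (H ^ 2 * K)" using that HK by (simp add: fun_eq_iff eval3_mult eval3_power)
    hence "G = H ^ 2 * K" by (rule eval3_inj)
    hence "H dvd 1" using s squarefreeD by (metis dvd_triv_left)
    thus ?thesis using eval3_unit_iff HK by blast
  qed
  ultimately show "sqfree (eval3 G)" by (auto simp: sqfree_def)
qed

lemma sqfree_lin3:
  assumes "sqfree F" "dot p (crs q r) \<noteq> 0" shows "sqfree (\<lambda>v. F (lin3 p q r v))"
proof -
  obtain v0 where "F v0 \<noteq> 0" using assms(1) by (auto simp: sqfree_def)
  hence "F (lin3 p q r (coords3 p q r v0)) \<noteq> 0" using lin3_coords3[OF assms(2)] by simp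
  moreover have "\<exists>c. \<forall>v. h v = c"
    if "polyfun h" "polyfun k" "\<forall>v. F (lin3 p q r v) = h v ^ 2 * k v" for h k
  proof -
    have "F v = h (coords3 p q r v) ^ 2 * k (coords3 p q r v)" for v
      using that(3)[rule_format, of "coords3 p q r v"] by (simp add: lin3_coords3[OF assms(2)])
    moreover have "polyfun (\<lambda>v. h (coords3 p q r v))" "polyfun (\<lambda>v. k (coords3 p q r v))"
      using polyfun_compose[OF that(1) polyfun_coords3] polyfun_compose[OF that(2) polyfun_coords3] .
    moreover have "\<forall>h k. polyfun h \<longrightarrow> polyfun k \<longrightarrow> (\<forall>v. F v = h v ^ 2 * k v) \<longrightarrow> (\<exists>c. \<forall>v. h v = c)"
      using assms(1) by (simp add: sqfree_def)
    note this[rule_format, of "\<lambda>v. h (coords3 p q r v)" "\<lambda>v. k (coords3 p q r v)"]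
    ultimately have "\<exists>c. \<forall>v. h (coords3 p q r v) = c" by blast
    then obtain c where c: "\<And>v. h (coords3 p q r v) = c" by blast
    have "h v = c" for v using c[of "lin3 p q r v"] coords3_lin3[OF assms(2)] by simp
    thus ?thesis by blast
  qed
  ultimately show ?thesis by (auto simp: sqfree_def)
qed

text \<open>A common prime factor \<open>\<pi>\<close> of \<open>G\<close> and its derivative divides \<open>G\<close> twice, or divides its own
  derivative. In the latter case it does not involve the first variable and divides the leading
  coefficient, which is a constant.\<close>

lemma squarefree_coprime_pderiv:
  assumes sq: "squarefree G" and lead: "lead_coeff G = [:[:c:]:]" "c \<noteq> (0::complex)"
  shows "degree (gcd G (pderiv G)) = 0"
proof (rule ccontr)
  assume d: "degree (gcd G (pderiv G)) \<noteq> 0"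
  have G0: "G \<noteq> 0" using sq by auto
  hence g0: "gcd G (pderiv G) \<noteq> 0" by simp
  have "\<not> gcd G (pderiv G) dvd 1" using d by (auto simp: poly_dvd_1)
  then obtain \<pi> where pi: "\<pi> dvd gcd G (pderiv G)" "prime \<pi>" using prime_divisor_exists[OF g0] by blast
  obtain H where H: "G = \<pi> * H" using pi by (meson dvd_trans dvdE gcd_dvd1)
  have "\<pi> dvd pderiv G" using pi dvd_trans by blast
  hence "\<pi> dvd pderiv \<pi> * H" unfolding H pderiv_mult by (simp add: dvd_add_right_iff mult.commute)
  hence "\<pi> dvd pderiv \<pi> \<or> \<pi> dvd H" using pi(2) by (simp add: prime_dvd_mult_iff)
  thus False
  proof
    assume "\<pi> dvd H"
    hence "\<pi> ^ 2 dvd G" unfolding H power2_eq_square by (rule mult_dvd_mono[OF dvd_refl])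
    hence "\<pi> dvd 1" using sq squarefreeD by blast
    thus False using pi(2) by (meson not_prime_unit)
  next
    assume *: "\<pi> dvd pderiv \<pi>"
    have "degree \<pi> = 0"
    proof (rule ccontr)
      assume "degree \<pi> \<noteq> 0"
      hence "pderiv \<pi> \<noteq> 0" by (simp add: pderiv_eq_0_iff)
      hence "degree \<pi> \<le> degree (pderiv \<pi>)" using * dvd_imp_degree_le by blast
      thus False using \<open>degree \<pi> \<noteq> 0\<close> by (simp add: degree_pderiv)
    qed
    then obtain a where a: "\<pi> = [:a:]" by (metis degree_eq_zeroE)
    have "lead_coeff G = a * lead_coeff H" using H a by simp
    hence "a dvd [:[:c:]:]" using lead(1) by (metis dvd_triv_left)
    moreover have "[:[:c:]:] dvd 1" using lead(2) by (simp add: is_unit_const_poly_iff)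
    ultimately have "a dvd 1" using dvd_trans by blast
    hence "\<pi> dvd 1" by (simp add: a is_unit_const_poly_iff)
    thus False using pi(2) by (meson not_prime_unit)
  qed
qed

lemma distinct_roots:
  fixes p :: "complex poly"
  assumes "\<And>x. \<not> (poly p x = 0 \<and> poly (pderiv p) x = 0)" "degree p = n"
  obtains x where "inj_on x {..<n}" "\<And>i. i < n \<Longrightarrow> poly p (x i) = 0"
proof -
  have "\<exists>x. inj_on x {..<n} \<and> (\<forall>i<n. poly p (x i) = 0)"
    using assms
  proof (induction n arbitrary: p)
    case (Suc n)
    hence "\<not> constant (poly p)" by (simp add: constant_degree)
    then obtain a where a: "poly p a = 0" using fundamental_theorem_of_algebra by blast
    then obtain q where q: "p = [:- a, 1:] * q" by (auto simp: poly_eq_0_iff_dvd elim: dvdE)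
    have "p \<noteq> 0" using Suc.prems(2) by auto
    hence "q \<noteq> 0" using q by auto
    have dq: "degree q = n" using Suc.prems(2) degree_mult_eq[of "[:- a, 1:]" q] q \<open>q \<noteq> 0\<close> by simp
    have dp: "poly (pderiv p) x = poly q x + (x - a) * poly (pderiv q) x" for x
      unfolding q pderiv_mult by (simp add: pderiv_pCons algebra_simps)
    have qa: "poly q a \<noteq> 0" using Suc.prems(1)[of a] a dp[of a] by auto
    have "\<not> (poly q x = 0 \<and> poly (pderiv q) x = 0)" for x
      using Suc.prems(1)[of x] dp[of x] by (auto simp: q)
    then obtain x where x: "inj_on x {..<n}" "\<forall>i<n. poly q (x i) = 0" using Suc.IH[of q] dq by blast
    hence "x i \<noteq> a" if "i < n" for i using that qa by auto
    hence "inj_on (x(n := a)) {..<Suc n}" using x(1) by (fastforce simp: inj_on_def less_Suc_eq)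
    moreover have "poly p ((x(n := a)) i) = 0" if "i < Suc n" for i
      using that x(2) a by (auto simp: q less_Suc_eq)
    ultimately show ?case by blast
  qed auto
  thus ?thesis using that by blast
qed

text \<open>The resultant of \<open>G\<close> and its derivative is a nonzero polynomial in the last two variables, and
  it commutes with specialisation because the degree in the first variable does not drop.\<close>

lemma generic_discriminant:
  assumes "homogeneous n G" "squarefree G" "eval3 G (v3 1 0 0) \<noteq> 0"
  obtains y z where "y \<noteq> 0"
    "resultant (map_poly (spec y z) G) (pderiv (map_poly (spec y z) G)) \<noteq> 0"
proof -
  note lG = homogeneous_lead[OF assms(1,3)]
  define r where "r = resultant G (pderiv G)"
  have "r \<noteq> 0" unfolding r_def resultant_0_gcd
    using squarefree_coprime_pderiv[OF assms(2) lG(2) assms(3)] by simp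
  hence "\<exists>v. eval3 [:r:] v \<noteq> 0" using eval3_eq_0_iff[of "[:r:]"] by auto
  then obtain w :: "complex^3" where "spec (w $ 2) (w $ 3) r \<noteq> 0" by (auto simp: eval3_pCons spec_def)
  hence "\<exists>v :: complex^3. spec (v $ 1) (v $ 2) r \<noteq> 0" by (intro exI[of _ "v3 (w $ 2) (w $ 3) 0"]) simp
  moreover have "\<exists>v :: complex^3. v $ 1 \<noteq> 0" by (intro exI[of _ "v3 1 0 0"]) simp
  ultimately obtain v :: "complex^3" where v: "spec (v $ 1) (v $ 2) r \<noteq> 0" "v $ 1 \<noteq> 0"
    using polyfun_common_ne_0[OF polyfun_spec polyfun_nth[of 1]] by blast
  define y z where "y = v $ 1" and "z = v $ 2"
  interpret comm_ring_hom "spec y z" by (rule spec_hom)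
  define p where "p = map_poly (spec y z) G"
  have dp: "degree p = n" unfolding p_def using map_spec_degree[OF lG(2) assms(3)] lG(1) by simp
  have pd: "map_poly (spec y z) (pderiv G) = pderiv p"
  proof -
    have "spec y z (of_nat k) = of_nat k" for k by (induction k) (simp_all add: hom_add)
    thus ?thesis
      unfolding p_def by (intro poly_eqI) (simp add: coeff_map_poly coeff_pderiv hom_mult del: of_nat_Suc)
  qed
  have "degree (pderiv p) = degree (pderiv G)" using dp lG(1) by (simp add: degree_pderiv)
  hence "resultant (map_poly (spec y z) G) (map_poly (spec y z) (pderiv G)) = spec y z r"
    unfolding r_def
    by (intro resultant_map_poly map_spec_degree[OF lG(2) assms(3)]) (simp only: pd)
  hence "resultant p (pderiv p) = spec y z r" by (simp only: pd) (simp only: p_def)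
  hence "resultant p (pderiv p) \<noteq> 0" using v by (simp add: y_def z_def)
  thus ?thesis using that[of y z] v by (simp add: p_def y_def)
qed

section \<open>Generic lines through a point\<close>

text \<open>The point \<open>v\<close> is in general position to the curve \<open>F = 0\<close> of degree \<open>n\<close>: the second clause ensures
  that there are no further lines of the web through \<open>v\<close>, and that each of the \<open>n\<close> lines is a simple
  zero of \<open>F\<close> on the pencil through \<open>v\<close>.\<close>

definition nlines :: "nat \<Rightarrow> (complex^3 \<Rightarrow> complex) \<Rightarrow> complex^3 \<Rightarrow> bool" where
  "nlines n F v \<longleftrightarrow> (\<exists>u :: nat \<Rightarrow> complex^3.
     (\<forall>i<n. u i \<noteq> 0 \<and> dot (u i) v = 0 \<and> F (u i) = 0) \<and>
     (\<forall>i<n. \<forall>j<n. i \<noteq> j \<longrightarrow> crs (u i) (u j) \<noteq> 0)) \<and> (\<exists>w. dot w v = 0 \<and> F w \<noteq> 0)"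

definition polycoeffs :: "(complex^3 \<Rightarrow> complex poly) \<Rightarrow> bool" where
  "polycoeffs h \<longleftrightarrow> (\<forall>i. polyfun (\<lambda>v. coeff (h v) i))"

lemma polycoeffs_lin: "polyfun f \<Longrightarrow> polyfun g \<Longrightarrow> polycoeffs (\<lambda>v. [:f v, g v:])"
  unfolding polycoeffs_def
proof
  fix i assume "polyfun f" "polyfun g"
  thus "polyfun (\<lambda>v. coeff [:f v, g v:] i)"
    by (cases i; cases "i - 1") (auto simp: coeff_pCons)
qed

lemma polycoeffs_mult: "polycoeffs h \<Longrightarrow> polycoeffs k \<Longrightarrow> polycoeffs (\<lambda>v. h v * k v)"
  unfolding polycoeffs_def coeff_mult by (auto intro!: polyfun_intros)

lemma polycoeffs_power: "polycoeffs h \<Longrightarrow> polycoeffs (\<lambda>v. h v ^ n)"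
proof (induction n)
  case 0
  show ?case by (simp add: polycoeffs_def coeff_1)
qed (auto intro: polycoeffs_mult)

lemma polycoeffs_smult: "polycoeffs h \<Longrightarrow> polycoeffs (\<lambda>v. smult c (h v))"
  unfolding polycoeffs_def by (auto intro!: polyfun_intros)

lemma polycoeffs_sum: "(\<And>i. i \<in> I \<Longrightarrow> polycoeffs (h i)) \<Longrightarrow> polycoeffs (\<lambda>v. \<Sum>i\<in>I. h i v)"
  unfolding polycoeffs_def coeff_sum by (auto intro!: polyfun_intros)

text \<open>The restriction of a form to a pencil that moves with \<open>v\<close>, as a polynomial in the pencil
  parameter; its top coefficient is the value at infinity of the pencil.\<close>

lemma form_on_pencil_poly:
  assumes "tform n F" "\<And>i. polyfun (\<lambda>v. a v $ i)" "\<And>i. polyfun (\<lambda>v. b v $ i)"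
  obtains P where "polycoeffs P" "\<And>v. degree (P v) \<le> n" "\<And>v s. poly (P v) s = F (a v + s *s b v)"
    "\<And>v. coeff (P v) n = F (b v)"
proof -
  obtain G where G: "F = eval3 G" using assms(1) by (auto simp: tform_def polyfun_def)
  hence hG: "homogeneous n G" using assms(1) by (auto simp: tform_def intro: homog_imp_homogeneous)
  obtain N where "\<And>i j k. coeff (coeff (coeff G i) j) k \<noteq> 0 \<Longrightarrow> i \<le> N \<and> j \<le> N \<and> k \<le> N"
    and N: "\<And>v. eval3 G v = (\<Sum>i\<le>N. \<Sum>j\<le>N. \<Sum>k\<le>N. coeff (coeff (coeff G i) j) k * v $ 1 ^ i * v $ 2 ^ j * v $ 3 ^ k)" and "0 \<le> N"
    by (rule eval3_monomials[where G = G and M = 0]) blast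
  define L where "L i v = [:a v $ i, b v $ i:]" for i v
  define P where "P v = (\<Sum>i\<le>N. \<Sum>j\<le>N. \<Sum>k\<le>N. smult (coeff (coeff (coeff G i) j) k) (L 1 v ^ i * L 2 v ^ j * L 3 v ^ k))" for v
  have pc: "polycoeffs P" unfolding P_def[abs_def] L_def
    by (intro polycoeffs_sum polycoeffs_smult polycoeffs_mult polycoeffs_power polycoeffs_lin assms)
  have deg: "degree (P v) \<le> n" for v unfolding P_def
  proof (intro degree_sum_le finite_atMost)
    fix i j k
    have "degree (L l v ^ m) \<le> m" for l m
      by (rule order_trans[OF degree_power_le]) (simp add: L_def)
    hence "degree (L 1 v ^ i * L 2 v ^ j * L 3 v ^ k) \<le> i + j + k"
      by (intro order_trans[OF degree_mult_le] add_mono) auto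
    moreover have "coeff (coeff (coeff G i) j) k \<noteq> 0 \<Longrightarrow> i + j + k = n" using hG by (auto simp: homogeneous_def)
    ultimately show "degree (smult (coeff (coeff (coeff G i) j) k) (L 1 v ^ i * L 2 v ^ j * L 3 v ^ k)) \<le> n"
      by (cases "coeff (coeff (coeff G i) j) k = 0") auto
  qed
  have val: "poly (P v) s = F (a v + s *s b v)" for v s
    unfolding G N P_def L_def by (simp add: poly_sum poly_power mult_ac)
  have "coeff (P v) n = F (b v)" for v
  proof -
    have "bform n (\<lambda>s t. F (s *s b v + t *s a v))" by (rule tform_bform[OF assms(1)])
    then obtain c where c: "\<And>s t. F (s *s b v + t *s a v) = (\<Sum>i\<le>n. c i * s ^ i * t ^ (n - i))"
      using bform_coeffs by blast
    have "\<forall>s. (\<Sum>i\<le>n. coeff (P v) i * s ^ i) = (\<Sum>i\<le>n. c i * s ^ i)"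
    proof
      fix s
      have "(\<Sum>i\<le>n. coeff (P v) i * s ^ i) = F (a v + s *s b v)"
        using val[of v s] poly_le_degree_sum[OF deg] by simp
      also have "\<dots> = F (s *s b v + 1 *s a v)" by (simp add: add.commute)
      finally show "(\<Sum>i\<le>n. coeff (P v) i * s ^ i) = (\<Sum>i\<le>n. c i * s ^ i)" unfolding c by simp
    qed
    hence "coeff (P v) n = c n" using polyfun_eq_coeffs[of "coeff (P v)" n c] by blast
    also have "c n = (\<Sum>i\<in>{n}. c i * 1 ^ i * 0 ^ (n - i))" by simp
    also have "\<dots> = (\<Sum>i\<le>n. c i * 1 ^ i * 0 ^ (n - i))"
      by (rule sum.mono_neutral_left) auto
    also have "\<dots> = F (1 *s b v + 0 *s a v)" by (rule c[symmetric])
    finally show ?thesis by simp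
  qed
  thus ?thesis using that pc deg val by blast
qed

lemma polyfun_if: "polyfun f \<Longrightarrow> polyfun g \<Longrightarrow> polyfun (\<lambda>v. if b then f v else g v)"
  by (cases b) simp_all

lemma polyfun_det:
  assumes "\<And>i j. polyfun (\<lambda>v. f v i j)"
  shows "polyfun (\<lambda>v. Determinant.det (mat k k (\<lambda>(i, j). f v i j)))"
proof -
  have "Determinant.det (mat k k (\<lambda>(i, j). f v i j)) =
    (\<Sum>p\<in>{p. p permutes {0..<k}}. signof p * (\<Prod>i=0..<k. f v i (p i)))" for v
  proof -
    have "Determinant.det (mat k k (\<lambda>(i, j). f v i j)) =
      (\<Sum>p\<in>{p. p permutes {0..<k}}. signof p * (\<Prod>i=0..<k. mat k k (\<lambda>(i, j). f v i j) $$ (i, p i)))"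
      by (rule det_def'[of _ k]) simp
    also have "\<dots> = (\<Sum>p\<in>{p. p permutes {0..<k}}. signof p * (\<Prod>i=0..<k. f v i (p i)))"
      by (intro sum.cong arg_cong2[where f = "(*)"] prod.cong refl) (auto simp: permutes_in_image)
    finally show ?thesis .
  qed
  thus ?thesis by (simp only:) (intro polyfun_intros polyfun_const assms)
qed

text \<open>The lines through \<open>v\<close> are parametrised as \<open>crs v a + s crs v b\<close> for fixed \<open>a\<close> and \<open>b\<close>. The
  discriminant in \<open>s\<close> of the restriction of \<open>F\<close>, multiplied by two factors that exclude the points
  where this parametrisation degenerates or a line of the web lies at infinity, is a polynomial in
  \<open>v\<close>. It is nonzero at the base point \<open>v0\<close> of a pencil on which, by \<open>generic_discriminant\<close>, \<open>F\<close> has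
  distinct zeros.\<close>

lemma discriminant:
  assumes F: "tform n F" "sqfree F" "n \<ge> 1"
  obtains \<Delta> where "polyfun \<Delta>" "\<exists>v. \<Delta> v \<noteq> 0" "\<And>v. \<Delta> v \<noteq> 0 \<Longrightarrow> nlines n F v"
proof -
  obtain p where p: "F p \<noteq> 0" using F(2) by (auto simp: sqfree_def)
  have "p \<noteq> 0" using p F homog_zero[of n F] by (auto simp: tform_def)
  then obtain q r where qr: "dot p (crs q r) \<noteq> 0" using exists_basis by blast
  obtain G where G: "(\<lambda>v. F (lin3 p q r v)) = eval3 G"
    using tform_lin3[OF F(1), of p q r] by (auto simp: tform_def polyfun_def)
  have hG: "homogeneous n G" using tform_lin3[OF F(1), of p q r] unfolding G tform_def
    by (auto intro: homog_imp_homogeneous)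
  have sG: "squarefree G" using sqfree_lin3[OF F(2) qr] unfolding G sqfree_iff_squarefree .
  have eG: "eval3 G (v3 1 0 0) \<noteq> 0" unfolding G[symmetric] using p by simp
  obtain y z where yz: "y \<noteq> 0"
    "resultant (map_poly (spec y z) G) (pderiv (map_poly (spec y z) G)) \<noteq> 0"
    by (rule generic_discriminant[OF hG sG eG], rule that)
  define m where "m = y *s q + z *s r"
  have pm: "crs p m \<noteq> 0"
  proof
    assume "crs p m = 0"
    hence "lin3 p q r (v3 0 y z) = m" "\<exists>c. m = c *s p"
      using parallel_iff[OF \<open>p \<noteq> 0\<close>] by (simp_all add: lin3_def m_def)
    then obtain c where "lin3 p q r (v3 0 y z) = c *s p" by auto
    hence "lin3 p q r (v3 0 y z - v3 c 0 0) = 0"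
      unfolding lin3_diff by (simp add: lin3_def)
    hence "v3 0 y z - v3 c 0 0 = 0" by (rule lin3_inj[OF qr])
    thus False using yz(1) by (auto simp: cvec3_eq_iff)
  qed
  \<comment> \<open>the pencil spanned by \<open>p\<close> and \<open>m\<close> consists of the lines through \<open>v0\<close>\<close>
  define v0 where "v0 = crs p m"
  have "v0 \<noteq> 0" using pm by (simp add: v0_def)
  obtain a where a: "m = crs v0 a" using orth_is_crs[OF \<open>v0 \<noteq> 0\<close>, of m] by (auto simp: v0_def)
  obtain b where b: "p = crs v0 b" using orth_is_crs[OF \<open>v0 \<noteq> 0\<close>, of p] by (auto simp: v0_def)
  have pc: "polyfun (\<lambda>v. crs v a $ i)" for a i by (intro polyfun_crs) auto
  obtain P where P: "polycoeffs P" "\<And>v. degree (P v) \<le> n" "\<And>v s. poly (P v) s = F (crs v a + s *s crs v b)"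
    "\<And>v. coeff (P v) n = F (crs v b)"
    by (rule form_on_pencil_poly[OF F(1) pc[of a] pc[of b]], rule that)
  \<comment> \<open>the matrix has fixed size, so that its determinant is polynomial in \<open>v\<close> even where degrees drop\<close>
  define S where "S v = Determinant.det (sylvester_mat_sub n (n - 1) (P v) (pderiv (P v)))" for v
  define \<Delta> where "\<Delta> v = F (crs v b) * dot v (crs a b) * S v" for v
  have S: "S v = resultant (P v) (pderiv (P v))" if "F (crs v b) \<noteq> 0" for v
  proof -
    have "coeff (P v) n \<noteq> 0" using that P(4) by simp
    hence "degree (P v) = n" using P(2)[of v] le_degree[of "P v" n] by simp
    thus ?thesis by (simp add: S_def resultant_sub resultant_sub_def degree_pderiv)
  qed
  have dd: "crs (crs v a) (crs v b) = dot v (crs a b) *s v" for v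
    by (simp add: cvec3_eq_iff crs_def dot_def algebra_simps)
  have pS: "polyfun S"
  proof -
    have c: "polyfun (\<lambda>v. coeff (P v) i)" "polyfun (\<lambda>v. coeff (pderiv (P v)) i)" for i
      using P(1) by (auto simp: polycoeffs_def coeff_pderiv intro!: polyfun_mult)
    show ?thesis unfolding S_def[abs_def] sylvester_mat_sub_def
      by (rule polyfun_det) (intro polyfun_if c polyfun_const)
  qed
  show ?thesis
  proof
    have "polyfun F" using F(1) by (simp add: tform_def)
    hence "polyfun (\<lambda>v. F (crs v b))" by (rule polyfun_compose[OF _ pc])
    moreover have "polyfun (\<lambda>v. dot v (crs a b))" by (intro polyfun_dot) auto
    ultimately show "polyfun \<Delta>" unfolding \<Delta>_def[abs_def] by (intro polyfun_mult pS)
  next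
    have F0: "F (crs v0 b) \<noteq> 0" using p b by simp
    have "P v0 = map_poly (spec y z) G"
    proof -
      have "poly (P v0) s = poly (map_poly (spec y z) G) s" for s
        unfolding P(3) poly_map_spec G[symmetric] a[symmetric] b[symmetric]
        by (simp add: lin3_def m_def add_ac)
      thus ?thesis using poly_eq_poly_eq_iff by blast
    qed
    hence "S v0 \<noteq> 0" using S[OF F0] yz(2) by simp
    moreover have "dot v0 (crs a b) \<noteq> 0"
    proof
      assume "dot v0 (crs a b) = 0"
      hence "crs m p = 0" using dd[of v0] unfolding a[symmetric] b[symmetric] by simp
      thus False using pm crs_eq_0_commute by blast
    qed
    ultimately show "\<exists>v. \<Delta> v \<noteq> 0" using F0 unfolding \<Delta>_def by (intro exI[of _ v0]) simp
  next
    fix v assume "\<Delta> v \<noteq> 0"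
    hence v: "F (crs v b) \<noteq> 0" "dot v (crs a b) \<noteq> 0" "S v \<noteq> 0" by (auto simp: \<Delta>_def)
    have "coeff (P v) n \<noteq> 0" using v P(4) by simp
    hence dP: "degree (P v) = n" using P(2)[of v] le_degree[of "P v" n] by simp
    hence "P v \<noteq> 0" using F(3) by auto
    have "degree (gcd (P v) (pderiv (P v))) = 0" using v(3) S[OF v(1)] by (simp add: resultant_0_gcd)
    hence nr: "\<not> (poly (P v) x = 0 \<and> poly (pderiv (P v)) x = 0)" for x
      using root_gcd \<open>P v \<noteq> 0\<close> by blast
    obtain x where x: "inj_on x {..<n}" "\<And>i. i < n \<Longrightarrow> poly (P v) (x i) = 0"
      using distinct_roots[OF nr dP] by blast
    define u where "u i = crs v a + x i *s crs v b" for i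
    have "v \<noteq> 0" using v by (auto simp: dot_lin)
    have cr: "crs (u i) (u j) = (x j - x i) *s (dot v (crs a b) *s v)" for i j
    proof -
      have "crs (u i) (u j) = (x j - x i) *s crs (crs v a) (crs v b)"
        unfolding u_def by (simp add: crs_lin cvec3_eq_iff crs_swap[of "crs v b" "crs v a"] algebra_simps)
      thus ?thesis by (simp only: dd)
    qed
    have "u i \<noteq> 0" for i
    proof
      assume "u i = 0"
      hence "crs (u i) (crs v b) = 0" by (simp add: crs_lin)
      hence "crs (crs v a) (crs v b) = 0" by (simp add: u_def crs_lin)
      thus False using dd[of v] v(2) \<open>v \<noteq> 0\<close> by (auto simp: cvec3_eq_iff)
    qed
    moreover have "dot (u i) v = 0" for i by (simp add: u_def dot_lin)
    moreover have "F (u i) = 0" if "i < n" for i using x(2)[OF that] P(3) by (simp add: u_def)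
    moreover have "crs (u i) (u j) \<noteq> 0" if "i < n" "j < n" "i \<noteq> j" for i j
    proof -
      have "x j - x i \<noteq> 0" using that x(1) by (auto simp: inj_on_def)
      thus ?thesis using v(2) \<open>v \<noteq> 0\<close> by (auto simp: cr cvec3_eq_iff)
    qed
    moreover have "dot (crs v b) v = 0" by simp
    ultimately show "nlines n F v" unfolding nlines_def using v(1) by blast
  qed
qed

section \<open>Polynomial self-maps of the plane\<close>

text \<open>A lift to \<open>\<complex>\<^sup>3\<close> of a holomorphic self-map of the plane.\<close>

definition pmap :: "nat \<Rightarrow> (complex^3 \<Rightarrow> complex^3) \<Rightarrow> bool" where
  "pmap d f \<longleftrightarrow> (\<forall>i. tform d (\<lambda>v. f v $ i)) \<and> (\<forall>v. f v = 0 \<longrightarrow> v = 0)"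

text \<open>The transposed differential, acting on linear forms: \<open>tdiff f v w\<close> is the differential at
  \<open>v\<close> of the form \<open>w\<close> pulled back by \<open>f\<close>.\<close>

definition tdiff :: "(complex^3 \<Rightarrow> complex^3) \<Rightarrow> complex^3 \<Rightarrow> complex^3 \<Rightarrow> complex^3" where
  "tdiff f v = lin3 (grad (\<lambda>v. f v $ 1) v) (grad (\<lambda>v. f v $ 2) v) (grad (\<lambda>v. f v $ 3) v)"

definition jac :: "(complex^3 \<Rightarrow> complex^3) \<Rightarrow> complex^3 \<Rightarrow> complex" where
  "jac f v = dot (grad (\<lambda>v. f v $ 1) v) (crs (grad (\<lambda>v. f v $ 2) v) (grad (\<lambda>v. f v $ 3) v))"

lemma pmap_polyfun: "pmap d f \<Longrightarrow> polyfun (\<lambda>v. f v $ i)"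
  by (simp add: pmap_def tform_def)

lemma pmap_scale: "pmap d f \<Longrightarrow> f (t *s v) = t ^ d *s f v"
  by (simp add: pmap_def tform_def homog_def Finite_Cartesian_Product.vec_eq_iff)

lemma pmap_eq_0: "pmap d f \<Longrightarrow> f v = 0 \<Longrightarrow> v = 0"
  by (simp add: pmap_def)

lemma pmap_zero: "pmap d f \<Longrightarrow> d \<ge> 1 \<Longrightarrow> f 0 = 0"
  using pmap_scale[of d f 0 0] by (simp add: zero_power)

lemma pmap_tendsto: "pmap d f \<Longrightarrow> (c \<longlongrightarrow> a) F \<Longrightarrow> ((\<lambda>k. f (c k)) \<longlongrightarrow> f a) F"
  by (rule tendsto_cvec3) (auto intro: polyfun_tendsto[OF pmap_polyfun])

lemma tform_pullback:
  assumes "pmap d f" shows "tform d (\<lambda>v. dot w (f v))"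
proof -
  have "polyfun (\<lambda>v. dot w (f v))" by (intro polyfun_dot) (auto intro: pmap_polyfun[OF assms])
  thus ?thesis by (simp add: tform_def homog_def pmap_scale[OF assms] dot_lin)
qed

lemma grad_pullback:
  assumes "pmap d f" shows "grad (\<lambda>v. dot w (f v)) v = tdiff f v w"
proof (rule grad_unique)
  show "polyfun (\<lambda>v. dot w (f v))" using tform_pullback[OF assms] by (simp add: tform_def)
  fix t
  have "((\<lambda>s. w $ 1 * f (v + s *s t) $ 1 + w $ 2 * f (v + s *s t) $ 2 + w $ 3 * f (v + s *s t) $ 3)
    has_field_derivative (w $ 1 * dot (grad (\<lambda>v. f v $ 1) v) t +
     w $ 2 * dot (grad (\<lambda>v. f v $ 2) v) t + w $ 3 * dot (grad (\<lambda>v. f v $ 3) v) t)) (at 0)"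
    by (intro DERIV_add DERIV_cmult grad_field_derivative pmap_polyfun[OF assms])
  thus "((\<lambda>s. dot w (f (v + s *s t))) has_field_derivative dot (tdiff f v w) t) (at 0)"
    by (simp add: tdiff_def lin3_def dot_lin dot_def[of w])
qed

lemma polyfun_tdiff:
  assumes "pmap d f" "\<And>i. polyfun (\<lambda>v. w v $ i)"
  shows "polyfun (\<lambda>v. tdiff f v (w v) $ i)"
  unfolding tdiff_def lin3_def
  by (auto intro!: polyfun_intros assms polyfun_grad pmap_polyfun[OF assms(1)])

lemma polyfun_jac: "pmap d f \<Longrightarrow> polyfun (jac f)"
  unfolding jac_def[abs_def] by (intro polyfun_dot polyfun_crs polyfun_grad pmap_polyfun)

text \<open>Two independent linear forms vanishing at \<open>q\<close> pull back to forms with a common zero, which is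
  mapped to a multiple of \<open>q\<close>; a root of the factor corrects it.\<close>

lemma pmap_surj:
  assumes "pmap d f" "d \<ge> 1" shows "\<exists>v. f v = q"
proof (cases "q = 0")
  case True
  thus ?thesis using pmap_zero[OF assms] by blast
next
  case False
  obtain p where p: "p \<noteq> 0" "dot p q = 0" using exists_orth[OF False] by blast
  obtain p' where p': "dot p' q = 0" "crs p p' = q" using orth_basis[OF False p(2,1)] by metis
  obtain v where v: "v \<noteq> 0" "dot p (f v) = 0" "dot p' (f v) = 0"
    using common_zero_of_forms[OF tform_pullback tform_pullback, of d f d f p p'] assms by auto
  have "dot (f v) p = 0" "dot (f v) p' = 0" "crs p p' \<noteq> 0" using v p' False by (auto simp: dot_commute)
  then obtain c where c: "f v = c *s q" using orth_crs p' by metis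
  have "c \<noteq> 0" using c v(1) pmap_eq_0[OF assms(1), of v] by auto
  obtain t where t: "t ^ d = 1 / c" using assms(2) by (metis exists_complex_root not_one_le_zero)
  have "f (t *s v) = q" using \<open>c \<noteq> 0\<close> by (simp add: pmap_scale[OF assms(1)] t c cvec3_eq_iff)
  thus ?thesis by blast
qed

lemma det0_left_kernel:
  assumes "dot a (crs b c) = 0" obtains r where "r \<noteq> 0" "lin3 a b c r = 0"
proof (cases "crs b c = 0")
  case True
  show ?thesis
  proof (cases "b = 0")
    case True
    thus ?thesis using that[of "v3 0 1 0"] by (simp add: lin3_def cvec3_eq_iff)
  next
    case False
    then obtain k where "c = k *s b" using True parallel_iff by blast
    thus ?thesis using that[of "v3 0 k (-1)"] by (simp add: lin3_def cvec3_eq_iff)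
  qed
next
  case False
  then obtain e where e: "dot (crs b c) e \<noteq> 0" by (rule exists_dot_ne_0)
  have "lin3 a b c (v3 (dot (crs b c) e) (dot (crs c a) e) (dot (crs a b) e)) = dot a (crs b c) *s e"
    by (simp add: lin3_def cvec3_eq_iff dot_def crs_def algebra_simps)
  thus ?thesis using that[of "v3 (dot (crs b c) e) (dot (crs c a) e) (dot (crs a b) e)"] assms e
    by (simp add: cvec3_eq_iff)
qed

text \<open>Since a self-map of the plane is onto, its Jacobian is not identically zero, by Sard's
  theorem for the underlying real map in six variables.\<close>

lemma pmap_jac_nonzero:
  assumes "pmap d f" "d \<ge> 1" shows "\<exists>v. jac f v \<noteq> 0"
proof (rule ccontr)
  assume "\<not> ?thesis"
  hence J: "jac f v = 0" for v by blast
  obtain A :: "real^6 \<Rightarrow> complex^3" and B where AB: "linear A" "linear B" "\<And>x. B (A x) = x" "\<And>y. A (B y) = y"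
    by (rule isomorphisms_UNIV_UNIV[where 'M = "real^6" and 'N = "complex^3"]) auto
  define D where "D v t = v3 (dot (grad (\<lambda>v. f v $ 1) v) t) (dot (grad (\<lambda>v. f v $ 2) v) t)
      (dot (grad (\<lambda>v. f v $ 3) v) t)" for v t
  have D: "(f has_derivative D v) (at v)" for v
  proof -
    have bl: "bounded_linear (\<lambda>c. v3 c 0 0)" "bounded_linear (\<lambda>c. v3 0 c 0)" "bounded_linear (\<lambda>c. v3 0 0 c)"
      unfolding linear_conv_bounded_linear[symmetric]
      by (auto intro!: linearI simp: cvec3_eq_iff)
    have "((\<lambda>v. v3 (f v $ 1) 0 0 + v3 0 (f v $ 2) 0 + v3 0 0 (f v $ 3)) has_derivative
       (\<lambda>t. v3 (dot (grad (\<lambda>v. f v $ 1) v) t) 0 0 + v3 0 (dot (grad (\<lambda>v. f v $ 2) v) t) 0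
         + v3 0 0 (dot (grad (\<lambda>v. f v $ 3) v) t))) (at v)"
      by (intro has_derivative_add bounded_linear.has_derivative[OF bl(1)]
        bounded_linear.has_derivative[OF bl(2)] bounded_linear.has_derivative[OF bl(3)]
        grad_has_derivative pmap_polyfun[OF assms(1)])
    moreover have "v3 a 0 0 + v3 0 b 0 + v3 0 0 c = v3 a b c" for a b c by (simp add: cvec3_eq_iff)
    ultimately show ?thesis by (simp add: D_def[abs_def])
  qed
  have nsurj: "\<not> surj (D v)" for v
  proof
    assume s: "surj (D v)"
    obtain r where r: "r \<noteq> 0" "tdiff f v r = 0"
      using det0_left_kernel J[of v] unfolding jac_def tdiff_def by metis
    obtain e where e: "dot r e \<noteq> 0" using exists_dot_ne_0[OF r(1)] .
    obtain t where t: "e = D v t" using s by (metis surjD)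
    have "dot r (D v t) = dot (tdiff f v r) t"
      by (simp add: D_def tdiff_def lin3_def dot_lin dot_def[of r])
    thus False using t e r by (simp add: dot_lin)
  qed
  define g where "g x = B (f (A x))" for x
  have der: "(g has_derivative (\<lambda>t. B (D (A x) (A t)))) (at x)" for x
  proof -
    have "((\<lambda>x. f (A x)) has_derivative (\<lambda>t. D (A x) (A t))) (at x)"
      using diff_chain_at[OF linear_imp_has_derivative[OF AB(1)] D] by (simp add: o_def)
    from diff_chain_at[OF this linear_imp_has_derivative[OF AB(2)]] show ?thesis
      by (simp add: o_def g_def[abs_def])
  qed
  have "negligible (g ` UNIV)"
  proof (rule baby_Sard)
    show "(g has_derivative (\<lambda>t. B (D (A x) (A t)))) (at x within UNIV)" for x using der by simp
    show "rank (matrix (\<lambda>t. B (D (A x) (A t)))) < CARD(6)" for x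
    proof -
      have lin: "linear (\<lambda>t. B (D (A x) (A t)))" using der has_derivative_linear by blast
      have "\<not> surj (\<lambda>t. B (D (A x) (A t)))"
      proof
        assume s: "surj (\<lambda>t. B (D (A x) (A t)))"
        have "\<exists>t. y = D (A x) t" for y
          using surjD[OF s, of "B y"] AB(4) by metis
        thus False using nsurj unfolding surj_def by blast
      qed
      hence "\<not> surj ((*v) (matrix (\<lambda>t. B (D (A x) (A t)))))"
        using matrix_vector_mul(2)[OF lin] by simp
      hence "rank (matrix (\<lambda>t. B (D (A x) (A t)))) \<noteq> CARD(6)"
        using full_rank_surjective by blast
      moreover have "rank (matrix (\<lambda>t. B (D (A x) (A t)))) \<le> CARD(6)"
        using rank_bound[of "matrix (\<lambda>t. B (D (A x) (A t)))"] by simp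
      ultimately show ?thesis by simp
    qed
  qed simp
  moreover have "g ` UNIV = UNIV"
  proof -
    have "\<exists>x. y = g x" for y
    proof -
      obtain v where "f v = A y" using pmap_surj[OF assms] by blast
      hence "g (B v) = y" by (simp add: g_def AB)
      thus ?thesis by metis
    qed
    thus ?thesis by auto
  qed
  ultimately show False using non_negligible_UNIV by metis
qed

section \<open>Invariant webs\<close>

text \<open>For a lift of a holomorphic map the image of the line \<open>u\<close> is then the whole line \<open>w\<close>, so \<open>w\<close> is
  determined by \<open>u\<close>; see \<open>image_line_unique\<close>.\<close>

definition maps :: "(complex^3 \<Rightarrow> complex^3) \<Rightarrow> complex^3 \<Rightarrow> complex^3 \<Rightarrow> bool" where
  "maps f u w \<longleftrightarrow> (\<forall>v. dot u v = 0 \<longrightarrow> dot w (f v) = 0)"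

text \<open>\<open>F\<close> is the equation of the curve in the dual plane, and \<open>inv\<close> is the invariance of its web.\<close>

locale web =
  fixes n d :: nat and F :: "complex^3 \<Rightarrow> complex" and f :: "complex^3 \<Rightarrow> complex^3"
  assumes F: "tform n F" and sq: "sqfree F" and n2: "n \<ge> 2"
    and f: "pmap d f" and d1: "d \<ge> 1"
    and inv: "\<And>u. u \<noteq> 0 \<Longrightarrow> F u = 0 \<Longrightarrow> \<exists>w. w \<noteq> 0 \<and> F w = 0 \<and> maps f u w"

lemma maps_scale: "maps f u w \<Longrightarrow> c \<noteq> 0 \<Longrightarrow> maps f (c *s u) (c' *s w)"
  by (simp add: maps_def dot_lin)

lemma maps_comp: "maps g t u \<Longrightarrow> maps f u w \<Longrightarrow> maps (f \<circ> g) t w"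
  by (simp add: maps_def)

lemma exists_unit:
  assumes "u \<noteq> (0 :: complex^3)" obtains c where "c \<noteq> 0" "norm (c *s u) = 1"
proof
  show "complex_of_real (1 / norm u) \<noteq> 0" using assms by simp
  have "complex_of_real (1 / norm u) *s u = (1 / norm u) *\<^sub>R u"
    by (simp add: Finite_Cartesian_Product.vec_eq_iff scaleR_conv_of_real[where 'a = complex])
  thus "norm (complex_of_real (1 / norm u) *s u) = 1" using assms by simp
qed

lemma tdiff_scale: "tdiff f v (c *s w) = c *s tdiff f v w"
  by (simp add: tdiff_def lin3_def cvec3_eq_iff algebra_simps)

lemma tdiff_inj: "jac f v \<noteq> 0 \<Longrightarrow> tdiff f v w = 0 \<Longrightarrow> w = 0"
  unfolding jac_def tdiff_def by (rule lin3_inj)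

text \<open>If the line \<open>u\<close> is sent to \<open>w\<close>, the pull-back of \<open>w\<close> vanishes on \<open>u\<close>; therefore its
  differential at a point of \<open>u\<close> is a multiple of \<open>u\<close>.\<close>

lemma tdiff_line:
  assumes "pmap d f" "maps f u w" "u \<noteq> 0" "dot u v = 0"
  shows "\<exists>c. tdiff f v w = c *s u"
proof (rule orth_complement_parallel[OF assms(3)])
  fix t assume "dot u t = 0"
  have "dot (grad (\<lambda>v. dot w (f v)) v) t = 0"
    using tform_pullback[OF assms(1), of w] assms \<open>dot u t = 0\<close>
    by (intro grad_orth[of _ u]) (auto simp: tform_def maps_def)
  thus "dot (tdiff f v w) t = 0" by (simp add: grad_pullback[OF assms(1)])
qed

lemma orth_eq_0:
  assumes "dot x q = 0" "dot y q = 0" "dot q e \<noteq> 0" "dot (crs x y) e = 0"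
  shows "crs x y = 0"
proof -
  have "q \<noteq> 0" using assms(3) by (auto simp: dot_lin)
  have "crs q (crs x y) = 0" using assms(1,2) by (simp add: triple_product dot_commute)
  then obtain c where c: "crs x y = c *s q" using parallel_iff[OF \<open>q \<noteq> 0\<close>] by blast
  thus ?thesis using assms by (simp add: dot_lin)
qed

text \<open>On the pencil through a point \<open>q\<close>, a form with \<open>n\<close> distinct zeros is determined by them up to a
  factor. The linear factor with zero \<open>w i\<close> is written as the determinant of \<open>x\<close>, \<open>w i\<close> and an
  auxiliary vector \<open>e\<close>, an expression that is continuous in all data.\<close>

lemma form_on_pencil:
  assumes F: "tform n F" and q: "dot q e \<noteq> 0"
    and w: "\<And>i. i < n \<Longrightarrow> w i \<noteq> 0 \<and> dot (w i) q = 0 \<and> F (w i) = 0"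
    and dist: "\<And>i j. i < n \<Longrightarrow> j < n \<Longrightarrow> i \<noteq> j \<Longrightarrow> crs (w i) (w j) \<noteq> 0"
  shows "\<exists>c. \<forall>x. dot x q = 0 \<longrightarrow> F x = c * (\<Prod>i<n. dot (crs x (w i)) e)"
proof -
  have "q \<noteq> 0" using q by (auto simp: dot_lin)
  obtain p where p: "p \<noteq> 0" "dot p q = 0" using exists_orth[OF \<open>q \<noteq> 0\<close>] .
  obtain p' where p': "dot p' q = 0" "crs p p' = q" "\<And>w. dot w q = 0 \<Longrightarrow> \<exists>a b. w = a *s p + b *s p'"
    using orth_basis[OF \<open>q \<noteq> 0\<close> p(2,1)] by metis
  have "\<forall>i. \<exists>s t. i < n \<longrightarrow> w i = s *s p + t *s p'" using w p'(3) by metis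
  then obtain s t where st: "\<And>i. i < n \<Longrightarrow> w i = s i *s p + t i *s p'" by metis
  have cr: "crs (a *s p + b *s p') (a' *s p + b' *s p') = (a * b' - b * a') *s q" for a b a' b'
    unfolding p'(2)[symmetric] by (simp add: cvec3_eq_iff crs_def algebra_simps)
  have "bform n (\<lambda>a b. F (a *s p + b *s p'))" by (rule tform_bform[OF F])
  moreover have "F (s i *s p + t i *s p') = 0" if "i < n" for i using w[OF that] st[OF that] by simp
  moreover have "s i \<noteq> 0 \<or> t i \<noteq> 0" if "i < n" for i using w[OF that] st[OF that] by auto
  moreover have "s i * t j \<noteq> t i * s j" if "i < j" "j < n" for i j
  proof
    assume *: "s i * t j = t i * s j"
    have "crs (w i) (w j) = (s i * t j - t i * s j) *s q" using st[of i] st[of j] that cr by simp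
    thus False using dist[of i j] that * by simp
  qed
  ultimately obtain c where c: "\<And>a b. F (a *s p + b *s p') = c * (\<Prod>j<n. a * t j - b * s j)"
    using bform_distinct_roots[of n "\<lambda>a b. F (a *s p + b *s p')" s t] by blast
  have "F x = c / dot q e ^ n * (\<Prod>i<n. dot (crs x (w i)) e)" if "dot x q = 0" for x
  proof -
    obtain a b where ab: "x = a *s p + b *s p'" using p'(3) \<open>dot x q = 0\<close> by blast
    have "(\<Prod>i<n. dot (crs x (w i)) e) = (\<Prod>i<n. (a * t i - b * s i) * dot q e)"
      by (intro prod.cong refl) (simp add: ab st cr dot_lin algebra_simps)
    also have "\<dots> = (\<Prod>i<n. a * t i - b * s i) * dot q e ^ n" by (simp add: prod.distrib)
    finally show ?thesis using q c ab by simp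
  qed
  thus ?thesis by blast
qed

text \<open>The proportion \<open>ratio\<close> says that the \<open>w i\<close> are the zeros of \<open>F\<close> on the pencil through \<open>q\<close>,
  counted with multiplicity; unlike a statement with a factor of proportionality it survives
  passage to the limit. A point \<open>l\<close> where the gradient vanishes has multiplicity at least two.\<close>

lemma double_zero:
  assumes F: "tform n F" "n \<ge> 1" and q: "dot q e \<noteq> 0"
    and w: "\<And>i. i < n \<Longrightarrow> w i \<noteq> 0 \<and> dot (w i) q = 0"
    and ratio: "\<And>x y. dot x q = 0 \<Longrightarrow> dot y q = 0 \<Longrightarrow>
       F x * (\<Prod>i<n. dot (crs y (w i)) e) = F y * (\<Prod>i<n. dot (crs x (w i)) e)"
    and w0: "dot w0 q = 0" "F w0 \<noteq> 0"
    and l: "l \<noteq> 0" "dot l q = 0" "grad F l = 0"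
  obtains i j where "i < n" "j < n" "i \<noteq> j" "crs l (w i) = 0" "crs l (w j) = 0"
proof -
  have pF: "polyfun F" "homog n F" using F by (auto simp: tform_def)
  have Fl: "F l = 0" using euler[OF pF, of l] l(3) F(2) by (simp add: dot_lin)
  have "q \<noteq> 0" using q by (auto simp: dot_lin)
  have par: "crs l (w i) = 0" if "dot (crs l (w i)) e = 0" "i < n" for i
    using orth_eq_0[OF l(2) _ q that(1)] w[OF that(2)] by blast
  have "(\<Prod>i<n. dot (crs l (w i)) e) = 0" using ratio[OF l(2) w0(1)] Fl w0(2) by auto
  then obtain i where i: "i < n" "dot (crs l (w i)) e = 0" by (auto simp: prod_zero_iff)
  obtain t where t: "dot t q = 0" "crs l t \<noteq> 0"
    using orth_basis[OF \<open>q \<noteq> 0\<close> l(2,1)] by metis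
  define C where "C s = (\<Prod>j\<in>{..<n}-{i}. dot (crs (l + s *s t) (w j)) e)" for s
  have "dot (crs t (w i)) e \<noteq> 0"
  proof
    assume "dot (crs t (w i)) e = 0"
    hence "crs t (w i) = 0" using orth_eq_0[OF t(1) _ q] w[OF i(1)] by blast
    moreover obtain c where "c \<noteq> 0" "w i = c *s l"
      using parallelE[OF par[OF i(2,1)] l(1)] w[OF i(1)] by blast
    ultimately have "crs t l = 0" by (simp add: crs_lin cvec3_eq_iff)
    thus False using t(2) crs_eq_0_commute by blast
  qed
  define \<tau> where "\<tau> = dot (crs t (w i)) e"
  have prod: "(\<Prod>j<n. dot (crs (l + s *s t) (w j)) e) = s * \<tau> * C s" for s
  proof -
    have "(\<Prod>j<n. dot (crs (l + s *s t) (w j)) e) = dot (crs (l + s *s t) (w i)) e * C s"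
      unfolding C_def using i(1) by (intro prod.remove) auto
    thus ?thesis using i(2) by (simp add: crs_lin dot_lin \<tau>_def)
  qed
  have eq: "F (l + s *s t) / s * (\<Prod>i<n. dot (crs w0 (w i)) e) = F w0 * \<tau> * C s" if "s \<noteq> 0" for s
    using ratio[of "l + s *s t" w0] l t w0 prod[of s] that by (simp add: dot_lin)
  have "((\<lambda>s. (F (l + s *s t) - F l) / s) \<longlongrightarrow> dot (grad F l) t) (at 0)"
    using grad_field_derivative[OF pF(1), of l t] by (simp add: has_field_derivative_iff)
  hence "((\<lambda>s. F (l + s *s t) / s * (\<Prod>i<n. dot (crs w0 (w i)) e)) \<longlongrightarrow> 0 * (\<Prod>i<n. dot (crs w0 (w i)) e)) (at 0)"
    using Fl l(3) by (intro tendsto_mult tendsto_const) (simp add: dot_lin)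
  hence "((\<lambda>s. F w0 * \<tau> * C s) \<longlongrightarrow> 0) (at 0)"
    unfolding mult_zero_left
    by (rule Lim_transform_eventually) (rule eventually_mono[OF eventually_neq_at_within eq])
  moreover have "((\<lambda>s. F w0 * \<tau> * C s) \<longlongrightarrow> F w0 * \<tau> * C 0) (at 0)"
    unfolding C_def
    by (intro tendsto_intros tendsto_dot tendsto_crs tendsto_smult_cvec)
  ultimately have "F w0 * \<tau> * C 0 = 0" using LIM_unique by blast
  hence "C 0 = 0" using w0(2) \<open>dot (crs t (w i)) e \<noteq> 0\<close> by (simp add: \<tau>_def)
  then obtain j where "j \<in> {..<n} - {i}" "dot (crs l (w j)) e = 0"
    unfolding C_def by (auto simp: prod_zero_iff cvec3_eq_iff)
  thus ?thesis using that[of i j] i par by auto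
qed

lemma nlines_nonsingular:
  assumes F: "tform n F" "n \<ge> 1" and v: "nlines n F v" "v \<noteq> 0" and l: "l \<noteq> 0" "dot l v = 0"
  shows "grad F l \<noteq> 0"
proof
  assume g: "grad F l = 0"
  obtain u w where u: "\<And>i. i < n \<Longrightarrow> u i \<noteq> 0 \<and> dot (u i) v = 0 \<and> F (u i) = 0"
    "\<And>i j. i < n \<Longrightarrow> j < n \<Longrightarrow> i \<noteq> j \<Longrightarrow> crs (u i) (u j) \<noteq> 0" and w: "dot w v = 0" "F w \<noteq> 0"
    using v(1) unfolding nlines_def by blast
  obtain e where e: "dot v e \<noteq> 0" using exists_dot_ne_0[OF v(2)] .
  obtain c where c: "\<And>x. dot x v = 0 \<Longrightarrow> F x = c * (\<Prod>i<n. dot (crs x (u i)) e)"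
    using form_on_pencil[where w = u, OF F(1) e u] by blast
  have ratio: "F x * (\<Prod>i<n. dot (crs y (u i)) e) = F y * (\<Prod>i<n. dot (crs x (u i)) e)"
    if "dot x v = 0" "dot y v = 0" for x y using c[OF that(1)] c[OF that(2)] by simp
  have u': "u i \<noteq> 0 \<and> dot (u i) v = 0" if "i < n" for i using u(1)[OF that] by blast
  obtain i j where ij: "i < n" "j < n" "i \<noteq> j" "crs l (u i) = 0" "crs l (u j) = 0"
    by (rule double_zero[where w = u, OF F e u' ratio w l g]; blast)
  obtain c c' where "u i = c *s l" "u j = c' *s l" using ij parallel_iff[OF l(1)] by blast
  hence "crs (u i) (u j) = 0" by (simp add: crs_lin)
  thus False using u(2) ij by blast
qed

lemma common_subseq:
  fixes x :: "nat \<Rightarrow> nat \<Rightarrow> complex^3"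
  assumes "\<And>i. i < n \<Longrightarrow> bounded (range (x i))"
  shows "\<exists>r l. strict_mono r \<and> (\<forall>i<n. (\<lambda>k. x i (r k)) \<longlonglongrightarrow> l i)"
  using assms
proof (induction n)
  case 0
  show ?case by (intro exI[of _ "\<lambda>k. k"]) (simp add: strict_mono_def)
next
  case (Suc n)
  then obtain r l where r: "strict_mono r" "\<forall>i<n. (\<lambda>k. x i (r k)) \<longlonglongrightarrow> l i" by auto
  have "bounded (range (\<lambda>k. x n (r k)))" using Suc.prems[OF lessI] by (rule bounded_subset) auto
  then obtain r' l' where r': "strict_mono r'" "((\<lambda>k. x n (r k)) \<circ> r') \<longlonglongrightarrow> l'"
    using bounded_imp_convergent_subsequence[of "\<lambda>k. x n (r k)"] by blast
  have "(\<lambda>k. x i ((r \<circ> r') k)) \<longlonglongrightarrow> (l(n := l')) i" if "i < Suc n" for i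
  proof (cases "i = n")
    case True
    thus ?thesis using r'(2) by (simp add: o_def)
  next
    case False
    hence "(\<lambda>k. x i (r k)) \<longlonglongrightarrow> l i" using that r(2) by simp
    thus ?thesis using LIMSEQ_subseq_LIMSEQ[OF _ r'(1)] False by (force simp: o_def)
  qed
  moreover have "strict_mono (r \<circ> r')" using r(1) r'(1) by (rule strict_mono_o)
  ultimately show ?case by blast
qed

text \<open>A point \<open>t\<close> of the limit line is the limit of the points \<open>y k\<close> of the lines \<open>u k\<close> obtained by
  projection along a fixed vector.\<close>

lemma maps_limit:
  assumes f: "pmap d f" and u: "u \<longlonglongrightarrow> lu" "lu \<noteq> 0" and w: "w \<longlonglongrightarrow> lw"
    and m: "\<And>k :: nat. maps f (u k) (w k)"
  shows "maps f lu lw"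
  unfolding maps_def
proof (intro allI impI)
  fix t assume t: "dot lu t = 0"
  obtain a where a: "dot lu a \<noteq> 0" using exists_dot_ne_0[OF u(2)] .
  define y where "y k = t - (dot (u k) t / dot (u k) a) *s a" for k
  have da: "(\<lambda>k. dot (u k) a) \<longlonglongrightarrow> dot lu a" by (intro tendsto_dot u tendsto_const)
  have "y \<longlonglongrightarrow> t - (dot lu t / dot lu a) *s a" unfolding y_def[abs_def]
    using a by (intro tendsto_intros tendsto_smult_cvec tendsto_dot u) auto
  hence "y \<longlonglongrightarrow> t" using t by simp
  hence "(\<lambda>k. dot (w k) (f (y k))) \<longlonglongrightarrow> dot lw (f t)" by (intro tendsto_dot w pmap_tendsto[OF f])
  moreover have "\<forall>\<^sub>F k in sequentially. dot (w k) (f (y k)) = 0"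
    using tendsto_imp_eventually_ne[OF da a]
  proof eventually_elim
    case (elim k)
    hence "dot (u k) (y k) = 0" by (simp add: y_def dot_lin)
    thus ?case using m[of k] by (simp add: maps_def)
  qed
  hence "(\<lambda>k. dot (w k) (f (y k))) \<longlonglongrightarrow> 0" by (rule tendsto_eventually)
  ultimately show "dot lw (f t) = 0" using LIMSEQ_unique by blast
qed

text \<open>In the dual plane the points \<open>u k\<close> and \<open>u' k\<close> of the curve are joined by the line \<open>v k\<close>. When they
  merge, these secants tend to the tangent at the limit point, whose equation is the gradient of \<open>F\<close>.
  If the limit point is singular, the gradient is the zero multiple of \<open>v0\<close>.\<close>

lemma merging_lines:
  assumes F: "tform n F" "n \<ge> 1" and v: "v \<longlonglongrightarrow> v0" "v0 \<noteq> 0"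
    and u: "u \<longlonglongrightarrow> lu" "lu \<noteq> 0" and u': "u' \<longlonglongrightarrow> lu'" "lu' \<noteq> 0" and par: "crs lu lu' = 0"
    and uk: "\<And>k :: nat. F (u k) = 0 \<and> F (u' k) = 0 \<and> dot (u k) (v k) = 0 \<and> dot (u' k) (v k) = 0 \<and> crs (u k) (u' k) \<noteq> 0"
  shows "\<exists>c. grad F lu = c *s v0"
proof -
  have pF: "polyfun F" "homog n F" using F by (auto simp: tform_def)
  obtain a where a: "dot lu a \<noteq> 0" using exists_dot_ne_0[OF u(2)] .
  obtain \<mu> where mu: "\<mu> \<noteq> 0" "lu' = \<mu> *s lu" using parallelE[OF par u(2) u'(2)] .
  have a': "dot lu' a \<noteq> 0" using a mu by (simp add: dot_lin)
  have da: "(\<lambda>k. dot (u k) a) \<longlonglongrightarrow> dot lu a" "(\<lambda>k. dot (u' k) a) \<longlonglongrightarrow> dot lu' a"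
    by (intro tendsto_dot u u' tendsto_const)+
  have "\<forall>\<^sub>F k in sequentially. dot (u k) a \<noteq> 0 \<and> dot (u' k) a \<noteq> 0"
    using tendsto_imp_eventually_ne[OF da(1) a] tendsto_imp_eventually_ne[OF da(2) a'] by eventually_elim simp
  then obtain K where K: "\<And>k. k \<ge> K \<Longrightarrow> dot (u k) a \<noteq> 0 \<and> dot (u' k) a \<noteq> 0"
    by (auto simp: eventually_sequentially)
  \<comment> \<open>points of the curve are compared in the affine chart given by \<open>a\<close>\<close>
  define P where "P = (1 / dot lu a) *s lu"
  define p where "p k = (1 / dot (u (k + K)) a) *s u (k + K)" for k
  define p' where "p' k = (1 / dot (u' (k + K)) a) *s u' (k + K)" for k
  define \<delta> where "\<delta> k = p k - p' k" for k
  have "p \<longlonglongrightarrow> P" unfolding p_def[abs_def] P_def using a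
    by (intro tendsto_smult_cvec tendsto_divide tendsto_const LIMSEQ_ignore_initial_segment[OF u(1)]
          LIMSEQ_ignore_initial_segment[OF da(1)])
  have "p' \<longlonglongrightarrow> (1 / dot lu' a) *s lu'" unfolding p'_def[abs_def] using a'
    by (intro tendsto_smult_cvec tendsto_divide tendsto_const LIMSEQ_ignore_initial_segment[OF u'(1)]
          LIMSEQ_ignore_initial_segment[OF da(2)])
  also have "(1 / dot lu' a) *s lu' = P" unfolding P_def mu(2) using mu(1) a by (simp add: dot_lin cvec3_eq_iff)
  finally have "p' \<longlonglongrightarrow> P" .
  have d0: "\<delta> k \<noteq> 0" for k
  proof
    assume "\<delta> k = 0"
    hence "crs (p k) (p' k) = 0" by (simp add: \<delta>_def)
    hence "crs (u (k + K)) (u' (k + K)) = 0" using K[of "k + K"] by (simp add: p_def p'_def crs_lin cvec3_eq_iff)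
    thus False using uk by blast
  qed
  have da0: "dot (\<delta> k) a = 0" for k using K[of "k + K"] by (simp add: \<delta>_def p_def p'_def dot_lin)
  have dv0: "dot (\<delta> k) (v (k + K)) = 0" for k using uk[of "k + K"] by (simp add: \<delta>_def p_def p'_def dot_lin)
  obtain B where B: "hadamard F B" "\<And>v. grad F v = B v v" using hadamardE[OF pF(1)] by blast
  \<comment> \<open>the curve contains both ends of the secant\<close>
  have Bd: "dot (B (p k) (p' k)) (\<delta> k) = 0" for k
  proof -
    have "F (p k) = 0" "F (p' k) = 0" using uk[of "k + K"] by (simp_all add: p_def p'_def homogD[OF pF(2)])
    thus ?thesis using B(1) unfolding hadamard_def \<delta>_def by (metis diff_zero)
  qed
  have "\<exists>c. norm (c *s \<delta> k) = 1" for k using exists_unit[OF d0[of k]] by blast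
  then obtain c where c: "\<And>k. norm (c k *s \<delta> k) = 1" by metis
  have "bounded (range (\<lambda>k. c k *s \<delta> k))" using c by (intro boundedI[of _ 1]) auto
  then obtain r t where r: "strict_mono r" and t: "((\<lambda>k. c k *s \<delta> k) \<circ> r) \<longlonglongrightarrow> t"
    using bounded_imp_convergent_subsequence[of "\<lambda>k. c k *s \<delta> k"] by blast
  have t': "(\<lambda>k. c (r k) *s \<delta> (r k)) \<longlonglongrightarrow> t" using t by (simp add: o_def)
  have "norm t = 1" using tendsto_norm[OF t'] c by (simp add: LIMSEQ_const_iff)
  hence "t \<noteq> 0" by auto
  have "(\<lambda>k. dot (c (r k) *s \<delta> (r k)) a) \<longlonglongrightarrow> dot t a" by (intro tendsto_dot t' tendsto_const)
  hence ta: "dot t a = 0" by (simp add: dot_lin da0 LIMSEQ_const_iff)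
  have "(\<lambda>k. v (r k + K)) \<longlonglongrightarrow> v0"
    using LIMSEQ_subseq_LIMSEQ[OF LIMSEQ_ignore_initial_segment[OF v(1), of K] r] by (simp add: o_def)
  hence "(\<lambda>k. dot (c (r k) *s \<delta> (r k)) (v (r k + K))) \<longlonglongrightarrow> dot t v0" by (intro tendsto_dot t')
  hence tv: "dot t v0 = 0" by (simp add: dot_lin dv0 LIMSEQ_const_iff)
  have "(\<lambda>k. p (r k)) \<longlonglongrightarrow> P" "(\<lambda>k. p' (r k)) \<longlonglongrightarrow> P"
    using LIMSEQ_subseq_LIMSEQ[OF \<open>p \<longlonglongrightarrow> P\<close> r] LIMSEQ_subseq_LIMSEQ[OF \<open>p' \<longlonglongrightarrow> P\<close> r] by (simp_all add: o_def)
  hence "(\<lambda>k. dot (B (p (r k)) (p' (r k))) (c (r k) *s \<delta> (r k))) \<longlonglongrightarrow> dot (B P P) t"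
    by (intro tendsto_dot t' hadamard_tendsto[OF B(1)])
  hence gt: "dot (grad F P) t = 0" by (simp add: dot_lin Bd LIMSEQ_const_iff B(2))
  have "(\<lambda>k. F (p k)) \<longlonglongrightarrow> F P" by (rule polyfun_tendsto[OF pF(1) \<open>p \<longlonglongrightarrow> P\<close>])
  moreover have "F (p k) = 0" for k using uk[of "k + K"] by (simp add: p_def homogD[OF pF(2)])
  ultimately have "F P = 0" by (simp add: LIMSEQ_const_iff)
  hence gP: "dot (grad F P) P = 0" using euler[OF pF, of P] by simp
  have "(\<lambda>k. dot (u k) (v k)) \<longlonglongrightarrow> dot lu v0" by (intro tendsto_dot u v)
  hence luv: "dot lu v0 = 0" using uk by (simp add: LIMSEQ_const_iff)
  have "P \<noteq> 0" using a u(2) by (auto simp: P_def cvec3_eq_iff)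
  have "dot P a = 1" using a by (simp add: P_def dot_lin)
  have "crs P t \<noteq> 0"
  proof
    assume "crs P t = 0"
    then obtain c where "t = c *s P" using parallel_iff[OF \<open>P \<noteq> 0\<close>] by blast
    thus False using ta \<open>dot P a = 1\<close> \<open>t \<noteq> 0\<close> by (auto simp: dot_lin)
  qed
  moreover have "dot v0 P = 0" "dot v0 t = 0"
    using luv tv by (simp_all add: P_def dot_lin dot_commute[of v0])
  ultimately have "crs v0 (grad F P) = 0" using gP gt by (intro orth_parallel)
  then obtain c where c: "grad F P = c *s v0" using parallel_iff[OF v(2)] by blast
  have "dot lu a *s P = lu" using a by (simp add: P_def cvec3_eq_iff)
  hence "dot lu a *s grad F lu = dot lu a ^ n *s grad F P" using grad_homog[OF pF, of "dot lu a" P] by simp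
  hence "grad F lu = (dot lu a ^ n / dot lu a * c) *s v0"
    using a by (simp add: c cvec3_eq_iff field_simps)
  thus ?thesis by blast
qed

context web begin

lemma pF: "polyfun F" and hF: "homog n F"
  using F by (auto simp: tform_def)

lemma sing_zero: "grad F l = 0 \<Longrightarrow> F l = 0"
  using euler[OF pF hF, of l] n2 by (simp add: dot_lin)

lemma F_ne_0: "\<exists>w. F w \<noteq> 0"
  using sq by (auto simp: sqfree_def)

text \<open>A point is general if it avoids the zeros of a polynomial that combines the discriminant of the
  web and the Jacobian of the map.\<close>

lemma generic_points:
  obtains G where "polyfun G" "\<exists>v. G v \<noteq> 0"
    "\<And>v. G v \<noteq> 0 \<Longrightarrow> nlines n F v \<and> jac f v \<noteq> 0 \<and> v \<noteq> 0"
proof -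
  have "n \<ge> 1" using n2 by simp
  obtain \<Delta> where D: "polyfun \<Delta>" "\<exists>v. \<Delta> v \<noteq> 0" "\<And>v. \<Delta> v \<noteq> 0 \<Longrightarrow> nlines n F v"
    by (rule discriminant[OF F sq \<open>n \<ge> 1\<close>], rule that)
  have J: "polyfun (jac f)" "\<exists>v. jac f v \<noteq> 0" using polyfun_jac[OF f] pmap_jac_nonzero[OF f d1] .
  have x: "polyfun (\<lambda>v. v $ 1)" "\<exists>v :: complex^3. v $ 1 \<noteq> 0" by (auto intro: exI[of _ "v3 1 0 0"])
  have DJ: "polyfun (\<lambda>v. \<Delta> v * jac f v)" "\<exists>v. \<Delta> v * jac f v \<noteq> 0"
    using polyfun_common_ne_0[OF D(1) J(1) D(2) J(2)] by (auto intro: polyfun_mult D J)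
  show ?thesis
  proof (rule that[of "\<lambda>v. \<Delta> v * jac f v * v $ 1"])
    show "polyfun (\<lambda>v. \<Delta> v * jac f v * v $ 1)" by (intro polyfun_mult[OF DJ(1) x(1)])
    show "\<exists>v. \<Delta> v * jac f v * v $ 1 \<noteq> 0"
      using polyfun_common_ne_0[OF DJ(1) x(1) DJ(2) x(2)] by auto
    show "nlines n F v \<and> jac f v \<noteq> 0 \<and> v \<noteq> 0" if "\<Delta> v * jac f v * v $ 1 \<noteq> 0" for v
      using that D(3) by auto
  qed
qed

text \<open>At a general point different lines \<open>u i\<close> have different images \<open>w i\<close>, because the transposed
  differential is injective and sends \<open>w i\<close> back to a multiple of \<open>u i\<close>. The normalisation to norm
  one prepares for compactness arguments.\<close>

lemma lifted_lines:
  assumes "nlines n F v" "jac f v \<noteq> 0"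
  obtains u w where
    "\<And>i. i < n \<Longrightarrow> norm (u i) = 1 \<and> norm (w i) = 1 \<and> dot (u i) v = 0 \<and> dot (w i) (f v) = 0
        \<and> F (u i) = 0 \<and> F (w i) = 0 \<and> maps f (u i) (w i) \<and> (\<exists>c. tdiff f v (w i) = c *s u i)"
    "\<And>i j. i < n \<Longrightarrow> j < n \<Longrightarrow> i \<noteq> j \<Longrightarrow> crs (u i) (u j) \<noteq> 0 \<and> crs (w i) (w j) \<noteq> 0"
proof -
  obtain u0 where u0: "\<And>i. i < n \<Longrightarrow> u0 i \<noteq> 0 \<and> dot (u0 i) v = 0 \<and> F (u0 i) = 0"
    "\<And>i j. i < n \<Longrightarrow> j < n \<Longrightarrow> i \<noteq> j \<Longrightarrow> crs (u0 i) (u0 j) \<noteq> 0"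
    using assms(1) unfolding nlines_def by blast
  have "\<exists>u w. (\<exists>c. c \<noteq> 0 \<and> u = c *s u0 i) \<and> norm u = 1 \<and> norm w = 1 \<and> dot u v = 0 \<and> dot w (f v) = 0
        \<and> F u = 0 \<and> F w = 0 \<and> maps f u w \<and> (\<exists>c. tdiff f v w = c *s u)" if i: "i < n" for i
  proof -
    obtain c where c: "c \<noteq> 0" "norm (c *s u0 i) = 1" using exists_unit u0(1)[OF i] by blast
    define u where "u = c *s u0 i"
    have u: "u \<noteq> 0" "dot u v = 0" "F u = 0" using c u0(1)[OF i]
      by (auto simp: u_def dot_lin homogD[OF hF])
    obtain w1 where w1: "w1 \<noteq> 0" "F w1 = 0" "maps f u w1" using inv[OF u(1,3)] by blast
    obtain c' where c': "c' \<noteq> 0" "norm (c' *s w1) = 1" using exists_unit[OF w1(1)] by blast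
    define w where "w = c' *s w1"
    have m: "maps f u w" using maps_scale[OF w1(3), of 1 c'] by (simp add: w_def)
    have "F w = 0" by (simp add: w_def homogD[OF hF] w1)
    moreover have "dot w (f v) = 0" using m u(2) by (simp add: maps_def)
    ultimately show ?thesis using c c' u m tdiff_line[OF f m u(1,2)]
      by (intro exI[of _ u] exI[of _ w]) (auto simp: u_def w_def)
  qed
  then obtain u w where uw: "\<And>i. i < n \<Longrightarrow> (\<exists>c. c \<noteq> 0 \<and> u i = c *s u0 i) \<and> norm (u i) = 1 \<and> norm (w i) = 1 \<and>
     dot (u i) v = 0 \<and> dot (w i) (f v) = 0
        \<and> F (u i) = 0 \<and> F (w i) = 0 \<and> maps f (u i) (w i) \<and> (\<exists>c. tdiff f v (w i) = c *s u i)"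
    by metis
  have cu: "crs (u i) (u j) \<noteq> 0" if ij: "i < n" "j < n" "i \<noteq> j" for i j
  proof -
    obtain c c' where "c \<noteq> 0" "c' \<noteq> 0" "u i = c *s u0 i" "u j = c' *s u0 j" using uw ij by meson
    hence "crs (u i) (u j) = (c * c') *s crs (u0 i) (u0 j)"
      by (simp only: crs_lin) (simp add: cvec3_eq_iff)
    thus ?thesis using u0(2)[OF ij] \<open>c \<noteq> 0\<close> \<open>c' \<noteq> 0\<close> by (auto simp: cvec3_eq_iff)
  qed
  have "crs (w i) (w j) \<noteq> 0" if ij: "i < n" "j < n" "i \<noteq> j" for i j
  proof
    assume "crs (w i) (w j) = 0"
    moreover have w0: "w i \<noteq> 0" "w j \<noteq> 0" using uw ij by force+
    ultimately obtain b where b: "b \<noteq> 0" "w j = b *s w i" using parallelE by blast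
    obtain c c' where cc: "tdiff f v (w i) = c *s u i" "tdiff f v (w j) = c' *s u j" using uw ij by meson
    have "c \<noteq> 0" "c' \<noteq> 0" using tdiff_inj[OF assms(2)] cc w0 by force+
    moreover have "c' *s u j = (b * c) *s u i" unfolding cc(2)[symmetric] b(2) tdiff_scale cc(1) by (simp add: vector_smult_assoc)
    hence "crs (u i) (c' *s u j) = 0" by (simp add: crs_lin)
    ultimately have "crs (u i) (u j) = 0" by (simp add: crs_lin cvec3_eq_iff)
    thus False using cu ij by blast
  qed
  thus ?thesis using that[of u w] uw cu by blast
qed

text \<open>At a general point \<open>F\<close> and its pull-back \<open>F \<circ> tdiff f v\<close> have the same \<open>n\<close> zeros on the pencil
  through \<open>f v\<close>, namely the images of the lines through \<open>v\<close>. The identity extends to all points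
  because forms vanishing at \<open>f v\<close> can be written polynomially in \<open>v\<close>, as \<open>crs (f v) a\<close>.\<close>

lemma pullback_identity:
  assumes "v \<noteq> 0" "dot w (f v) = 0" "dot w' (f v) = 0"
  shows "F (tdiff f v w) * F w' = F (tdiff f v w') * F w"
proof -
  obtain G where G: "polyfun G" "\<exists>v. G v \<noteq> 0"
    "\<And>v. G v \<noteq> 0 \<Longrightarrow> nlines n F v \<and> jac f v \<noteq> 0 \<and> v \<noteq> 0" by (rule generic_points, rule that)
  have good: "F (tdiff f v w) * F w' = F (tdiff f v w') * F w"
    if g: "G v \<noteq> 0" and w: "dot w (f v) = 0" "dot w' (f v) = 0" for v w w'
  proof -
    note gv = G(3)[OF g]
    obtain u z where uz: "\<And>i. i < n \<Longrightarrow> norm (u i) = 1 \<and> norm (z i) = 1 \<and> dot (u i) v = 0 \<and> dot (z i) (f v) = 0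
        \<and> F (u i) = 0 \<and> F (z i) = 0 \<and> maps f (u i) (z i) \<and> (\<exists>c. tdiff f v (z i) = c *s u i)"
    "\<And>i j. i < n \<Longrightarrow> j < n \<Longrightarrow> i \<noteq> j \<Longrightarrow> crs (u i) (u j) \<noteq> 0 \<and> crs (z i) (z j) \<noteq> 0"
      by (rule lifted_lines[of v], use gv in blast, use gv in blast, rule that)
    have "f v \<noteq> 0" using pmap_eq_0[OF f] gv by blast
    then obtain e where e: "dot (f v) e \<noteq> 0" by (rule exists_dot_ne_0)
    have z1: "z i \<noteq> 0 \<and> dot (z i) (f v) = 0 \<and> F (z i) = 0" if "i < n" for i using uz(1)[OF that] by force
    have z2: "z i \<noteq> 0 \<and> dot (z i) (f v) = 0 \<and> F (tdiff f v (z i)) = 0" if i: "i < n" for i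
    proof -
      obtain c where "tdiff f v (z i) = c *s u i" using uz(1)[OF i] by blast
      thus ?thesis using uz(1)[OF i] z1[OF i] by (simp add: homogD[OF hF])
    qed
    have z3: "crs (z i) (z j) \<noteq> 0" if "i < n" "j < n" "i \<noteq> j" for i j using uz(2)[OF that] by blast
    have t: "tform n (\<lambda>w. F (tdiff f v w))" unfolding tdiff_def by (rule tform_lin3[OF F])
    obtain c where c: "\<And>x. dot x (f v) = 0 \<Longrightarrow> F x = c * (\<Prod>i<n. dot (crs x (z i)) e)"
      using form_on_pencil[where w = z, OF F e z1 z3] by blast
    obtain c' where c': "\<And>x. dot x (f v) = 0 \<Longrightarrow> F (tdiff f v x) = c' * (\<Prod>i<n. dot (crs x (z i)) e)"
      using form_on_pencil[where w = z, OF t e z2 z3] by blast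
    show ?thesis using c[OF w(1)] c[OF w(2)] c'[OF w(1)] c'[OF w(2)] by simp
  qed
  have "f v \<noteq> 0" using pmap_eq_0[OF f] assms(1) by blast
  obtain a where a: "w = crs (f v) a" using orth_is_crs[OF \<open>f v \<noteq> 0\<close> assms(2)] .
  obtain a' where a': "w' = crs (f v) a'" using orth_is_crs[OF \<open>f v \<noteq> 0\<close> assms(3)] .
  define X where "X v = F (tdiff f v (crs (f v) a)) * F (crs (f v) a') -
      F (tdiff f v (crs (f v) a')) * F (crs (f v) a)" for v
  have pc: "polyfun (\<lambda>v. crs (f v) a $ i)" for a i by (intro polyfun_crs pmap_polyfun[OF f]) auto
  have p1: "polyfun (\<lambda>v. F (crs (f v) a))" for a by (rule polyfun_compose[OF pF pc])
  have p2: "polyfun (\<lambda>v. F (tdiff f v (crs (f v) a)))" for a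
    by (rule polyfun_compose[OF pF polyfun_tdiff[OF f pc]])
  have "polyfun X" unfolding X_def[abs_def] by (intro polyfun_diff polyfun_mult p1 p2)
  moreover have "X v = 0" if "G v \<noteq> 0" for v using good[OF that] by (simp add: X_def)
  ultimately have "X v = 0" using polyfun_zero_of_mult[OF _ G(1,2)] by blast
  thus ?thesis by (simp add: X_def a a')
qed

lemma image_line_unique:
  assumes "maps f u w" "maps f u w'" shows "crs w w' = 0"
proof (rule ccontr)
  assume c: "crs w w' \<noteq> 0"
  obtain e where e: "dot (crs w w') e \<noteq> 0" using exists_dot_ne_0[OF c] .
  obtain v where v: "v \<noteq> 0" "dot u v = 0" "dot e (f v) = 0"
    using zero_on_plane[OF tform_pullback[OF f] d1, of u e] by blast
  have "dot (f v) w = 0" "dot (f v) w' = 0" using v assms by (auto simp: maps_def dot_commute)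
  then obtain k where k: "f v = k *s crs w w'" using orth_crs[OF _ _ c] by blast
  hence "k = 0" using v(3) e by (simp add: dot_lin dot_commute)
  thus False using k pmap_eq_0[OF f] v(1) by auto
qed

text \<open>Take general points \<open>v k\<close> tending to \<open>v0\<close>, the \<open>n\<close> lines of the web through each of them, and
  their images. Along a subsequence all these lines converge. The limits of the image lines are the
  zeros of \<open>F\<close> on the pencil through \<open>f v0\<close> with multiplicity, and the form \<open>w0\<close> witnesses that \<open>F\<close>
  does not vanish identically there; so two of them are \<open>l\<close>. The lines \<open>u1\<close> and \<open>u2\<close> are the limits
  of the corresponding lines through \<open>v k\<close>.\<close>

lemma singular_preimages:
  assumes l: "l \<noteq> 0" "grad F l = 0" "dot l (f v0) = 0" and v0: "v0 \<noteq> 0"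
    and w0: "dot w0 (f v0) = 0" "F w0 \<noteq> 0"
  shows "\<exists>u1 u2. u1 \<noteq> 0 \<and> u2 \<noteq> 0 \<and> dot u1 v0 = 0 \<and> dot u2 v0 = 0 \<and> maps f u1 l \<and> maps f u2 l \<and>
     (crs u1 u2 \<noteq> 0 \<or> (\<exists>c. grad F u1 = c *s v0))"
proof -
  obtain G where G: "polyfun G" "\<exists>v. G v \<noteq> 0"
    "\<And>v. G v \<noteq> 0 \<Longrightarrow> nlines n F v \<and> jac f v \<noteq> 0 \<and> v \<noteq> 0" by (rule generic_points, rule that)
  obtain v where v: "\<And>k. G (v k) \<noteq> 0" "v \<longlonglongrightarrow> v0" by (rule polyfun_dense[OF G(1,2)], rule that)
  have "\<exists>u w. (\<forall>i<n. norm (u i) = 1 \<and> norm (w i) = 1 \<and> dot (u i) (v k) = 0 \<and> dot (w i) (f (v k)) = 0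
        \<and> F (u i) = 0 \<and> F (w i) = 0 \<and> maps f (u i) (w i)) \<and>
    (\<forall>i<n. \<forall>j<n. i \<noteq> j \<longrightarrow> crs (u i) (u j) \<noteq> 0 \<and> crs (w i) (w j) \<noteq> 0)" for k
    using lifted_lines[of "v k"] G(3)[OF v(1)] by metis
  then obtain u w where uw: "\<And>k i. i < n \<Longrightarrow> norm (u k i) = 1 \<and> norm (w k i) = 1 \<and> dot (u k i) (v k) = 0 \<and>
      dot (w k i) (f (v k)) = 0 \<and> F (u k i) = 0 \<and> F (w k i) = 0 \<and> maps f (u k i) (w k i)"
    "\<And>k i j. i < n \<Longrightarrow> j < n \<Longrightarrow> i \<noteq> j \<Longrightarrow> crs (u k i) (u k j) \<noteq> 0 \<and> crs (w k i) (w k j) \<noteq> 0" by metis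
  have "bounded (range (\<lambda>k. u k i))" if "i < n" for i using uw(1)[OF that] by (intro boundedI[of _ 1]) auto
  then obtain r1 lu where r1: "strict_mono r1" "\<And>i. i < n \<Longrightarrow> (\<lambda>k. u (r1 k) i) \<longlonglongrightarrow> lu i"
    using common_subseq[of n "\<lambda>i k. u k i"] by blast
  have "bounded (range (\<lambda>k. w (r1 k) i))" if "i < n" for i using uw(1)[OF that] by (intro boundedI[of _ 1]) auto
  then obtain r2 lw where r2: "strict_mono r2" "\<And>i. i < n \<Longrightarrow> (\<lambda>k. w (r1 (r2 k)) i) \<longlonglongrightarrow> lw i"
    using common_subseq[of n "\<lambda>i k. w (r1 k) i"] by blast
  define r where "r k = r1 (r2 k)" for k
  have r: "strict_mono r" using strict_mono_o[OF r1(1) r2(1)] by (simp add: r_def[abs_def] o_def)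
  have Lw: "(\<lambda>k. w (r k) i) \<longlonglongrightarrow> lw i" if "i < n" for i using r2(2)[OF that] by (simp add: r_def)
  have Lu: "(\<lambda>k. u (r k) i) \<longlonglongrightarrow> lu i" if "i < n" for i
    using LIMSEQ_subseq_LIMSEQ[OF r1(2)[OF that] r2(1)] by (simp add: r_def o_def)
  have Lv: "(\<lambda>k. v (r k)) \<longlonglongrightarrow> v0" using LIMSEQ_subseq_LIMSEQ[OF v(2) r] by (simp add: o_def)
  have Lf: "(\<lambda>k. f (v (r k))) \<longlonglongrightarrow> f v0" by (rule pmap_tendsto[OF f Lv])
  have lu1: "lu i \<noteq> 0" if "i < n" for i
    using tendsto_norm[OF Lu[OF that]] uw(1)[OF that] by (auto simp: LIMSEQ_const_iff)
  have lw1: "lw i \<noteq> 0" if "i < n" for i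
    using tendsto_norm[OF Lw[OF that]] uw(1)[OF that] by (auto simp: LIMSEQ_const_iff)
  have luv: "dot (lu i) v0 = 0" if "i < n" for i
    using tendsto_dot[OF Lu[OF that] Lv] uw(1)[OF that] by (auto simp: LIMSEQ_const_iff)
  have lwf: "dot (lw i) (f v0) = 0" if "i < n" for i
    using tendsto_dot[OF Lw[OF that] Lf] uw(1)[OF that] by (auto simp: LIMSEQ_const_iff)
  have lm: "maps f (lu i) (lw i)" if "i < n" for i
    by (rule maps_limit[OF f Lu[OF that] lu1[OF that] Lw[OF that]]) (use uw(1)[OF that] in blast)
  have "f v0 \<noteq> 0" using pmap_eq_0[OF f] v0 by blast
  then obtain e where e: "dot (f v0) e \<noteq> 0" by (rule exists_dot_ne_0)
  have ev: "\<forall>\<^sub>F k in sequentially. dot (f (v (r k))) e \<noteq> 0"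
    by (rule tendsto_imp_eventually_ne[OF tendsto_dot[OF Lf tendsto_const] e])
  have ratio: "F x * (\<Prod>i<n. dot (crs y (lw i)) e) = F y * (\<Prod>i<n. dot (crs x (lw i)) e)"
    if x: "dot x (f v0) = 0" and y: "dot y (f v0) = 0" for x y
  proof -
    define pr where "pr x k = x - (dot x (f (v (r k))) / dot (f (v (r k))) e) *s e" for x k
    have Lpr: "pr x \<longlonglongrightarrow> x" if "dot x (f v0) = 0" for x
    proof -
      have "pr x \<longlonglongrightarrow> x - (dot x (f v0) / dot (f v0) e) *s e" unfolding pr_def[abs_def]
        using e by (intro tendsto_intros tendsto_smult_cvec tendsto_dot Lf) auto
      thus ?thesis using that by simp
    qed
    have A: "(\<lambda>k. F (pr x k) * (\<Prod>i<n. dot (crs (pr y k) (w (r k) i)) e)) \<longlonglongrightarrow> F x * (\<Prod>i<n. dot (crs y (lw i)) e)"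
      by (intro tendsto_mult polyfun_tendsto[OF pF Lpr] tendsto_prod tendsto_dot tendsto_crs Lpr x y Lw tendsto_const) auto
    have B: "(\<lambda>k. F (pr y k) * (\<Prod>i<n. dot (crs (pr x k) (w (r k) i)) e)) \<longlonglongrightarrow> F y * (\<Prod>i<n. dot (crs x (lw i)) e)"
      by (intro tendsto_mult polyfun_tendsto[OF pF Lpr] tendsto_prod tendsto_dot tendsto_crs Lpr x y Lw tendsto_const) auto
    have E: "\<forall>\<^sub>F k in sequentially. F (pr x k) * (\<Prod>i<n. dot (crs (pr y k) (w (r k) i)) e) =
        F (pr y k) * (\<Prod>i<n. dot (crs (pr x k) (w (r k) i)) e)"
      using ev
    proof eventually_elim
      case (elim k)
      have z: "w (r k) i \<noteq> 0 \<and> dot (w (r k) i) (f (v (r k))) = 0 \<and> F (w (r k) i) = 0" if "i < n" for i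
        using uw(1)[OF that, of "r k"] by force
      have z': "crs (w (r k) i) (w (r k) j) \<noteq> 0" if "i < n" "j < n" "i \<noteq> j" for i j using uw(2)[OF that] by blast
      obtain c where c: "\<And>x. dot x (f (v (r k))) = 0 \<Longrightarrow> F x = c * (\<Prod>i<n. dot (crs x (w (r k) i)) e)"
        using form_on_pencil[where w = "w (r k)", OF F elim z z'] by blast
      have "dot (pr x k) (f (v (r k))) = 0" for x using elim by (simp add: pr_def dot_lin dot_commute[of e])
      thus ?case using c by simp
    qed
    show ?thesis by (rule LIMSEQ_unique[OF Lim_transform_eventually[OF A E] B])
  qed
  have n1: "n \<ge> 1" using n2 by simp
  have lw': "lw i \<noteq> 0 \<and> dot (lw i) (f v0) = 0" if "i < n" for i using lw1 lwf that by blast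
  obtain i j where ij: "i < n" "j < n" "i \<noteq> j" "crs l (lw i) = 0" "crs l (lw j) = 0"
    by (rule double_zero[where w = lw, OF F n1 e lw' ratio w0 l(1,3,2)]; blast)
  have ml: "maps f (lu k) l" if k: "k < n" "crs l (lw k) = 0" for k
  proof -
    obtain c where "c \<noteq> 0" "lw k = c *s l" using parallelE[OF k(2) l(1) lw1[OF k(1)]] .
    moreover from this have "(1 / c) *s lw k = l" by (simp add: cvec3_eq_iff)
    ultimately show ?thesis using maps_scale[OF lm[OF k(1)], of 1 "1 / c"] by simp
  qed
  have "crs (lu i) (lu j) \<noteq> 0 \<or> (\<exists>c. grad F (lu i) = c *s v0)"
  proof (cases "crs (lu i) (lu j) = 0")
    case True
    have "\<exists>c. grad F (lu i) = c *s v0"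
      by (rule merging_lines[OF F n1 Lv v0 Lu[OF ij(1)] lu1[OF ij(1)] Lu[OF ij(2)] lu1[OF ij(2)] True])
         (use uw(1)[OF ij(1)] uw(1)[OF ij(2)] uw(2)[OF ij(1,2,3)] in simp)
    thus ?thesis ..
  qed simp
  moreover have "lu i \<noteq> 0" "lu j \<noteq> 0" "dot (lu i) v0 = 0" "dot (lu j) v0 = 0" "maps f (lu i) l" "maps f (lu j) l"
    using lu1[OF ij(1)] lu1[OF ij(2)] luv[OF ij(1)] luv[OF ij(2)] ml[OF ij(1,4)] ml[OF ij(2,5)] .
  ultimately show ?thesis by (intro exI[of _ "lu i"] exI[of _ "lu j"]) simp
qed

end

section \<open>A totally invariant line\<close>

text \<open>Points of the dual plane as sets of representatives, in order to count them.\<close>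

definition cls :: "complex^3 \<Rightarrow> (complex^3) set" where
  "cls u = range (\<lambda>c. c *s u)"

lemma cls_eq_iff:
  assumes "u \<noteq> 0" "w \<noteq> 0" shows "cls u = cls w \<longleftrightarrow> crs u w = 0"
proof
  assume "cls u = cls w"
  moreover have "1 *s w \<in> cls w" unfolding cls_def by (rule rangeI)
  ultimately have "w \<in> cls u" by simp
  thus "crs u w = 0" by (auto simp: cls_def crs_lin)
next
  assume "crs u w = 0"
  then obtain c where c: "c \<noteq> 0" "w = c *s u" using parallelE assms by blast
  have 1: "a *s u = (a / c) *s w" for a using c by (auto simp: cvec3_eq_iff)
  have 2: "a *s w = (a * c) *s u" for a using c by (auto simp: cvec3_eq_iff)
  have "a *s u \<in> cls w" "a *s w \<in> cls u" for a
    unfolding cls_def using 1[of a] 2[of a] by (metis rangeI)+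
  thus "cls u = cls w" unfolding cls_def[of u] cls_def[of w] by (auto simp: cls_def)
qed

text \<open>A linear form on whose plane \<open>H\<close> vanishes is determined, up to scale, by its zeros on two lines
  through points where \<open>H\<close> does not vanish, and these zeros are zeros of \<open>H\<close>.\<close>

lemma finite_lines:
  assumes H: "polyfun H" "\<exists>v. H v \<noteq> 0"
  shows "finite {cls u | u. u \<noteq> 0 \<and> (\<forall>v. dot u v = 0 \<longrightarrow> H v = 0)}"
proof -
  obtain p where p: "H p \<noteq> 0" "p $ 1 \<noteq> 0"
    using polyfun_common_ne_0[OF H(1) polyfun_nth[of 1] H(2)] by (metis v3_nth(1) zero_neq_one)
  hence "p \<noteq> 0" by auto
  then obtain q0 r0 where b0: "dot p (crs q0 r0) \<noteq> 0" using exists_basis by blast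
  have "dot (crs p r0) q0 = - dot p (crs q0 r0)" by (simp add: crs_def dot_def algebra_simps)
  hence "\<exists>v. dot (crs p v) q0 \<noteq> 0" using b0 by (intro exI[of _ r0]) simp
  moreover have "polyfun (\<lambda>v. dot (crs p v) q0)" by (intro polyfun_dot polyfun_crs) auto
  ultimately obtain q where q: "H q \<noteq> 0" "dot (crs p q) q0 \<noteq> 0" using polyfun_common_ne_0[OF H(1)] H(2) by blast
  have "polyfun (\<lambda>v. dot (crs p q) v)" by (intro polyfun_dot) auto
  then obtain r where r: "H r \<noteq> 0" "dot (crs p q) r \<noteq> 0" using polyfun_common_ne_0[OF H(1)] H(2) q(2) by blast
  have fin: "finite {t. H (a + t *s p) = 0}" if "H a \<noteq> 0" for a
  proof -
    obtain P where P: "\<And>t. H (a + t *s p) = poly P t" using polyfun_line[OF H(1)] by blast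
    have "poly P 0 \<noteq> 0" using that P[of 0] by simp
    hence "P \<noteq> 0" by auto
    thus ?thesis unfolding P by (rule poly_roots_finite)
  qed
  define S where "S a = {t. H (a + t *s p) = 0}" for a
  have "{cls u | u. u \<noteq> 0 \<and> (\<forall>v. dot u v = 0 \<longrightarrow> H v = 0)} \<subseteq>
      (\<lambda>(s, t). cls (crs (q + s *s p) (r + t *s p))) ` (S q \<times> S r)"
  proof safe
    fix u assume u: "u \<noteq> 0" "\<forall>v. dot u v = 0 \<longrightarrow> H v = 0"
    have up: "dot u p \<noteq> 0" using u(2) p(1) by blast
    define s t where "s = - dot u q / dot u p" and "t = - dot u r / dot u p"
    have z: "dot u (q + s *s p) = 0" "dot u (r + t *s p) = 0" using up by (simp_all add: s_def t_def dot_lin)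
    hence "s \<in> S q" "t \<in> S r" using u(2) by (auto simp: S_def)
    have "dot (crs (q + s *s p) (r + t *s p)) p = dot (crs p q) r"
      by (simp add: crs_def dot_def algebra_simps)
    hence c: "crs (q + s *s p) (r + t *s p) \<noteq> 0" using r(2) by (auto simp: dot_lin)
    then obtain k where "u = k *s crs (q + s *s p) (r + t *s p)" using orth_crs z by blast
    hence "crs u (crs (q + s *s p) (r + t *s p)) = 0" by (simp only: crs_scale_left crs_self) simp
    hence "cls u = cls (crs (q + s *s p) (r + t *s p))" using cls_eq_iff[OF u(1) c] by simp
    thus "cls u \<in> (\<lambda>(s, t). cls (crs (q + s *s p) (r + t *s p))) ` (S q \<times> S r)"
      using \<open>s \<in> S q\<close> \<open>t \<in> S r\<close> by (intro image_eqI[of _ _ "(s, t)"]) auto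
  qed
  moreover have "finite (S q \<times> S r)" unfolding S_def using fin[OF q(1)] fin[OF r(1)] by blast
  ultimately show ?thesis using finite_subset by blast
qed

context web begin

definition sings :: "(complex^3) set set" where
  "sings = {cls l | l. l \<noteq> 0 \<and> grad F l = 0}"

text \<open>Through a general point passes no singular line, by \<open>nlines_nonsingular\<close>. So the polynomial that
  defines general points vanishes along each singular line.\<close>

lemma finite_sings: "finite sings"
proof -
  have n1: "n \<ge> 1" using n2 by simp
  obtain G where G: "polyfun G" "\<exists>v. G v \<noteq> 0"
    "\<And>v. G v \<noteq> 0 \<Longrightarrow> nlines n F v \<and> jac f v \<noteq> 0 \<and> v \<noteq> 0" by (rule generic_points, rule that)
  have "G v = 0" if "l \<noteq> 0" "grad F l = 0" "dot l v = 0" for l v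
    using nlines_nonsingular[OF F n1 _ _ that(1,3)] that(2) G(3)[of v] by blast
  hence "sings \<subseteq> {cls u | u. u \<noteq> 0 \<and> (\<forall>v. dot u v = 0 \<longrightarrow> G v = 0)}"
    unfolding sings_def by blast
  thus ?thesis using finite_lines[OF G(1,2)] finite_subset by blast
qed

text \<open>Infinitely many points of the line \<open>u\<close> lie on no other line that is sent to \<open>l\<close>. At each of them
  \<open>singular_preimages\<close> leaves only the alternative that the gradient of \<open>F\<close> at \<open>u\<close> is a multiple of
  that point; two different points make it zero.\<close>

lemma preimage_sing:
  assumes l: "l \<noteq> 0" "grad F l = 0" and u: "u \<noteq> 0" "maps f u l"
  shows "grad F u = 0"
proof -
  \<comment> \<open>the forms \<open>w + s w'\<close> cut out points \<open>v s\<close> of the line \<open>u\<close>; only finitely many of these forms are lines of the web\<close>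
  obtain w where w: "F w \<noteq> 0" using F_ne_0 by blast
  have "crs l w \<noteq> 0"
  proof
    assume "crs l w = 0"
    then obtain c where "w = c *s l" using parallel_iff[OF l(1)] by blast
    thus False using w sing_zero[OF l(2)] by (simp add: homogD[OF hF])
  qed
  then obtain w' where w': "dot (crs l w) w' \<noteq> 0" by (rule exists_dot_ne_0)
  define H where "H v = dot l (f v)" for v
  have H: "polyfun H" using tform_pullback[OF f, of l] by (simp add: tform_def H_def[abs_def])
  have "\<exists>v. H v \<noteq> 0"
  proof -
    obtain e where e: "dot l e \<noteq> 0" using exists_dot_ne_0[OF l(1)] .
    obtain v where "f v = e" using pmap_surj[OF f d1] by blast
    thus ?thesis using e by (auto simp: H_def)
  qed
  hence finL: "finite {cls u | u. u \<noteq> 0 \<and> (\<forall>v. dot u v = 0 \<longrightarrow> H v = 0)}" (is "finite ?L")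
    by (rule finite_lines[OF H])
  have "\<forall>s. \<exists>v. v \<noteq> 0 \<and> dot u v = 0 \<and> dot (w + s *s w') (f v) = 0"
    using zero_on_plane[OF tform_pullback[OF f] d1] by blast
  then obtain v where v: "\<And>s. v s \<noteq> 0 \<and> dot u (v s) = 0 \<and> dot (w + s *s w') (f (v s)) = 0" by metis
  have lv: "dot l (f (v s)) = 0" for s using u(2) v by (simp add: maps_def)
  have vpar: "crs (v s) (v t) \<noteq> 0" if "s \<noteq> t" for s t
  proof
    assume "crs (v s) (v t) = 0"
    then obtain c where c: "c \<noteq> 0" "v t = c *s v s" using parallelE v by metis
    have "f (v t) = c ^ d *s f (v s)" using c by (simp add: pmap_scale[OF f])
    hence "dot (w + t *s w') (f (v s)) = 0" using v[of t] c(1) by (simp add: dot_lin)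
    moreover have "dot (w + s *s w') (f (v s)) = 0" using v by blast
    ultimately have "dot (w + s *s w') (f (v s)) - dot (w + t *s w') (f (v s)) = 0" by simp
    hence "(s - t) * dot w' (f (v s)) = 0" by (simp only: dot_lin) (simp add: algebra_simps)
    hence "dot w' (f (v s)) = 0" using that by simp
    moreover from this have "dot w (f (v s)) = 0" using v[of s] by (simp add: dot_lin)
    ultimately have "dot (f (v s)) l = 0" "dot (f (v s)) w = 0" "dot w' (f (v s)) = 0"
      using lv[of s] by (simp_all add: dot_commute)
    moreover from this(1,2) obtain k where k: "f (v s) = k *s crs l w" using orth_crs \<open>crs l w \<noteq> 0\<close> by blast
    ultimately have "k = 0" using w' by (simp add: dot_lin dot_commute)
    thus False using k pmap_eq_0[OF f] v by auto
  qed
  define bad where "bad = {s. \<exists>u'. u' \<noteq> 0 \<and> maps f u' l \<and> dot u' (v s) = 0 \<and> crs u u' \<noteq> 0}"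
  have "finite bad"
  proof -
    have "\<forall>s. \<exists>u'. s \<in> bad \<longrightarrow> u' \<noteq> 0 \<and> maps f u' l \<and> dot u' (v s) = 0 \<and> crs u u' \<noteq> 0" unfolding bad_def by blast
    then obtain u' where u': "\<And>s. s \<in> bad \<Longrightarrow> u' s \<noteq> 0 \<and> maps f (u' s) l \<and> dot (u' s) (v s) = 0 \<and> crs u (u' s) \<noteq> 0" by metis
    have "inj_on (\<lambda>s. cls (u' s)) bad"
    proof (rule inj_onI, rule ccontr)
      fix s t assume st: "s \<in> bad" "t \<in> bad" "cls (u' s) = cls (u' t)" "s \<noteq> t"
      hence "crs (u' s) (u' t) = 0" using cls_eq_iff u' by blast
      then obtain c where "c \<noteq> 0" "u' t = c *s u' s" using parallelE u' st by metis
      hence "dot (u' s) (v t) = 0" using u'[OF st(2)] by (simp add: dot_lin)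
      hence "crs (v s) (v t) = 0" using v u'[OF st(1)] 
        by (intro orth_parallel[of _ u "u' s"]) (auto simp: dot_commute)
      thus False using vpar st(4) by blast
    qed
    moreover have "cls (u' s) \<in> ?L" if "s \<in> bad" for s
      using u'[OF that] unfolding H_def maps_def by blast
    hence "finite ((\<lambda>s. cls (u' s)) ` bad)" by (intro finite_subset[OF _ finL] image_subsetI)
    ultimately show ?thesis by (rule finite_imageD[rotated])
  qed
  moreover have "finite {s. F (w + s *s w') = 0}"
  proof -
    obtain P where P: "\<And>t. F (w + t *s w') = poly P t" using polyfun_line[OF pF] by blast
    have "poly P 0 \<noteq> 0" using w P[of 0] by simp
    hence "P \<noteq> 0" by auto
    thus ?thesis unfolding P by (rule poly_roots_finite)
  qed
  ultimately have fin: "finite (bad \<union> {s. F (w + s *s w') = 0})" by simp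
  have inf: "infinite (UNIV :: complex set)" by (rule infinite_UNIV_char_0)
  obtain s where s: "s \<notin> bad \<union> {s. F (w + s *s w') = 0}" using ex_new_if_finite[OF inf fin] by blast
  obtain t where t: "t \<notin> insert s (bad \<union> {s. F (w + s *s w') = 0})"
    using ex_new_if_finite[OF inf] fin by (meson finite_insert)
  have tang: "\<exists>c. grad F u = c *s v s" if sb: "s \<notin> bad" "F (w + s *s w') \<noteq> 0" for s
  proof -
    obtain u1 u2 where u12: "u1 \<noteq> 0" "u2 \<noteq> 0" "dot u1 (v s) = 0" "dot u2 (v s) = 0" "maps f u1 l" "maps f u2 l"
        "crs u1 u2 \<noteq> 0 \<or> (\<exists>c. grad F u1 = c *s v s)"
      using singular_preimages[OF l lv[of s]] v[of s] sb(2) by blast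
    have "crs u u1 = 0" "crs u u2 = 0" using sb(1) u12 unfolding bad_def by blast+
    then obtain c c' where c: "c \<noteq> 0" "u1 = c *s u" "c' \<noteq> 0" "u2 = c' *s u" using parallelE u(1) u12(1,2) by metis
    hence "crs u1 u2 = 0" by (simp add: crs_lin)
    then obtain k where "grad F u1 = k *s v s" using u12(7) by blast
    hence "c *s (k *s v s) = c ^ n *s grad F u" using grad_homog[OF pF hF, of c u] c by simp
    hence "grad F u = (c * k / c ^ n) *s v s" using c(1) by (simp add: cvec3_eq_iff field_simps)
    thus ?thesis by blast
  qed
  obtain a b where ab: "grad F u = a *s v s" "grad F u = b *s v t" using tang s t by blast
  have "s \<noteq> t" using t by auto
  hence "crs (v s) (v t) \<noteq> 0" by (rule vpar)
  moreover have "a *s crs (v s) (v t) = 0"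
  proof -
    have "a *s crs (v s) (v t) = crs (grad F u) (v t)" by (simp add: ab(1) crs_lin)
    also have "\<dots> = 0" unfolding ab(2) by (simp add: crs_lin)
    finally show ?thesis .
  qed
  ultimately have "a = 0" by (auto simp: cvec3_eq_iff)
  thus ?thesis using ab by simp
qed

lemma exists_preimage:
  assumes l: "l \<noteq> 0" "grad F l = 0" shows "\<exists>u. u \<noteq> 0 \<and> maps f u l"
proof -
  obtain w where w: "F w \<noteq> 0" using F_ne_0 by blast
  have "crs l w \<noteq> 0"
  proof
    assume "crs l w = 0"
    then obtain c where "w = c *s l" using parallel_iff[OF l(1)] by blast
    thus False using w sing_zero[OF l(2)] by (simp add: homogD[OF hF])
  qed
  obtain v where v: "f v = crs l w" using pmap_surj[OF f d1] by blast
  have "v \<noteq> 0" using v \<open>crs l w \<noteq> 0\<close> pmap_zero[OF f d1] by auto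
  thus ?thesis using singular_preimages[OF l, of v w] v w by auto
qed

definition sends :: "(complex^3) set \<Rightarrow> (complex^3) set \<Rightarrow> bool" where
  "sends X Y \<longleftrightarrow> (\<exists>u l. u \<noteq> 0 \<and> l \<noteq> 0 \<and> X = cls u \<and> Y = cls l \<and> maps f u l)"

lemma sends_cls:
  assumes "u \<noteq> 0" "l \<noteq> 0" shows "sends (cls u) (cls l) \<longleftrightarrow> maps f u l"
proof
  assume "sends (cls u) (cls l)"
  then obtain u' l' where *: "u' \<noteq> 0" "l' \<noteq> 0" "cls u = cls u'" "cls l = cls l'" "maps f u' l'"
    unfolding sends_def by blast
  obtain c c' where c: "c \<noteq> 0" "u = c *s u'" "c' \<noteq> 0" "l = c' *s l'"
    using * parallelE cls_eq_iff assms by metis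
  thus "maps f u l" using maps_scale[OF *(5) c(1)] by simp
qed (use assms sends_def in blast)

lemma sends_unique: "sends X Y \<Longrightarrow> sends X Y' \<Longrightarrow> Y = Y'"
proof -
  assume "sends X Y" "sends X Y'"
  then obtain u l l' u' where *: "u \<noteq> 0" "l \<noteq> 0" "l' \<noteq> 0" "X = cls u" "Y = cls l" "Y' = cls l'" "maps f u l"
     "sends (cls u) (cls l')"
    unfolding sends_def by blast
  have "maps f u l'" using *(8) sends_cls[OF *(1,3)] by simp
  thus "Y = Y'" using image_line_unique[OF *(7)] cls_eq_iff[OF *(2,3)] *(5,6) by simp
qed

text \<open>The map induced on lines permutes the finite set of singular points, because a choice of
  preimages is an injective self-map of it.\<close>

lemma preimage_bij:
  obtains h where "bij_betw h sings sings" "\<And>X Y. Y \<in> sings \<Longrightarrow> sends X Y \<longleftrightarrow> X = h Y"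
proof -
  have in_sings: "X \<in> sings" if Y: "Y \<in> sings" and XY: "sends X Y" for X Y
  proof -
    obtain l where l: "l \<noteq> 0" "grad F l = 0" "Y = cls l" using Y by (auto simp: sings_def)
    obtain u where u: "u \<noteq> 0" "X = cls u" using XY by (auto simp: sends_def)
    have "maps f u l" using XY sends_cls[OF u(1) l(1)] u l by simp
    thus ?thesis using preimage_sing[OF l(1,2) u(1)] u by (auto simp: sings_def)
  qed
  have "\<exists>X. sends X Y" if Y: "Y \<in> sings" for Y
  proof -
    obtain l where l: "l \<noteq> 0" "grad F l = 0" "Y = cls l" using Y by (auto simp: sings_def)
    obtain u where "u \<noteq> 0" "maps f u l" using exists_preimage[OF l(1,2)] by blast
    thus ?thesis using sends_cls[OF _ l(1)] l by blast
  qed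
  then obtain h where h: "\<And>Y. Y \<in> sings \<Longrightarrow> sends (h Y) Y" by metis
  have inj: "inj_on h sings" by (rule inj_onI) (metis h sends_unique)
  moreover have "h ` sings \<subseteq> sings" using h in_sings by blast
  ultimately have surj: "h ` sings = sings" using endo_inj_surj[OF finite_sings] by blast
  have "sends X Y \<longleftrightarrow> X = h Y" if Y: "Y \<in> sings" for X Y
  proof
    assume s: "sends X Y"
    then obtain Z where Z: "Z \<in> sings" "X = h Z" using in_sings[OF Y] surj by blast
    hence "Z = Y" using h sends_unique s by blast
    thus "X = h Y" using Z by simp
  qed (use h Y in blast)
  thus ?thesis using that[of h] inj surj by (simp add: bij_betw_def)
qed

lemma preimage_unique:
  assumes "l \<noteq> 0" "grad F l = 0" "u \<noteq> 0" "maps f u l" "u' \<noteq> 0" "maps f u' l"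
  shows "crs u u' = 0"
proof -
  obtain h where h: "bij_betw h sings sings" "\<And>X Y. Y \<in> sings \<Longrightarrow> sends X Y \<longleftrightarrow> X = h Y"
    by (rule preimage_bij, rule that)
  have "cls l \<in> sings" using assms by (auto simp: sings_def)
  hence "cls u = h (cls l)" "cls u' = h (cls l)" using h(2) sends_cls assms by blast+
  thus ?thesis using cls_eq_iff[OF assms(3,5)] by simp
qed

end

lemma pmap_comp:
  assumes "pmap d f" "pmap e g" shows "pmap (d * e) (f \<circ> g)"
proof -
  have "polyfun (\<lambda>v. f (g v) $ i)" for i
    by (rule polyfun_compose[OF pmap_polyfun[OF assms(1)] pmap_polyfun[OF assms(2)]])
  moreover have "f (g (t *s v)) = t ^ (d * e) *s f (g v)" for t v
    by (simp add: pmap_scale[OF assms(2)] pmap_scale[OF assms(1)] power_mult[symmetric] mult.commute)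
  ultimately have "tform (d * e) (\<lambda>v. f (g v) $ i)" for i
    unfolding tform_def homog_def by (metis vector_smult_component)
  moreover have "v = 0" if "f (g v) = 0" for v
    using pmap_eq_0[OF assms(2)] pmap_eq_0[OF assms(1)] that by blast
  ultimately show ?thesis unfolding pmap_def by simp
qed

lemma pmap_id: "pmap 1 id"
  by (simp add: pmap_def tform_def homog_def)

context web begin

lemma pmap_funpow: "pmap (d ^ k) (f ^^ k)"
proof (induction k)
  case 0
  show ?case using pmap_id by (simp add: id_def)
next
  case (Suc k)
  show ?case using pmap_comp[OF f Suc] by (simp only: funpow.simps(2) power_Suc)
qed

lemma inv_funpow: "u \<noteq> 0 \<Longrightarrow> F u = 0 \<Longrightarrow> \<exists>w. w \<noteq> 0 \<and> F w = 0 \<and> maps (f ^^ k) u w"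
proof (induction k)
  case 0
  thus ?case by (auto simp: maps_def)
next
  case (Suc k)
  then obtain w where "w \<noteq> 0" "F w = 0" "maps (f ^^ k) u w" by blast
  moreover from this obtain w' where "w' \<noteq> 0" "F w' = 0" "maps f w w'" using inv by blast
  ultimately show ?case using maps_comp by (metis funpow.simps(2))
qed

lemma web_funpow: "web n (d ^ k) F (f ^^ k)"
  using F sq n2 pmap_funpow inv_funpow d1 by unfold_locales auto

text \<open>The orbit of \<open>l\<close> under taking preimages is periodic. An even number of iterations is used to make
  the degree at least 3.\<close>

lemma totally_invariant_iterate:
  assumes d2: "d \<ge> 2" and l: "l \<noteq> 0" "grad F l = 0"
  obtains D g where "web n D F g" "D \<ge> 3" "maps g l l" "\<And>u. u \<noteq> 0 \<Longrightarrow> maps g u l \<Longrightarrow> crs u l = 0"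
proof -
  obtain h where h: "bij_betw h sings sings" "\<And>X Y. Y \<in> sings \<Longrightarrow> sends X Y \<longleftrightarrow> X = h Y"
    by (rule preimage_bij, rule that)
  define Y where "Y = cls l"
  have Y: "Y \<in> sings" using l by (auto simp: sings_def Y_def)
  have hk: "bij_betw (h ^^ k) sings sings" for k by (rule bij_betw_funpow[OF h(1)])
  have "\<not> inj (\<lambda>k. (h ^^ k) Y)"
  proof
    assume "inj (\<lambda>k. (h ^^ k) Y)"
    moreover have "range (\<lambda>k. (h ^^ k) Y) \<subseteq> sings" using hk Y by (auto dest: bij_betwE)
    ultimately show False using finite_subset[OF _ finite_sings] range_inj_infinite by blast
  qed
  then obtain i j where ij: "i < j" "(h ^^ i) Y = (h ^^ j) Y"
    unfolding inj_def by (metis linorder_neqE_nat)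
  \<comment> \<open>a period of \<open>Y\<close>\<close>
  define N where "N = j - i"
  have "(h ^^ i) ((h ^^ N) Y) = (h ^^ i) Y"
    using ij by (simp add: N_def flip: funpow_add[unfolded o_def fun_eq_iff, rule_format])
  moreover have "(h ^^ N) Y \<in> sings" using hk Y by (auto dest: bij_betwE)
  ultimately have N: "(h ^^ N) Y = Y" using hk[of i] Y by (auto simp: bij_betw_def inj_on_def)
  have "N \<ge> 1" using ij by (simp add: N_def)
  have iter: "\<exists>u l. u \<noteq> 0 \<and> l \<noteq> 0 \<and> (h ^^ k) Z = cls u \<and> Z = cls l \<and> maps (f ^^ k) u l"
    if "Z \<in> sings" for k Z using that
  proof (induction k arbitrary: Z)
    case 0
    then obtain l where "l \<noteq> 0" "Z = cls l" by (auto simp: sings_def)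
    thus ?case by (intro exI[of _ l]) (auto simp: maps_def)
  next
    case (Suc k)
    have "h Z \<in> sings" using h(1) Suc.prems by (auto dest: bij_betwE)
    then obtain u w where uw: "u \<noteq> 0" "w \<noteq> 0" "(h ^^ k) (h Z) = cls u" "h Z = cls w" "maps (f ^^ k) u w"
      using Suc.IH by blast
    obtain l where l: "l \<noteq> 0" "Z = cls l" using Suc.prems by (auto simp: sings_def)
    have "sends (cls w) (cls l)" using h(2)[OF Suc.prems] uw(4) l(2) by metis
    hence "maps f w l" using sends_cls uw l by blast
    hence "maps (f ^^ Suc k) u l" using maps_comp[OF uw(5)] by (simp only: funpow.simps(2))
    moreover have "(h ^^ Suc k) Z = cls u" using uw(3) by (simp only: funpow_Suc_right o_apply)
    ultimately show ?case using uw(1) l by blast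
  qed
  have N2: "(h ^^ (2 * N)) Y = Y" using N by (simp add: mult_2 funpow_add)
  define g where "g = f ^^ (2 * N)"
  define D where "D = d ^ (2 * N)"
  have w: "web n D F g" unfolding g_def D_def by (rule web_funpow)
  then interpret g: web n D F g .
  have "(4::nat) = 2 ^ 2" by simp
  also have "\<dots> \<le> d ^ 2" using d2 by (rule power_mono) simp
  also have "\<dots> \<le> d ^ (2 * N)" using d2 \<open>N \<ge> 1\<close> by (intro power_increasing) auto
  finally have D: "D \<ge> 3" by (simp add: D_def)
  obtain u l' where ul: "u \<noteq> 0" "l' \<noteq> 0" "Y = cls u" "Y = cls l'" "maps g u l'"
    using iter[OF Y, of "2 * N"] unfolding N2 g_def by blast
  have "g.sends Y Y" unfolding g.sends_def using ul by blast
  hence ml: "maps g l l" unfolding Y_def using g.sends_cls[OF l(1) l(1)] by simp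
  show ?thesis using that[OF w D ml] g.preimage_unique[OF l _ _ l(1) ml] by blast
qed

end

section \<open>Webs with a totally invariant singular line\<close>

definition e1 :: "complex^3" where "e1 = v3 1 0 0"

text \<open>The situation provided by \<open>totally_invariant_iterate\<close>, in coordinates in which the totally
  invariant singular line is \<open>x = 0\<close>.\<close>

locale fixed_web = web +
  assumes d3: "d \<ge> 3" and sing: "grad F e1 = 0"
    and tot: "\<And>u. u \<noteq> 0 \<Longrightarrow> maps f u e1 \<Longrightarrow> crs u e1 = 0"

lemma squarefree_dvd_square:
  fixes a :: poly3
  assumes "squarefree a" "a dvd b ^ 2" shows "a dvd b"
proof (cases "b = 0")
  case False
  have "a \<noteq> 0" using assms(1) by auto
  show ?thesis
  proof (rule multiplicity_le_imp_dvd[OF \<open>a \<noteq> 0\<close>])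
    fix p :: poly3 assume p: "prime p"
    have le: "multiplicity p a \<le> 1"
      using assms(1) p \<open>a \<noteq> 0\<close> squarefree_factorial_semiring'' by blast
    show "multiplicity p a \<le> multiplicity p b"
    proof (cases "p dvd a")
      case True
      hence "p dvd b" using assms(2) p by (meson dvd_trans prime_dvd_power)
      hence "multiplicity p b \<ge> 1" using p False by (simp add: multiplicity_gt_zero_iff Suc_le_eq prime_elem_not_unit)
      thus ?thesis using le by simp
    qed (simp add: not_dvd_imp_multiplicity_0)
  qed
qed simp

lemma one_root_poly:
  fixes p :: "complex poly"
  assumes "degree p = k" "k \<ge> 1" "\<And>x y. poly p x = 0 \<Longrightarrow> poly p y = 0 \<Longrightarrow> x = y"
  obtains c a where "p = Polynomial.smult c ([:- a, 1:] ^ k)"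
proof -
  have "\<not> constant (poly p)" using assms by (simp add: constant_degree)
  then obtain a where a: "poly p a = 0" using fundamental_theorem_of_algebra by blast
  have "p \<noteq> 0" using assms by auto
  then obtain r where r: "p = [:- a, 1:] ^ order a p * r" "\<not> [:- a, 1:] dvd r"
    using order_decomp by blast
  have "poly r x \<noteq> 0" for x
  proof
    assume z: "poly r x = 0"
    hence "poly p x = 0" by (subst r(1)) simp
    hence "x = a" using assms(3) a by blast
    thus False using z r(2) by (simp add: poly_eq_0_iff_dvd)
  qed
  hence "constant (poly r)" using fundamental_theorem_of_algebra by blast
  hence "degree r = 0" by (simp add: constant_degree)
  then obtain c where c: "r = [:c:]" by (metis degree_eq_zeroE)
  hence p: "p = Polynomial.smult c ([:- a, 1:] ^ order a p)" by (subst r(1)) simp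
  have "c \<noteq> 0" using \<open>p \<noteq> 0\<close> r(1) c by auto
  hence "degree p = order a p" by (subst p) (simp add: degree_power_eq)
  thus ?thesis using that p assms(1) by metis
qed

text \<open>That a polynomial is a power of a linear one is here expressed without reference to the root.
  Being an identity between coefficients, it extends from general to all values of parameters.\<close>

lemma one_root_identity:
  fixes p :: "complex poly"
  assumes "p = Polynomial.smult c ([:- a, 1:] ^ k)"
  shows "of_nat k * (p * pderiv (pderiv p)) = of_nat (k - 1) * (pderiv p) ^ 2"
proof -
  define q where "q = [:- a, 1:]"
  have dq: "pderiv q = 1" by (simp add: q_def pderiv_pCons)
  have d1: "pderiv (q ^ j) = of_nat j * q ^ (j - 1)" for j
    by (cases j) (simp_all add: pderiv_power_Suc dq of_nat_poly del: of_nat_Suc power_Suc)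
  show ?thesis
  proof (cases k)
    case (Suc j)
    show ?thesis
    proof (cases j)
      case 0
      have "p = Polynomial.smult c q" using assms Suc 0 by (simp add: q_def)
      hence "pderiv p = [:c:]" by (simp add: pderiv_smult dq)
      hence "pderiv (pderiv p) = 0" by (simp add: pderiv_pCons)
      thus ?thesis using Suc 0 by simp
    next
      case (Suc i)
      hence k: "k = Suc (Suc i)" using \<open>k = Suc j\<close> by simp
      define C where "C = [:c:]"
      have p: "p = C * q ^ k" using assms by (simp add: q_def C_def)
      have dC: "pderiv (C * r) = C * pderiv r" for r by (simp add: C_def pderiv_smult)
      have p1: "pderiv p = C * (of_nat k * q ^ Suc i)" unfolding p dC d1 k by simp
      have dn: "pderiv (of_nat m * r) = of_nat m * pderiv r" for m and r :: "complex poly"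
        by (simp add: pderiv_mult pderiv_of_nat)
      have p2: "pderiv (pderiv p) = C * (of_nat k * (of_nat (Suc i) * q ^ i))"
        unfolding p1 dC dn d1 by simp
      have "k - 1 = Suc i" using k by simp
      have A: "p * pderiv (pderiv p) = (C * q ^ k) * (C * (of_nat k * (of_nat (Suc i) * q ^ i)))"
        by (rule arg_cong2[of _ _ _ _ "(*)"], rule p, rule p2)
      have B: "(pderiv p) ^ 2 = (C * (of_nat k * q ^ Suc i)) ^ 2" by (simp only: p1)
      show ?thesis unfolding A B \<open>k - 1 = Suc i\<close>
        by (simp add: k power2_eq_square algebra_simps del: of_nat_Suc)
    qed
  qed (use assms in simp)
qed

context fixed_web begin

lemma e1_ne_0: "e1 \<noteq> 0"
  by (simp add: e1_def cvec3_eq_iff)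

lemma dot_e1 [simp]: "dot e1 v = v $ 1"
  by (simp add: e1_def dot_def)

text \<open>The first component of \<open>f\<close> is \<open>x\<^sup>k G'\<close> with \<open>G'\<close> not divisible by \<open>x\<close>. If \<open>G'\<close> were not constant, a
  general form \<open>w\<close> would yield a common zero \<open>v\<close> of \<open>G'\<close> and \<open>w \<circ> f\<close> other than the finitely many
  zeros of \<open>G'\<close> on \<open>x = 0\<close>. But \<open>f v\<close> lies on the singular line \<open>x = 0\<close>, so a line through \<open>v\<close> is
  sent to it; by total invariance this line is \<open>x = 0\<close> itself, a contradiction.\<close>

lemma first_component: obtains c where "c \<noteq> 0" "\<And>v. f v $ 1 = c * v $ 1 ^ d"
proof -
  obtain G where G: "(\<lambda>v. f v $ 1) = eval3 G" using pmap_polyfun[OF f, of 1] by (auto simp: polyfun_def)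
  have tH: "tform d (\<lambda>v. f v $ 1)" using f by (simp add: pmap_def)
  obtain v1 where v1: "f v1 = e1" using pmap_surj[OF f d1] by blast
  hence H1: "f v1 $ 1 \<noteq> 0" by (simp add: e1_def)
  hence "G \<noteq> 0" using G eval3_eq_0_iff[of G] by metis
  then obtain G' where G': "G = [:- 0, 1:] ^ order 0 G * G'" "\<not> [:- 0, 1:] dvd G'" using order_decomp by blast
  define k where "k = order 0 G"
  have fac: "f v $ 1 = v $ 1 ^ k * eval3 G' v" for v
  proof -
    have "f v $ 1 = eval3 G v" using G by metis
    also have "\<dots> = v $ 1 ^ k * eval3 G' v"
      by (subst G'(1)) (simp only: minus_zero eval3_mult eval3_power eval3_x k_def)
    finally show ?thesis .
  qed
  have "homog d (\<lambda>v. v $ 1 ^ k * eval3 G' v)" using tH unfolding fac tform_def by simp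
  moreover have "\<exists>v. v $ 1 ^ k * eval3 G' v \<noteq> 0" using H1 fac by metis
  ultimately obtain a b where ab: "tform b (eval3 G')" "a + b = d"
    using factors_of_form[of "\<lambda>v. v $ 1 ^ k" "eval3 G'" d] by (metis polyfun_eval3 polyfun_nth polyfun_power)
  have "b = 0"
  proof (rule ccontr)
    assume "b \<noteq> 0"
    have bf: "bform b (\<lambda>y z. eval3 G' (v3 0 y z))"
      using tform_bform[OF ab(1), of "v3 0 1 0" "v3 0 0 1"] by (simp add: v3_basis)
    obtain \<kappa> s t where st: "\<And>j. s j \<noteq> 0 \<or> t j \<noteq> (0::complex)"
      "\<And>y z. eval3 G' (v3 0 y z) = \<kappa> * (\<Prod>j<b. y * t j - z * s j)" by (rule bform_factor[OF bf], rule that)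
    have "poly G' 0 \<noteq> 0" using G'(2) by (simp add: poly_eq_0_iff_dvd)
    hence "\<exists>v. eval3 [:poly G' 0:] v \<noteq> 0" using eval3_eq_0_iff[of "[:poly G' 0:]"] by auto
    then obtain y z where "poly (poly (poly G' 0) [:y:]) z \<noteq> 0" by (auto simp: eval3_pCons)
    hence "eval3 G' (v3 0 y z) \<noteq> 0" by (simp add: eval3_v3)
    hence "\<kappa> \<noteq> 0" using st(2) by auto
    define q where "q j = v3 0 (s j) (t j)" for j
    have q: "f (q j) \<noteq> 0" for j using st(1)[of j] pmap_eq_0[OF f, of "q j"] by (auto simp: q_def cvec3_eq_iff)
    have "\<exists>w. \<forall>j\<in>{..b}. (if j = b then F w else dot (f (q j)) w) \<noteq> 0"
    proof (rule polyfun_prod_ne_0)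
      show "polyfun (\<lambda>w. if j = b then F w else dot (f (q j)) w)" for j
        by (intro polyfun_if pF polyfun_dot) auto
      show "\<exists>w. (if j = b then F w else dot (f (q j)) w) \<noteq> 0" for j
        using F_ne_0 exists_dot_ne_0[OF q[of j]] by (cases "j = b") auto
    qed simp
    then obtain w where w: "\<And>j. j \<le> b \<Longrightarrow> (if j = b then F w else dot (f (q j)) w) \<noteq> 0" by auto
    have Fw: "F w \<noteq> 0" using w[of b] by simp
    have wq: "dot w (f (q j)) \<noteq> 0" if "j < b" for j using w[of j] that by (simp add: dot_commute)
    obtain v where v: "v \<noteq> 0" "eval3 G' v = 0" "dot w (f v) = 0"
      using common_zero_of_forms[OF ab(1) tform_pullback[OF f]] \<open>b \<noteq> 0\<close> d1 by (metis One_nat_def Suc_leI neq0_conv)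
    have "dot e1 (f v) = 0" using fac[of v] v(2) by simp
    then obtain u where u: "u \<noteq> 0" "dot u v = 0" "maps f u e1"
      using singular_preimages[OF e1_ne_0 sing _ v(1,3) Fw] by blast
    have "crs u e1 = 0" by (rule tot[OF u(1,3)])
    then obtain a where "a \<noteq> 0" "e1 = a *s u" using parallelE[OF _ u(1) e1_ne_0] by metis
    hence "dot e1 v = 0" using u(2) by (metis dot_scale_left mult_zero_right)
    hence vx: "v = v3 0 (v $ 2) (v $ 3)" by (simp add: cvec3_eq_iff)
    hence "eval3 G' (v3 0 (v $ 2) (v $ 3)) = 0" using v(2) by simp
    hence "(\<Prod>j<b. v $ 2 * t j - v $ 3 * s j) = 0" using \<open>\<kappa> \<noteq> 0\<close> unfolding st(2) by simp
    then obtain j where j: "j < b" "v $ 2 * t j = v $ 3 * s j" by (auto simp: prod_zero_iff)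
    have "crs (q j) v = 0" using j(2) vx by (subst vx) (simp add: crs_def q_def cvec3_eq_iff mult.commute)
    moreover have "q j \<noteq> 0" using st(1)[of j] by (auto simp: q_def cvec3_eq_iff)
    ultimately obtain a where a: "a \<noteq> 0" "v = a *s q j" using parallelE v(1) by blast
    hence "dot w (f (q j)) = 0" using v(3) by (simp add: pmap_scale[OF f] dot_lin)
    thus False using wq[OF j(1)] by simp
  qed
  hence "homog 0 (eval3 G')" using ab(1) by (simp add: tform_def)
  hence cst: "eval3 G' v = eval3 G' 0" for v by (rule homog_0_const)
  define c where "c = eval3 G' 0"
  have fc: "f v $ 1 = c * v $ 1 ^ k" for v using fac[of v] cst[of v] by (simp add: c_def)
  have c0: "c \<noteq> 0" using H1 fc by auto
  have "f (2 *s e1) $ 1 = 2 ^ d * f e1 $ 1" by (simp add: pmap_scale[OF f])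
  hence "(2::complex) ^ k = 2 ^ d" using c0 by (simp add: fc e1_def)
  hence "norm ((2::complex) ^ k) = norm ((2::complex) ^ d)" by simp
  hence "(2::real) ^ k = 2 ^ d" by (simp only: norm_power norm_numeral)
  hence "k = d" by simp
  thus ?thesis using that[OF c0] fc by simp
qed

definition c0 :: complex where "c0 = (SOME c. c \<noteq> 0 \<and> (\<forall>v. f v $ 1 = c * v $ 1 ^ d))"

lemma c0: "c0 \<noteq> 0" "f v $ 1 = c0 * v $ 1 ^ d"
proof -
  have "\<exists>c. c \<noteq> 0 \<and> (\<forall>v. f v $ 1 = c * v $ 1 ^ d)" by (metis first_component)
  hence "c0 \<noteq> 0 \<and> (\<forall>v. f v $ 1 = c0 * v $ 1 ^ d)" unfolding c0_def by (rule someI_ex)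
  thus "c0 \<noteq> 0" "f v $ 1 = c0 * v $ 1 ^ d" by auto
qed

definition gP where "gP = grad (\<lambda>v. f v $ 2)"
definition gQ where "gQ = grad (\<lambda>v. f v $ 3)"

text \<open>Modulo the first coordinate, \<open>tdiff f v\<close> induces the linear map \<open>(\<alpha>, \<beta>) \<mapsto> (N2, N3)\<close> with
  determinant \<open>J2\<close>. On the line \<open>x = 0\<close> it is the transposed differential of the restriction of
  \<open>f\<close> to that line.\<close>

definition N2 where "N2 v \<alpha> \<beta> = \<alpha> * gP v $ 2 + \<beta> * gQ v $ 2"
definition N3 where "N3 v \<alpha> \<beta> = \<alpha> * gP v $ 3 + \<beta> * gQ v $ 3"
definition J2 where "J2 v = gP v $ 2 * gQ v $ 3 - gP v $ 3 * gQ v $ 2"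

lemma d2: "d \<ge> 2" using d3 by simp

lemma tform_gP: "tform (d - 1) (\<lambda>v. gP v $ i)" and tform_gQ: "tform (d - 1) (\<lambda>v. gQ v $ i)"
  using f grad_tform[OF _ d2] by (auto simp: gP_def gQ_def pmap_def)

lemma polyfun_gP [intro]: "polyfun (\<lambda>v. gP v $ i)" and polyfun_gQ [intro]: "polyfun (\<lambda>v. gQ v $ i)"
  using tform_gP tform_gQ by (auto simp: tform_def)

lemma eulerP: "v $ 1 * gP v $ 1 + v $ 2 * gP v $ 2 + v $ 3 * gP v $ 3 = of_nat d * f v $ 2"
  using euler[of "\<lambda>v. f v $ 2" d v] f by (simp add: pmap_def tform_def gP_def dot_def mult.commute)

lemma eulerQ: "v $ 1 * gQ v $ 1 + v $ 2 * gQ v $ 2 + v $ 3 * gQ v $ 3 = of_nat d * f v $ 3"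
  using euler[of "\<lambda>v. f v $ 3" d v] f by (simp add: pmap_def tform_def gQ_def dot_def mult.commute)

lemma grad_first: "grad (\<lambda>v. f v $ 1) v = v3 (c0 * of_nat d * v $ 1 ^ (d - 1)) 0 0"
proof (rule grad_unique[OF pmap_polyfun[OF f]])
  fix t :: "complex^3"
  have "((\<lambda>s. c0 * (v $ 1 + s * t $ 1) ^ d) has_field_derivative c0 * (of_nat d * v $ 1 ^ (d - 1) * t $ 1)) (at 0)"
    by (auto intro!: derivative_eq_intros)
  thus "((\<lambda>s. f (v + s *s t) $ 1) has_field_derivative dot (v3 (c0 * of_nat d * v $ 1 ^ (d - 1)) 0 0) t) (at 0)"
    by (simp add: c0 dot_def mult_ac)
qed

lemma tdiff_eq: "tdiff f v w = v3 (w $ 1 * (c0 * of_nat d * v $ 1 ^ (d - 1)) + w $ 2 * gP v $ 1 + w $ 3 * gQ v $ 1)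
    (N2 v (w $ 2) (w $ 3)) (N3 v (w $ 2) (w $ 3))"
  unfolding tdiff_def grad_first by (simp add: lin3_def cvec3_eq_iff N2_def N3_def gP_def gQ_def)

subsection \<open>The form in coordinates\<close>

definition G where "G = (SOME G. F = eval3 G)"

lemma G: "F = eval3 G"
proof -
  have "\<exists>G. F = eval3 G" using pF by (auto simp: polyfun_def)
  thus ?thesis unfolding G_def by (rule someI_ex)
qed

lemma homogeneous_G: "homogeneous n G"
proof -
  have "homog n (eval3 G)" by (subst G[symmetric]) (rule hF)
  thus ?thesis by (rule homog_imp_homogeneous)
qed

lemma squarefree_G: "squarefree G"
proof -
  have "sqfree (eval3 G)" by (subst G[symmetric]) (rule sq)
  thus ?thesis by (simp only: sqfree_iff_squarefree)
qed

text \<open>As a polynomial in the first dual coordinate \<open>w\<close>, the equation of the curve is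
  \<open>T \<alpha> \<beta> w\<^sup>k + \<dots> + C 0 \<alpha> \<beta>\<close>. In the affine chart \<open>w = 1\<close> around \<open>e1\<close> the term of lowest order is
  \<open>T\<close>, so \<open>n - k\<close> is the multiplicity of the singular point and the zeros of \<open>T\<close> are its tangents.\<close>

definition k where "k = degree G"
definition C where "C i \<alpha> \<beta> = spec \<alpha> \<beta> (coeff G i)"
definition T where "T = C k"

lemma F_expand: "F (v3 w \<alpha> \<beta>) = (\<Sum>i\<le>k. w ^ i * C i \<alpha> \<beta>)"
proof -
  have "F (v3 w \<alpha> \<beta>) = spec \<alpha> \<beta> (poly G [:[:w:]:])"
    using fun_cong[OF G, of "v3 w \<alpha> \<beta>"] by (simp only: eval3_v3 spec_def)
  also have "\<dots> = (\<Sum>i\<le>k. w ^ i * C i \<alpha> \<beta>)"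
    unfolding poly_altdef k_def by (simp add: spec_def poly_sum poly_power C_def mult.commute)
  finally show ?thesis .
qed

lemma k_le: "k \<le> n"
proof -
  have "coeff G i = 0" if "i > n" for i
    using that by (intro poly_eqI) (simp add: homogeneous_coeff_0[OF homogeneous_G])
  thus ?thesis unfolding k_def by (meson degree_le)
qed

lemma bform_C: assumes "i \<le> n" shows "bform (n - i) (C i)"
proof -
  have "C i (t * a) (t * b) = t ^ (n - i) * C i a b" for t a b
  proof -
    have hom: "\<forall>w. (\<Sum>j\<le>k. C j (t * a) (t * b) * (t * w) ^ j) = (\<Sum>j\<le>k. t ^ n * C j a b * w ^ j)" for t
    proof
      fix w
      have "v3 (t * w) (t * a) (t * b) = t *s v3 w a b" by (simp add: cvec3_eq_iff)
      hence "F (v3 (t * w) (t * a) (t * b)) = t ^ n * F (v3 w a b)" by (simp add: homogD[OF hF])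
      thus "(\<Sum>j\<le>k. C j (t * a) (t * b) * (t * w) ^ j) = (\<Sum>j\<le>k. t ^ n * C j a b * w ^ j)"
        unfolding F_expand by (simp add: sum_distrib_left mult_ac)
    qed
    have nz: "C i (t * a) (t * b) = t ^ (n - i) * C i a b" if "t \<noteq> 0" for t
    proof (cases "i \<le> k")
      case True
      have "\<forall>w. (\<Sum>j\<le>k. (C j (t * a) (t * b) * t ^ j) * w ^ j) = (\<Sum>j\<le>k. t ^ n * C j a b * w ^ j)"
        using hom[of t] by (simp add: power_mult_distrib mult_ac)
      hence "C i (t * a) (t * b) * t ^ i = t ^ n * C i a b" using True by (subst (asm) polyfun_eq_coeffs) blast
      moreover have "t ^ n = t ^ i * t ^ (n - i)" using assms by (simp flip: power_add)
      ultimately show ?thesis using that by simp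
    next
      case False
      hence "coeff G i = 0" unfolding k_def by (simp add: coeff_eq_0)
      thus ?thesis by (simp add: C_def spec_def)
    qed
    show ?thesis
    proof (cases "t = 0")
      case True
      have c00: "C i 0 0 = coeff (coeff (coeff G i) 0) 0" by (simp add: C_def spec_def poly_0_coeff_0)
      show ?thesis
      proof (cases "i = n")
        case True
        have "coeff (coeff (coeff G n) j) l = 0" if "j > 0 \<or> l > 0" for j l
          using that by (intro homogeneous_coeff_0[OF homogeneous_G]) auto
        hence "coeff G n = [:[:coeff (coeff (coeff G n) 0) 0:]:]"
          by (intro poly_eqI) (auto simp: coeff_pCons split: nat.splits)
        hence "C n a b = coeff (coeff (coeff G n) 0) 0" by (metis C_def poly_pCons poly_0 spec_def mult_zero_right add_0_right)
        thus ?thesis using True \<open>t = 0\<close> c00 by simp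
      next
        case False
        thus ?thesis using \<open>t = 0\<close> assms c00 by (simp add: zero_power homogeneous_coeff_0[OF homogeneous_G])
      qed
    qed (rule nz)
  qed
  thus ?thesis unfolding bform_def C_def by (simp add: polyfun_spec)
qed

lemma bform_T: "bform (n - k) T"
  unfolding T_def by (rule bform_C[OF k_le])

lemma T_ne_0: "\<exists>\<alpha> \<beta>. T \<alpha> \<beta> \<noteq> 0"
proof -
  have "G \<noteq> 0" using squarefree_G by auto
  hence "coeff G k \<noteq> 0" by (simp add: k_def)
  hence "[:coeff G k:] \<noteq> 0" by simp
  hence "\<exists>v. eval3 [:coeff G k:] v \<noteq> 0" using eval3_eq_0_iff by blast
  thus ?thesis by (auto simp: eval3_pCons T_def C_def spec_def)
qed

lemma multiplicity_ge_2: "n - k \<ge> 2"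
proof (rule ccontr)
  assume m: "\<not> n - k \<ge> 2"
  obtain \<alpha> \<beta> where ab: "T \<alpha> \<beta> \<noteq> 0" using T_ne_0 by blast
  define t where "t = v3 0 \<alpha> \<beta>"
  have eq: "F (e1 + s *s t) = s ^ (n - k) * (\<Sum>i\<le>k. s ^ (k - i) * C i \<alpha> \<beta>)" for s
  proof -
    have "e1 + s *s t = v3 1 (s * \<alpha>) (s * \<beta>)" by (simp add: e1_def t_def cvec3_eq_iff)
    hence "F (e1 + s *s t) = (\<Sum>i\<le>k. C i (s * \<alpha>) (s * \<beta>))" by (simp add: F_expand)
    also have "\<dots> = (\<Sum>i\<le>k. s ^ (n - k) * (s ^ (k - i) * C i \<alpha> \<beta>))"
    proof (intro sum.cong refl)
      fix i assume "i \<in> {..k}"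
      hence i: "i \<le> n" "n - i = (n - k) + (k - i)" using k_le by auto
      show "C i (s * \<alpha>) (s * \<beta>) = s ^ (n - k) * (s ^ (k - i) * C i \<alpha> \<beta>)"
        unfolding bform_scale[OF bform_C[OF i(1)]] i(2) power_add by (simp only: mult.assoc)
    qed
    finally show ?thesis by (simp add: sum_distrib_left)
  qed
  have lim0: "(\<Sum>i\<le>k. (0::complex) ^ (k - i) * C i \<alpha> \<beta>) = T \<alpha> \<beta>"
  proof -
    have "(\<Sum>i\<le>k. (0::complex) ^ (k - i) * C i \<alpha> \<beta>) = (\<Sum>i\<in>{k}. 0 ^ (k - i) * C i \<alpha> \<beta>)"
      by (rule sum.mono_neutral_right) auto
    thus ?thesis by (simp add: T_def)
  qed
  have Fe: "F e1 = 0" by (rule sing_zero[OF sing])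
  consider "n - k = 0" | "n - k = 1" using m by linarith
  thus False
  proof cases
    case 1
    thus False using eq[of 0] lim0 Fe ab by simp
  next
    case 2
    have eq': "F (e1 + s *s t) / s = (\<Sum>i\<le>k. s ^ (k - i) * C i \<alpha> \<beta>)" if "s \<noteq> 0" for s
      using eq[of s] 2 that by simp
    have "((\<lambda>s. (F (e1 + s *s t) - F e1) / s) \<longlongrightarrow> dot (grad F e1) t) (at 0)"
      using grad_field_derivative[OF pF, of e1 t] by (simp add: has_field_derivative_iff)
    hence "((\<lambda>s. F (e1 + s *s t) / s) \<longlongrightarrow> 0) (at 0)" using Fe sing by (simp add: dot_lin)
    hence "((\<lambda>s. \<Sum>i\<le>k. s ^ (k - i) * C i \<alpha> \<beta>) \<longlongrightarrow> 0) (at 0)"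
      by (rule Lim_transform_eventually) (rule eventually_mono[OF eventually_neq_at_within eq'])
    moreover have "((\<lambda>s. \<Sum>i\<le>k. s ^ (k - i) * C i \<alpha> \<beta>) \<longlongrightarrow> (\<Sum>i\<le>k. 0 ^ (k - i) * C i \<alpha> \<beta>)) (at 0)"
      by (intro tendsto_intros)
    ultimately have "(\<Sum>i\<le>k. (0::complex) ^ (k - i) * C i \<alpha> \<beta>) = 0" using LIM_unique by blast
    thus False using lim0 ab by simp
  qed
qed

subsection \<open>The pulled back web along the invariant line\<close>

text \<open>The linear forms vanishing at \<open>(x, y, z)\<close> with \<open>x \<noteq> 0\<close> are \<open>(- (\<alpha> y + \<beta> z), x \<alpha>, x \<beta>)\<close>. On them \<open>F\<close>
  is divisible by \<open>x\<^sup>n\<^sup>-\<^sup>k\<close>, and \<open>E\<close> is the quotient.\<close>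

definition E where "E x y z \<alpha> \<beta> = (\<Sum>i\<le>k. (- (\<alpha> * y + \<beta> * z)) ^ i * x ^ (k - i) * C i \<alpha> \<beta>)"

lemma E_eq: "x ^ (n - k) * E x y z \<alpha> \<beta> = F (v3 (- (\<alpha> * y + \<beta> * z)) (x * \<alpha>) (x * \<beta>))"
proof -
  have "x ^ (n - k) * ((- (\<alpha> * y + \<beta> * z)) ^ i * x ^ (k - i) * C i \<alpha> \<beta>) =
     (- (\<alpha> * y + \<beta> * z)) ^ i * C i (x * \<alpha>) (x * \<beta>)" if "i \<le> k" for i
  proof -
    have i: "i \<le> n" "n - i = (n - k) + (k - i)" using k_le that by auto
    show ?thesis unfolding bform_scale[OF bform_C[OF i(1)]] i(2) power_add by (simp only: mult_ac)
  qed
  thus ?thesis unfolding E_def F_expand sum_distrib_left by (intro sum.cong) auto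
qed

lemma E_0: "E 0 y z \<alpha> \<beta> = (- (\<alpha> * y + \<beta> * z)) ^ k * T \<alpha> \<beta>"
proof -
  have "E 0 y z \<alpha> \<beta> = (\<Sum>i\<in>{k}. (- (\<alpha> * y + \<beta> * z)) ^ i * 0 ^ (k - i) * C i \<alpha> \<beta>)"
    unfolding E_def by (rule sum.mono_neutral_right) auto
  thus ?thesis by (simp add: T_def)
qed

lemma polyfun_C: "polyfun p \<Longrightarrow> polyfun q \<Longrightarrow> i \<le> n \<Longrightarrow> polyfun (\<lambda>v. C i (p v) (q v))"
  using bform_polyfun[OF bform_C] by blast

lemma polyfun_E:
  assumes "polyfun x" "polyfun y" "polyfun z" "polyfun p" "polyfun q"
  shows "polyfun (\<lambda>v. E (x v) (y v) (z v) (p v) (q v))"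
  unfolding E_def using k_le by (intro polyfun_intros polyfun_C assms) auto

lemma polyfun_N:
  assumes "polyfun p" "polyfun q"
  shows "polyfun (\<lambda>v. N2 v (p v) (q v))" "polyfun (\<lambda>v. N3 v (p v) (q v))"
  unfolding N2_def N3_def by (intro polyfun_intros assms polyfun_gP polyfun_gQ)+

text \<open>The pull-back identity for the quotients \<open>E\<close>; the powers of \<open>x\<close> and the other factors common to
  both sides cancel because the first component of \<open>f\<close> is a power of \<open>x\<close>.\<close>

lemma E_identity:
  "E (v $ 1) (v $ 2) (v $ 3) (N2 v \<alpha> \<beta>) (N3 v \<alpha> \<beta>) * E (f v $ 1) (f v $ 2) (f v $ 3) \<alpha>' \<beta>' =
   E (v $ 1) (v $ 2) (v $ 3) (N2 v \<alpha>' \<beta>') (N3 v \<alpha>' \<beta>') * E (f v $ 1) (f v $ 2) (f v $ 3) \<alpha> \<beta>"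
proof -
  define X where "X v = E (v $ 1) (v $ 2) (v $ 3) (N2 v \<alpha> \<beta>) (N3 v \<alpha> \<beta>) * E (f v $ 1) (f v $ 2) (f v $ 3) \<alpha>' \<beta>' -
   E (v $ 1) (v $ 2) (v $ 3) (N2 v \<alpha>' \<beta>') (N3 v \<alpha>' \<beta>') * E (f v $ 1) (f v $ 2) (f v $ 3) \<alpha> \<beta>" for v
  have "X v = 0"
  proof (rule polyfun_zero_of_mult)
    show "polyfun X" unfolding X_def[abs_def]
      by (intro polyfun_diff polyfun_mult polyfun_E polyfun_N polyfun_nth polyfun_const pmap_polyfun[OF f])
    show "polyfun (\<lambda>v. v $ 1)" "\<exists>v :: complex^3. v $ 1 \<noteq> 0" by (auto intro: exI[of _ e1] simp: e1_def)
    fix v :: "complex^3" assume x: "v $ 1 \<noteq> 0"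
    define w where "w \<alpha> \<beta> = v3 (- (\<alpha> * f v $ 2 + \<beta> * f v $ 3)) (f v $ 1 * \<alpha>) (f v $ 1 * \<beta>)" for \<alpha> \<beta>
    have w: "dot (w \<alpha> \<beta>) (f v) = 0" for \<alpha> \<beta> by (simp add: w_def dot_def algebra_simps)
    have Fw: "F (w \<alpha> \<beta>) = f v $ 1 ^ (n - k) * E (f v $ 1) (f v $ 2) (f v $ 3) \<alpha> \<beta>" for \<alpha> \<beta>
      by (simp add: E_eq w_def)
    define x where "x = v $ 1"
    define \<mu> where "\<mu> = c0 * x ^ (d - 1)"
    have f1: "f v $ 1 = \<mu> * x"
      using d1 by (simp add: c0 \<mu>_def x_def power_eq_if[of _ d] mult_ac)
    have td: "tdiff f v (w \<alpha> \<beta>) = \<mu> *s v3 (- (N2 v \<alpha> \<beta> * v $ 2 + N3 v \<alpha> \<beta> * v $ 3)) (x * N2 v \<alpha> \<beta>) (x * N3 v \<alpha> \<beta>)" for \<alpha> \<beta>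
    proof -
      have 1: "of_nat d * (\<alpha> * f v $ 2 + \<beta> * f v $ 3) = x * (\<alpha> * gP v $ 1 + \<beta> * gQ v $ 1) + (N2 v \<alpha> \<beta> * v $ 2 + N3 v \<alpha> \<beta> * v $ 3)"
      proof -
        have "of_nat d * (\<alpha> * f v $ 2 + \<beta> * f v $ 3) = \<alpha> * (of_nat d * f v $ 2) + \<beta> * (of_nat d * f v $ 3)"
          by (simp add: algebra_simps)
        thus ?thesis unfolding eulerP[symmetric] eulerQ[symmetric] x_def N2_def N3_def by (simp add: algebra_simps)
      qed
      have "- (\<alpha> * f v $ 2 + \<beta> * f v $ 3) * (c0 * of_nat d * x ^ (d - 1)) + f v $ 1 * \<alpha> * gP v $ 1 + f v $ 1 * \<beta> * gQ v $ 1
        = \<mu> * (x * (\<alpha> * gP v $ 1 + \<beta> * gQ v $ 1) - of_nat d * (\<alpha> * f v $ 2 + \<beta> * f v $ 3))"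
        unfolding f1 by (simp add: \<mu>_def algebra_simps)
      also have "\<dots> = \<mu> * (- (N2 v \<alpha> \<beta> * v $ 2 + N3 v \<alpha> \<beta> * v $ 3))" unfolding 1 by simp
      finally have 2: "- (\<alpha> * f v $ 2 + \<beta> * f v $ 3) * (c0 * of_nat d * x ^ (d - 1)) + f v $ 1 * \<alpha> * gP v $ 1 + f v $ 1 * \<beta> * gQ v $ 1
        = \<mu> * (- (N2 v \<alpha> \<beta> * v $ 2 + N3 v \<alpha> \<beta> * v $ 3))" .
      have 3: "N2 v (f v $ 1 * \<alpha>) (f v $ 1 * \<beta>) = \<mu> * (x * N2 v \<alpha> \<beta>)" "N3 v (f v $ 1 * \<alpha>) (f v $ 1 * \<beta>) = \<mu> * (x * N3 v \<alpha> \<beta>)"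
        unfolding f1 N2_def N3_def by (simp_all add: algebra_simps)
      show ?thesis unfolding tdiff_eq w_def v3_nth x_def[symmetric] 2 3 by (simp add: cvec3_eq_iff)
    qed
    have Ft: "F (tdiff f v (w \<alpha> \<beta>)) = \<mu> ^ n * (x ^ (n - k) * E (v $ 1) (v $ 2) (v $ 3) (N2 v \<alpha> \<beta>) (N3 v \<alpha> \<beta>))" for \<alpha> \<beta>
      unfolding td homogD[OF hF] x_def[symmetric] E_eq by simp
    have nz: "x \<noteq> 0" "\<mu> \<noteq> 0" "f v $ 1 \<noteq> 0" using x c0(1) f1 by (auto simp: x_def \<mu>_def)
    have "v \<noteq> 0" using x by auto
    hence "F (tdiff f v (w \<alpha> \<beta>)) * F (w \<alpha>' \<beta>') = F (tdiff f v (w \<alpha>' \<beta>')) * F (w \<alpha> \<beta>)"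
      by (rule pullback_identity[OF _ w w])
    thus "X v = 0" unfolding Ft Fw X_def using nz by simp
  qed
  thus ?thesis by (simp add: X_def)
qed

lemma line_image:
  assumes "y \<noteq> 0 \<or> z \<noteq> 0" shows "f (v3 0 y z) $ 1 = 0" "f (v3 0 y z) $ 2 \<noteq> 0 \<or> f (v3 0 y z) $ 3 \<noteq> 0"
proof -
  show 1: "f (v3 0 y z) $ 1 = 0" using d1 by (simp add: c0 zero_power)
  have "f (v3 0 y z) \<noteq> 0" using pmap_eq_0[OF f, of "v3 0 y z"] assms by (auto simp: cvec3_eq_iff)
  thus "f (v3 0 y z) $ 2 \<noteq> 0 \<or> f (v3 0 y z) $ 3 \<noteq> 0" using 1 by (auto simp: cvec3_eq_iff)
qed

lemma euler_line:
  "N2 (v3 0 y z) \<alpha> \<beta> * y + N3 (v3 0 y z) \<alpha> \<beta> * z = of_nat d * (\<alpha> * f (v3 0 y z) $ 2 + \<beta> * f (v3 0 y z) $ 3)"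
proof -
  have "of_nat d * (\<alpha> * f (v3 0 y z) $ 2 + \<beta> * f (v3 0 y z) $ 3) =
     \<alpha> * (of_nat d * f (v3 0 y z) $ 2) + \<beta> * (of_nat d * f (v3 0 y z) $ 3)" by (simp add: algebra_simps)
  also have "\<dots> = N2 (v3 0 y z) \<alpha> \<beta> * y + N3 (v3 0 y z) \<alpha> \<beta> * z"
    unfolding eulerP[symmetric] eulerQ[symmetric] N2_def N3_def by (simp add: algebra_simps)
  finally show ?thesis by simp
qed

lemma cancel_linear:
  assumes X: "polyfun (\<lambda>v. X (v $ 1) (v $ 2))" and p: "p \<noteq> 0 \<or> q \<noteq> (0::complex)"
    and z: "\<And>\<alpha> \<beta>. \<alpha> * p + \<beta> * q \<noteq> 0 \<Longrightarrow> X \<alpha> \<beta> = 0"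
  shows "X \<alpha> \<beta> = 0"
proof -
  have "X (v3 \<alpha> \<beta> 0 $ 1) (v3 \<alpha> \<beta> 0 $ 2) = 0"
  proof (rule polyfun_zero_of_mult[OF X])
    show "polyfun (\<lambda>v. v $ 1 * p + v $ 2 * q)" by (intro polyfun_intros polyfun_nth polyfun_const)
    show "\<exists>v :: complex^3. v $ 1 * p + v $ 2 * q \<noteq> 0"
      using p by (cases "p = 0") (auto intro: exI[of _ "v3 0 1 0"] exI[of _ "v3 1 0 0"])
  qed (use z in auto)
  thus ?thesis by simp
qed

text \<open>The restriction of \<open>E_identity\<close> to \<open>x = 0\<close>, where \<open>E\<close> reduces to \<open>T\<close> times a power of a linear
  factor; by Euler's formula these factors agree on both sides and can be cancelled. The
  differential of \<open>f\<close> along the invariant line therefore permutes the tangents.\<close>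

lemma T_identity:
  assumes yz: "y \<noteq> 0 \<or> z \<noteq> 0" and v: "v = v3 0 y z"
  shows "T (N2 v \<alpha> \<beta>) (N3 v \<alpha> \<beta>) * T \<alpha>' \<beta>' = T (N2 v \<alpha>' \<beta>') (N3 v \<alpha>' \<beta>') * T \<alpha> \<beta>"
proof -
  define p q where "p = f v $ 2" and "q = f v $ 3"
  have pq: "p \<noteq> 0 \<or> q \<noteq> 0" using line_image(2)[OF yz] by (simp add: v p_def q_def)
  define X where "X \<alpha> \<beta> \<alpha>' \<beta>' = T (N2 v \<alpha> \<beta>) (N3 v \<alpha> \<beta>) * T \<alpha>' \<beta>' - T (N2 v \<alpha>' \<beta>') (N3 v \<alpha>' \<beta>') * T \<alpha> \<beta>" for \<alpha> \<beta> \<alpha>' \<beta>'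
  have 1: "X \<alpha> \<beta> \<alpha>' \<beta>' = 0" if nz: "\<alpha> * p + \<beta> * q \<noteq> 0" "\<alpha>' * p + \<beta>' * q \<noteq> 0" for \<alpha> \<beta> \<alpha>' \<beta>'
  proof -
    define a a' where "a = \<alpha> * p + \<beta> * q" and "a' = \<alpha>' * p + \<beta>' * q"
    have e: "N2 v \<alpha> \<beta> * y + N3 v \<alpha> \<beta> * z = of_nat d * a" "N2 v \<alpha>' \<beta>' * y + N3 v \<alpha>' \<beta>' * z = of_nat d * a'"
      using euler_line by (simp_all add: v a_def a'_def p_def q_def)
    have "(- (of_nat d * a)) ^ k * T (N2 v \<alpha> \<beta>) (N3 v \<alpha> \<beta>) * ((- a') ^ k * T \<alpha>' \<beta>') =
       (- (of_nat d * a')) ^ k * T (N2 v \<alpha>' \<beta>') (N3 v \<alpha>' \<beta>') * ((- a) ^ k * T \<alpha> \<beta>)"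
    proof -
      have x: "v $ 1 = 0" "v $ 2 = y" "v $ 3 = z" "f v $ 1 = 0" using line_image(1)[OF yz] by (simp_all add: v)
      have aa: "\<alpha> * f v $ 2 + \<beta> * f v $ 3 = a" "\<alpha>' * f v $ 2 + \<beta>' * f v $ 3 = a'"
        by (simp_all add: a_def a'_def p_def q_def)
      show ?thesis using E_identity[of v \<alpha> \<beta> \<alpha>' \<beta>'] by (simp only: x E_0 e aa)
    qed
    moreover have "(- (of_nat d * b)) ^ k = of_nat d ^ k * (- b) ^ k" for b :: complex
      by (metis mult_minus_right power_mult_distrib)
    ultimately have "(of_nat d ^ k * (- a) ^ k * (- a') ^ k) * X \<alpha> \<beta> \<alpha>' \<beta>' = 0"
      by (simp add: X_def algebra_simps)
    moreover have "a \<noteq> 0" "a' \<noteq> 0" using nz by (simp_all add: a_def a'_def)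
    hence "of_nat d ^ k * (- a) ^ k * (- a') ^ k \<noteq> 0" using d1 by simp
    ultimately show ?thesis by (metis mult_eq_0_iff)
  qed
  have pT: "polyfun (\<lambda>u. T (N2 v (u $ 1) (u $ 2)) (N3 v (u $ 1) (u $ 2)))"
    unfolding N2_def N3_def by (intro bform_polyfun[OF bform_T] polyfun_intros polyfun_nth polyfun_const)
  have pT': "polyfun (\<lambda>u. T (u $ 1) (u $ 2))" by (intro bform_polyfun[OF bform_T] polyfun_nth)
  have 2: "X \<alpha> \<beta> \<alpha>' \<beta>' = 0" if "\<alpha>' * p + \<beta>' * q \<noteq> 0" for \<alpha> \<beta> \<alpha>' \<beta>'
  proof (rule cancel_linear[OF _ pq, of "\<lambda>\<alpha> \<beta>. X \<alpha> \<beta> \<alpha>' \<beta>'"])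
    show "polyfun (\<lambda>u. X (u $ 1) (u $ 2) \<alpha>' \<beta>')" unfolding X_def
      by (intro polyfun_diff polyfun_mult pT pT' polyfun_const)
  qed (use 1 that in blast)
  have "X \<alpha> \<beta> \<alpha>' \<beta>' = 0"
  proof (rule cancel_linear[OF _ pq, of "\<lambda>\<alpha>' \<beta>'. X \<alpha> \<beta> \<alpha>' \<beta>'"])
    show "polyfun (\<lambda>u. X \<alpha> \<beta> (u $ 1) (u $ 2))" unfolding X_def
      by (intro polyfun_diff polyfun_mult pT pT' polyfun_const)
  qed (use 2 in blast)
  thus ?thesis by (simp add: X_def)
qed

lemma N_det: "N2 v a b * N3 v a' b' - N3 v a b * N2 v a' b' = J2 v * (a * b' - b * a')"
  by (simp add: N2_def N3_def J2_def algebra_simps)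

lemma J2_tform: "tform (2 * (d - 1)) J2"
  using tform_diff[OF tform_mult[OF tform_gP tform_gQ] tform_mult[OF tform_gP tform_gQ], of 2 3 3 2]
  by (simp add: J2_def[abs_def] mult_2)

lemma J2_zero: obtains y z where "y \<noteq> 0 \<or> z \<noteq> 0" "J2 (v3 0 y z) = 0"
proof -
  obtain v where v: "v \<noteq> 0" "dot e1 v = 0" "J2 v = 0" 
  proof -
    have "2 * (d - 1) \<ge> 1" using d2 by simp
    thus ?thesis using zero_on_plane[OF J2_tform, of e1] that by blast
  qed
  hence vv: "v = v3 0 (v $ 2) (v $ 3)" by (simp add: cvec3_eq_iff)
  have "v $ 2 \<noteq> 0 \<or> v $ 3 \<noteq> 0" using v(1,2) by (auto simp: cvec3_eq_iff)
  moreover have "J2 (v3 0 (v $ 2) (v $ 3)) = 0" using v(3) vv by simp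
  ultimately show ?thesis by (rule that)
qed

text \<open>Otherwise the two components \<open>p\<close> and \<open>q\<close> of the restriction of \<open>f\<close> to the line have vanishing
  Wronskian; being coprime they are constant in the affine coordinate, so both vanish at infinity.\<close>

lemma J2_nonzero: obtains y z where "J2 (v3 0 y z) \<noteq> 0"
proof (rule ccontr)
  assume "\<not> thesis"
  hence J: "J2 (v3 0 y z) = 0" for y z using that by blast
  define P where "P y z = f (v3 0 y z) $ 2" for y z
  define Q where "Q y z = f (v3 0 y z) $ 3" for y z
  have bP: "bform d P" unfolding P_def[abs_def] using f tform_bform[of d "\<lambda>v. f v $ 2" "v3 0 1 0" "v3 0 0 1"]
    by (simp add: pmap_def v3_basis)
  have bQ: "bform d Q" unfolding Q_def[abs_def] using f tform_bform[of d "\<lambda>v. f v $ 3" "v3 0 1 0" "v3 0 0 1"]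
    by (simp add: pmap_def v3_basis)
  have cur: "\<exists>p. \<forall>t. h (v3 0 1 t) = poly p t" if "polyfun h" for h
  proof (rule polyfun_curve[OF that])
    show "\<exists>p. \<forall>t. v3 0 1 t $ i = poly p t" for i
      using exhaust_3[of i] by (auto intro: exI[of _ "[:0, 1:]"] exI[of _ 1] exI[of _ 0])
  qed
  obtain p where p: "\<And>t. P 1 t = poly p t" using cur[OF pmap_polyfun[OF f, of 2]] by (auto simp: P_def)
  obtain q where q: "\<And>t. Q 1 t = poly q t" using cur[OF pmap_polyfun[OF f, of 3]] by (auto simp: Q_def)
  have der: "poly (pderiv r) t = grad h (v3 0 1 t) $ 3" if "polyfun h" "\<And>t. h (v3 0 1 t) = poly r t" for h r t
  proof -
    have "v3 0 1 t + s *s v3 0 0 1 = v3 0 1 (t + s)" for s by (simp add: cvec3_eq_iff)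
    hence "((\<lambda>s. poly r (t + s)) has_field_derivative dot (grad h (v3 0 1 t)) (v3 0 0 1)) (at 0)"
      using grad_field_derivative[OF that(1), of "v3 0 1 t" "v3 0 0 1"] by (simp add: that(2))
    moreover have "((\<lambda>s. poly r (t + s)) has_field_derivative poly (pderiv r) t) (at 0)"
      by (auto intro!: derivative_eq_intros poly_DERIV[THEN DERIV_chain2])
    ultimately have "poly (pderiv r) t = dot (grad h (v3 0 1 t)) (v3 0 0 1)" using DERIV_unique by blast
    thus ?thesis by (simp add: dot_def)
  qed
  have w: "poly (p * pderiv q) t = poly (q * pderiv p) t" for t
  proof -
    define v where "v = v3 0 1 t"
    have "of_nat d * (f v $ 2 * gQ v $ 3 - f v $ 3 * gP v $ 3) = v $ 2 * J2 v"
    proof -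
      have "of_nat d * (f v $ 2 * gQ v $ 3 - f v $ 3 * gP v $ 3) =
        (of_nat d * f v $ 2) * gQ v $ 3 - (of_nat d * f v $ 3) * gP v $ 3" by (simp add: algebra_simps)
      thus ?thesis unfolding eulerP[symmetric] eulerQ[symmetric] J2_def by (simp add: v_def algebra_simps)
    qed
    hence "f v $ 2 * gQ v $ 3 = f v $ 3 * gP v $ 3" using J[of 1 t] d1 by (simp add: v_def)
    thus ?thesis using der[OF pmap_polyfun[OF f, of 2], of p t] der[OF pmap_polyfun[OF f, of 3], of q t] p q
      by (simp add: P_def Q_def gP_def gQ_def v_def)
  qed
  hence pq: "p * pderiv q = q * pderiv p" using poly_eq_poly_eq_iff by blast
  have nc: "P y z \<noteq> 0 \<or> Q y z \<noteq> 0" if "y \<noteq> 0 \<or> z \<noteq> 0" for y z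
    using line_image(2)[OF that] by (simp add: P_def Q_def)
  have "degree (gcd p q) = 0"
  proof (rule ccontr)
    assume "degree (gcd p q) \<noteq> 0"
    then obtain x where "poly p x = 0" "poly q x = 0" by (rule gcd_root)
    thus False using nc[of 1 x] p q by simp
  qed
  moreover have "gcd p q \<noteq> 0" using nc[of 1 0] p q by auto
  ultimately have cop: "coprime p q" by (metis is_unit_gcd is_unit_iff_degree)
  have const: "degree r = 0" if "r dvd s * pderiv r" "coprime r s" for r s :: "complex poly"
  proof (rule ccontr)
    assume "degree r \<noteq> 0"
    hence "pderiv r \<noteq> 0" by (simp add: pderiv_eq_0_iff)
    moreover have "r dvd pderiv r" using that by (simp add: coprime_dvd_mult_right_iff)
    ultimately have "degree r \<le> degree (pderiv r)" by (rule dvd_imp_degree_le[rotated])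
    thus False using \<open>degree r \<noteq> 0\<close> by (simp add: degree_pderiv)
  qed
  have "p dvd q * pderiv p" unfolding pq[symmetric] by simp
  hence dp: "degree p = 0" using const[of p q] cop by blast
  have "q dvd p * pderiv q" unfolding pq by simp
  hence dq: "degree q = 0" using const[of q p] cop by (simp add: coprime_commute)
  have zero: "B 0 1 = 0" if B: "bform d B" "\<And>t. B 1 t = poly r t" and r: "degree r = 0" for B r
  proof -
    obtain a where a: "r = [:a:]" using r by (metis degree_eq_zeroE)
    have eq: "s ^ d * a = B s 1" if "s \<noteq> 0" for s
      using bform_scale[OF B(1), of s 1 "1 / s"] that B(2)[of "1 / s"] a by simp
    have "((\<lambda>s. B (v3 s 1 0 $ 1) (v3 s 1 0 $ 2)) \<longlongrightarrow> B (v3 0 1 0 $ 1) (v3 0 1 0 $ 2)) (at 0)"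
      using B(1) unfolding bform_def
      by (intro polyfun_tendsto[of "\<lambda>v. B (v $ 1) (v $ 2)"] tendsto_cvec3) (auto intro: tendsto_intros)
    hence 1: "((\<lambda>s. B s 1) \<longlongrightarrow> B 0 1) (at 0)" by simp
    have "((\<lambda>s. s ^ d * a) \<longlongrightarrow> 0 ^ d * a) (at 0)" by (intro tendsto_intros)
    hence "((\<lambda>s. B s 1) \<longlongrightarrow> 0 ^ d * a) (at 0)"
      by (rule Lim_transform_eventually) (rule eventually_mono[OF eventually_neq_at_within eq])
    thus ?thesis using LIM_unique[OF 1] d1 by (simp add: zero_power)
  qed
  show False using zero[OF bP p dp] zero[OF bQ q dq] nc[of 0 1] by simp
qed

subsection \<open>Through a general point of the invariant line passes at most one other line\<close>

lemma J2_ne_0_D: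
  assumes "J2 (v3 0 y z) \<noteq> 0" shows "y \<noteq> 0 \<or> z \<noteq> 0"
proof (rule ccontr)
  assume "\<not> ?thesis"
  hence "v3 0 y z = 0" by (simp add: cvec3_eq_iff)
  moreover have "J2 0 = 0" using J2_tform d2 by (intro homog_zero[of "2 * (d - 1)"]) (auto simp: tform_def)
  ultimately show False using assms by simp
qed

text \<open>Let the line \<open>u\<close> through the point \<open>v\<close> of \<open>x = 0\<close> be sent to \<open>w\<close>. On \<open>x = 0\<close> the vector
  \<open>tdiff f v w\<close> depends only on the last two coordinates of \<open>w\<close>, and these are determined up to a
  factor by \<open>dot w (f v) = 0\<close>. So \<open>u\<close> is a multiple of a fixed vector \<open>D0\<close>.\<close>

lemma other_line_unique:
  assumes J: "J2 (v3 0 y z) \<noteq> 0" and F: "F (v3 \<gamma> z (- y)) = 0" "F (v3 \<gamma>' z (- y)) = 0"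
  shows "\<gamma> = \<gamma>'"
proof -
  define v where "v = v3 0 y z"
  have yz: "y \<noteq> 0 \<or> z \<noteq> 0"
    by (rule J2_ne_0_D[OF J])
  define P Q where "P = f v $ 2" and "Q = f v $ 3"
  have PQ: "P \<noteq> 0 \<or> Q \<noteq> 0" "f v $ 1 = 0" using line_image[OF yz] by (simp_all add: P_def Q_def v_def)
  define D0 where "D0 = v3 (Q * gP v $ 1 - P * gQ v $ 1) (N2 v Q (- P)) (N3 v Q (- P))"
  have D0: "D0 \<noteq> 0"
  proof
    assume "D0 = 0"
    hence z: "N2 v Q (- P) = 0" "N3 v Q (- P) = 0" by (simp_all add: D0_def cvec3_eq_iff)
    have "J2 v * (Q * 0 - (- P) * 1) = 0" "J2 v * (Q * 1 - (- P) * 0) = 0"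
      unfolding N_det[of v Q "- P", symmetric] z by simp_all
    thus False using J PQ by (auto simp: v_def)
  qed
  have par: "crs D0 (v3 g z (- y)) = 0" if Fg: "F (v3 g z (- y)) = 0" for g
  proof -
    define u where "u = v3 g z (- y)"
    have u0: "u \<noteq> 0" using yz by (auto simp: u_def cvec3_eq_iff)
    have uv: "dot u v = 0" by (simp add: u_def v_def dot_def)
    obtain w where w: "w \<noteq> 0" "maps f u w" using inv[OF u0] Fg by (auto simp: u_def)
    have w23: "w $ 2 \<noteq> 0 \<or> w $ 3 \<noteq> 0"
    proof (rule ccontr)
      assume "\<not> ?thesis"
      moreover from this have "w $ 1 \<noteq> 0" using w(1) by (auto simp: cvec3_eq_iff)
      ultimately have "(1 / w $ 1) *s w = e1" by (simp add: e1_def cvec3_eq_iff)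
      hence "maps f u e1" using maps_scale[OF w(2), of 1 "1 / w $ 1"] by simp
      hence "crs u e1 = 0" by (rule tot[OF u0])
      thus False using yz by (auto simp: u_def e1_def crs_def cvec3_eq_iff)
    qed
    obtain l where l: "tdiff f v w = l *s u" using tdiff_line[OF f w(2) u0 uv] by blast
    have "dot w (f v) = 0" using w(2) uv by (simp add: maps_def)
    hence wPQ: "w $ 2 * P + w $ 3 * Q = 0" using PQ(2) by (simp add: dot_def P_def Q_def)
    obtain \<mu> where mu: "w $ 2 = \<mu> * Q" "w $ 3 = - (\<mu> * P)"
    proof (cases "Q = 0")
      case True
      thus ?thesis using that[of "- w $ 3 / P"] wPQ PQ by (simp add: field_simps)
    next
      case False
      moreover have "w $ 3 * Q = - (w $ 2 * P)" using wPQ by (simp add: eq_neg_iff_add_eq_0 add.commute)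
      ultimately have "w $ 3 = - (w $ 2 / Q * P)" by (simp add: field_simps)
      moreover have "w $ 2 = w $ 2 / Q * Q" using False by simp
      ultimately show ?thesis using that by blast
    qed
    have "tdiff f v w = \<mu> *s D0"
      unfolding tdiff_eq D0_def mu using d2
      by (simp add: cvec3_eq_iff v_def N2_def N3_def algebra_simps zero_power)
    hence eq: "\<mu> *s D0 = l *s u" using l by simp
    have "\<mu> \<noteq> 0" using w23 mu by auto
    have "\<mu> *s crs D0 u = crs (l *s u) u" unfolding eq[symmetric] by (simp add: crs_lin)
    also have "\<dots> = 0" by (simp add: crs_lin)
    finally show ?thesis using \<open>\<mu> \<noteq> 0\<close> by (simp add: u_def cvec3_eq_iff)
  qed
  obtain a where "v3 \<gamma> z (- y) = a *s D0" using par[OF F(1)] parallel_iff[OF D0] by blast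
  moreover obtain b where "v3 \<gamma>' z (- y) = b *s D0" using par[OF F(2)] parallel_iff[OF D0] by blast
  ultimately have "crs (v3 \<gamma> z (- y)) (v3 \<gamma>' z (- y)) = 0" by (simp add: crs_lin)
  hence "y * \<gamma> = y * \<gamma>'" "z * \<gamma> = z * \<gamma>'" by (auto simp: crs_def cvec3_eq_iff mult.commute)
  thus ?thesis using yz by auto
qed

text \<open>The lines other than \<open>x = 0\<close> through a general point of \<open>x = 0\<close> are the roots of \<open>F\<close> as a
  polynomial \<open>G\<close> of degree \<open>k\<close> in the first variable, and there is only one. Hence \<open>G\<close> satisfies
  \<open>one_root_identity\<close>. If \<open>k \<ge> 2\<close>, then \<open>G\<close> divides the square of its derivative, and being squarefree
  the derivative itself, which has smaller degree.\<close>

lemma k_le_1: "k \<le> 1"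
proof (rule ccontr)
  assume "\<not> k \<le> 1"
  hence k: "k \<ge> 2" by simp
  define W where "W = of_nat k * (G * pderiv (pderiv G)) - of_nat (k - 1) * (pderiv G) ^ 2"
  have pW: "poly (map_poly (spec a b) W) x = 0" if J: "J2 (v3 0 (- b) a) \<noteq> 0" and T: "T a b \<noteq> 0" for a b x
  proof -
    interpret h: comm_ring_hom "spec a b" by (rule spec_hom)
    interpret mh: map_poly_comm_ring_hom "spec a b" ..
    define p where "p = map_poly (spec a b) G"
    have pF: "poly p x = F (v3 x a b)" for x
      unfolding p_def poly_map_spec using fun_cong[OF G, of "v3 x a b"] by simp
    have "coeff p k = T a b" unfolding p_def T_def C_def by (simp add: coeff_map_poly k_def)
    hence "k \<le> degree p" using T by (intro le_degree) simp
    moreover have "degree p \<le> k" unfolding p_def k_def by (rule degree_map_poly_le)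
    ultimately have "degree p = k" by simp
    moreover have "x = y" if "poly p x = 0" "poly p y = 0" for x y
      using other_line_unique[OF J, of x y] that unfolding pF by simp
    moreover have "k \<ge> 1" using k by simp
    ultimately obtain c r where "p = Polynomial.smult c ([:- r, 1:] ^ k)"
      by (metis one_root_poly)
    hence id: "of_nat k * (p * pderiv (pderiv p)) = of_nat (k - 1) * (pderiv p) ^ 2" by (rule one_root_identity)
    have nat: "spec a b (of_nat m) = of_nat m" for m by (induction m) (simp_all add: h.hom_add)
    have pd: "map_poly (spec a b) (pderiv H) = pderiv (map_poly (spec a b) H)" for H
      by (intro poly_eqI) (simp add: coeff_map_poly coeff_pderiv h.hom_mult nat del: of_nat_Suc)
    have natp: "map_poly (spec a b) (of_nat m) = of_nat m" for m by (induction m) (simp_all add: mh.hom_add)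
    have "map_poly (spec a b) W = of_nat k * (p * pderiv (pderiv p)) - of_nat (k - 1) * (pderiv p) ^ 2"
      unfolding W_def p_def by (simp add: mh.hom_minus mh.hom_mult mh.hom_power pd natp)
    thus ?thesis using id by simp
  qed
  have "eval3 W v = 0" for v
  proof (rule polyfun_zero_of_mult[of "eval3 W" "\<lambda>v. J2 (v3 0 (- v $ 3) (v $ 2)) * T (v $ 2) (v $ 3)"])
    have p1: "polyfun (\<lambda>v. J2 (v3 0 (- v $ 3) (v $ 2)))"
      by (rule polyfun_v3) (use J2_tform in \<open>auto simp: tform_def intro: polyfun_uminus\<close>)
    have p2: "polyfun (\<lambda>v. T (v $ 2) (v $ 3))" by (intro bform_polyfun[OF bform_T] polyfun_nth)
    show "polyfun (\<lambda>v. J2 (v3 0 (- v $ 3) (v $ 2)) * T (v $ 2) (v $ 3))" by (rule polyfun_mult[OF p1 p2])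
    obtain y z where yz: "J2 (v3 0 y z) \<noteq> 0" by (rule J2_nonzero)
    hence n1: "\<exists>v :: complex^3. J2 (v3 0 (- v $ 3) (v $ 2)) \<noteq> 0" by (intro exI[of _ "v3 0 z (- y)"]) simp
    obtain a b where ab: "T a b \<noteq> 0" using T_ne_0 by blast
    hence n2: "\<exists>v :: complex^3. T (v $ 2) (v $ 3) \<noteq> 0" by (intro exI[of _ "v3 0 a b"]) simp
    show "\<exists>v :: complex^3. J2 (v3 0 (- v $ 3) (v $ 2)) * T (v $ 2) (v $ 3) \<noteq> 0"
      using polyfun_common_ne_0[OF p1 p2 n1 n2] by auto
    fix v :: "complex^3" assume "J2 (v3 0 (- v $ 3) (v $ 2)) * T (v $ 2) (v $ 3) \<noteq> 0"
    hence "poly (map_poly (spec (v $ 2) (v $ 3)) W) (v $ 1) = 0" by (intro pW) auto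
    thus "eval3 W v = 0" by (simp add: poly_map_spec)
  qed simp
  hence "W = 0" using eval3_eq_0_iff by blast
  hence "of_nat (k - 1) * (pderiv G) ^ 2 = G * (of_nat k * pderiv (pderiv G))" by (simp add: W_def mult_ac)
  moreover have "(of_nat (k - 1) :: poly3) = [:[:[:of_nat (k - 1):]:]:]" by (simp add: of_nat_poly)
  ultimately have "[:[:[:of_nat (k - 1):]:]:] * (pderiv G) ^ 2 = G * (of_nat k * pderiv (pderiv G))" by simp
  hence "G dvd [:[:[:of_nat (k - 1):]:]:] * (pderiv G) ^ 2" by (metis dvd_triv_left)
  moreover have "is_unit ([:[:[:of_nat (k - 1):]:]:] :: poly3)" using k by (simp add: is_unit_const_poly_iff)
  ultimately have "G dvd (pderiv G) ^ 2" by (metis dvd_mult_unit_iff' )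
  hence "G dvd pderiv G" by (rule squarefree_dvd_square[OF squarefree_G])
  moreover have "degree G \<noteq> 0" using k by (simp add: k_def)
  moreover from this have "pderiv G \<noteq> 0" by (simp add: pderiv_eq_0_iff)
  ultimately have "degree G \<le> degree (pderiv G)" by (intro dvd_imp_degree_le)
  thus False using \<open>degree G \<noteq> 0\<close> by (simp add: degree_pderiv)
qed

lemma F_eq: "F (v3 w \<alpha> \<beta>) = (if k = 0 then T \<alpha> \<beta> else C 0 \<alpha> \<beta> + w * T \<alpha> \<beta>)"
proof -
  have "k = 0 \<or> k = 1" using k_le_1 by linarith
  thus ?thesis by (auto simp: F_expand T_def)
qed

subsection \<open>The tangents at the singular point are distinct\<close>

lemma not_divisible_by_square:
  assumes st: "s \<noteq> 0 \<or> t \<noteq> 0" and K: "polyfun (\<lambda>v. K (v $ 1) (v $ 2) (v $ 3))"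
    and eq: "\<And>w \<alpha> \<beta>. F (v3 w \<alpha> \<beta>) = (\<alpha> * t - \<beta> * s) ^ 2 * K w \<alpha> \<beta>"
  shows False
proof -
  have imp: "\<forall>h k. polyfun h \<longrightarrow> polyfun k \<longrightarrow> (\<forall>v. F v = h v ^ 2 * k v) \<longrightarrow> (\<exists>c. \<forall>v. h v = c)"
    using sq by (simp add: sqfree_def)
  have "\<exists>c. \<forall>v :: complex^3. v $ 2 * t - v $ 3 * s = c"
  proof (rule imp[rule_format])
    show "polyfun (\<lambda>v. v $ 2 * t - v $ 3 * s)" by (intro polyfun_intros polyfun_nth polyfun_const)
    show "polyfun (\<lambda>v. K (v $ 1) (v $ 2) (v $ 3))" by (rule K)
    show "F v = (v $ 2 * t - v $ 3 * s) ^ 2 * K (v $ 1) (v $ 2) (v $ 3)" for v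
      using eq[of "v $ 1" "v $ 2" "v $ 3"] by simp
  qed
  then obtain c where c: "\<And>v :: complex^3. v $ 2 * t - v $ 3 * s = c" by blast
  have "c = 0" "t = c" "- s = c" using c[of 0] c[of "v3 0 1 0"] c[of "v3 0 0 1"] by auto
  thus False using st by auto
qed

text \<open>For \<open>k = 0\<close> the form \<open>F\<close> is \<open>T\<close>. For \<open>k = 1\<close> it is \<open>S + w T\<close>. Consider the pull-back identity at
  points \<open>V x = (x, y, z)\<close> with \<open>(0, y, z)\<close> general and \<open>x\<close> tending to 0, for directions
  \<open>(s, t) + x \<sigma> (e, f')\<close> close to the double zero \<open>(s, t)\<close> of \<open>T\<close>. The image \<open>(s', t')\<close> of \<open>(s, t)\<close> is a
  double zero of \<open>T\<close> as well. Since the first component of \<open>f\<close> is divisible by \<open>x\<^sup>3\<close>, it does not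
  contribute to the terms of order 1 and 2: the former show that \<open>(s', t')\<close> is a zero of \<open>S\<close>, the
  latter, for all \<open>\<sigma>\<close>, that it is a double one. So \<open>F\<close> is divisible by a square.\<close>

lemma no_double_tangent:
  assumes st: "s \<noteq> 0 \<or> t \<noteq> 0" and K: "bform (n - k - 2) K"
    and T: "\<And>\<alpha> \<beta>. T \<alpha> \<beta> = (\<alpha> * t - \<beta> * s) ^ 2 * K \<alpha> \<beta>"
  shows False
proof (cases "k = 0")
  case True
  show False
    by (rule not_divisible_by_square[OF st, of "\<lambda>w. K"])
       (use True T bform_polyfun[OF K] in \<open>auto simp: F_eq\<close>)
next
  case False
  hence k1: "k = 1" using k_le_1 by simp
  obtain y z where J: "J2 (v3 0 y z) \<noteq> 0" by (rule J2_nonzero)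
  define v0 where "v0 = v3 0 y z"
  have yz: "y \<noteq> 0 \<or> z \<noteq> 0"
    by (rule J2_ne_0_D[OF J])
  define \<delta> where "\<delta> = J2 v0"
  have d0: "\<delta> \<noteq> 0" using J by (simp add: \<delta>_def v0_def)
  define S where "S = C 0"
  have bS: "bform n S" unfolding S_def using bform_C[of 0] by simp
  define s' t' where "s' = N2 v0 s t" and "t' = N3 v0 s t"
  have st': "s' \<noteq> 0 \<or> t' \<noteq> 0"
  proof (rule ccontr)
    assume "\<not> ?thesis"
    hence "J2 v0 * (s * 0 - t * 1) = 0" "J2 v0 * (s * 1 - t * 0) = 0"
      unfolding N_det[symmetric] s'_def t'_def by auto
    thus False using d0 st by (auto simp: \<delta>_def)
  qed
  \<comment> \<open>the direction \<open>(s', t')\<close> is again a double zero of \<open>T\<close>\<close>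
  obtain \<alpha>0 \<beta>0 where T0: "T \<alpha>0 \<beta>0 \<noteq> 0" using T_ne_0 by blast
  define q where "q = T (N2 v0 \<alpha>0 \<beta>0) (N3 v0 \<alpha>0 \<beta>0) / (T \<alpha>0 \<beta>0 * \<delta> ^ (n - k))"
  define K' where "K' a b = q * K (a * gQ v0 $ 3 + b * (- gQ v0 $ 2)) (a * (- gP v0 $ 3) + b * gP v0 $ 2)" for a b
  have bK': "bform (n - k - 2) K'" unfolding K'_def[abs_def] by (intro bform_cmult bform_subst K)
  have T': "T a b = (a * t' - b * s') ^ 2 * K' a b" for a b
  proof -
    define \<alpha> \<beta> where "\<alpha> = a * gQ v0 $ 3 + b * (- gQ v0 $ 2)" and "\<beta> = a * (- gP v0 $ 3) + b * gP v0 $ 2"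
    have N: "N2 v0 \<alpha> \<beta> = \<delta> * a" "N3 v0 \<alpha> \<beta> = \<delta> * b"
      by (simp_all add: N2_def N3_def \<alpha>_def \<beta>_def \<delta>_def J2_def algebra_simps)
    have br: "\<alpha> * t - \<beta> * s = a * t' - b * s'"
      by (simp add: \<alpha>_def \<beta>_def s'_def t'_def N2_def N3_def algebra_simps)
    have "T (\<delta> * a) (\<delta> * b) * T \<alpha>0 \<beta>0 = T (N2 v0 \<alpha>0 \<beta>0) (N3 v0 \<alpha>0 \<beta>0) * T \<alpha> \<beta>"
      using T_identity[OF yz v0_def, of \<alpha> \<beta> \<alpha>0 \<beta>0] by (simp only: N)
    hence "\<delta> ^ (n - k) * T a b * T \<alpha>0 \<beta>0 = T (N2 v0 \<alpha>0 \<beta>0) (N3 v0 \<alpha>0 \<beta>0) * ((a * t' - b * s') ^ 2 * K \<alpha> \<beta>)"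
      unfolding bform_scale[OF bform_T] T[of \<alpha> \<beta>] br .
    thus ?thesis using T0 d0 unfolding K'_def \<alpha>_def[symmetric] \<beta>_def[symmetric] q_def
      by (simp add: field_simps)
  qed
  obtain e f' where e: "e * t - f' * s = 1"
  proof (cases "t = 0")
    case True
    thus ?thesis using that[of 0 "- 1 / s"] st by simp
  next
    case False
    thus ?thesis using that[of "1 / t" 0] by simp
  qed
  define V where "V x = v3 x y z" for x
  have V0: "V 0 = v0" by (simp add: V_def v0_def)
  have LV: "(V \<longlongrightarrow> v0) (at 0)" unfolding V0[symmetric] unfolding V_def[abs_def]
    by (rule tendsto_cvec3) (auto intro: tendsto_intros)
  define M2 where "M2 x \<sigma> = N2 (V x) (s + x * \<sigma> * e) (t + x * \<sigma> * f')" for x \<sigma>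
  define M3 where "M3 x \<sigma> = N3 (V x) (s + x * \<sigma> * e) (t + x * \<sigma> * f')" for x \<sigma>
  have lin: "((\<lambda>x. s + x * \<sigma> * e) \<longlongrightarrow> s) (at 0)" "((\<lambda>x. t + x * \<sigma> * f') \<longlongrightarrow> t) (at 0)" for \<sigma>
    by (rule tendsto_eq_intros refl | simp)+
  have LN: "((\<lambda>x. N2 (V x) (a x) (b x)) \<longlongrightarrow> N2 v0 a0 b0) (at 0)" "((\<lambda>x. N3 (V x) (a x) (b x)) \<longlongrightarrow> N3 v0 a0 b0) (at 0)"
    if "(a \<longlongrightarrow> a0) (at 0)" "(b \<longlongrightarrow> b0) (at 0)" for a b a0 b0
    unfolding N2_def N3_def
    by (intro tendsto_intros that polyfun_tendsto[OF polyfun_gP LV] polyfun_tendsto[OF polyfun_gQ LV])+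
  have LM: "((\<lambda>x. M2 x \<sigma>) \<longlongrightarrow> s') (at 0)" "((\<lambda>x. M3 x \<sigma>) \<longlongrightarrow> t') (at 0)" for \<sigma>
    unfolding M2_def M3_def s'_def t'_def by (intro LN lin)+
  have Lb: "((\<lambda>x. B (a x) (b x)) \<longlongrightarrow> B a0 b0) (at 0)"
    if "bform j B" "(a \<longlongrightarrow> a0) (at 0)" "(b \<longlongrightarrow> b0) (at 0)" for a b a0 b0 j B
  proof -
    have "((\<lambda>x. B (v3 (a x) (b x) 0 $ 1) (v3 (a x) (b x) 0 $ 2)) \<longlongrightarrow> B (v3 a0 b0 0 $ 1) (v3 a0 b0 0 $ 2)) (at 0)"
      using that unfolding bform_def
      by (intro polyfun_tendsto[of "\<lambda>v. B (v $ 1) (v $ 2)"] tendsto_cvec3) auto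
    thus ?thesis by simp
  qed
  have LP: "((\<lambda>x. f (V x) $ i) \<longlongrightarrow> f v0 $ i) (at 0)" for i
    by (rule polyfun_tendsto[OF pmap_polyfun[OF f] LV])
  \<comment> \<open>the image of the double direction moves by a multiple of \<open>x\<close>\<close>
  obtain p where p: "\<And>x. N2 (V x) s t * t' - N3 (V x) s t * s' = poly p x"
  proof -
    have pol: "polyfun (\<lambda>v. N2 v s t * t' - N3 v s t * s')"
      by (intro polyfun_diff polyfun_mult polyfun_N polyfun_const)
    have "\<exists>p. \<forall>x. V x $ i = poly p x" for i
      using exhaust_3[of i] by (auto simp: V_def intro: exI[of _ "[:0, 1:]"] exI[of _ "[:y:]"] exI[of _ "[:z:]"])
    from polyfun_curve[OF pol this] show ?thesis using that by blast
  qed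
  have "poly p 0 = 0" unfolding p[symmetric] V0 by (simp add: s'_def t'_def)
  then obtain r where r: "p = [:- 0, 1:] * r" by (auto simp: poly_eq_0_iff_dvd elim: dvdE)
  define \<rho> where "\<rho> x \<sigma> = poly r x + \<sigma> * (N2 (V x) e f' * t' - N3 (V x) e f' * s')" for x \<sigma>
  have br: "M2 x \<sigma> * t' - M3 x \<sigma> * s' = x * \<rho> x \<sigma>" for x \<sigma>
  proof -
    have "M2 x \<sigma> * t' - M3 x \<sigma> * s' = (N2 (V x) s t * t' - N3 (V x) s t * s') +
        x * \<sigma> * (N2 (V x) e f' * t' - N3 (V x) e f' * s')"
      by (simp add: M2_def M3_def N2_def N3_def algebra_simps)
    also have "N2 (V x) s t * t' - N3 (V x) s t * s' = x * poly r x" unfolding p r by simp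
    finally show ?thesis by (simp add: \<rho>_def algebra_simps)
  qed
  have "N2 v0 e f' * t' - N3 v0 e f' * s' = \<delta>" 
    unfolding s'_def t'_def N_det \<delta>_def using e by simp
  hence L\<rho>: "((\<lambda>x. \<rho> x \<sigma>) \<longlongrightarrow> poly r 0 + \<sigma> * \<delta>) (at 0)" for \<sigma>
    unfolding \<rho>_def using LN[OF tendsto_const tendsto_const, of e f']
    by (intro tendsto_add tendsto_mult tendsto_const isCont_tendsto_compose[of _ "poly r"] tendsto_ident_at)
       (auto intro!: tendsto_eq_intros)
  have Exp: "E x y z \<alpha> \<beta> = x * S \<alpha> \<beta> - (\<alpha> * y + \<beta> * z) * T \<alpha> \<beta>" for x y z \<alpha> \<beta>
    using k1 by (simp add: E_def S_def T_def algebra_simps)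
  define g where "g x i = f (V x) $ i" for x i
  have g1: "g x 1 = c0 * x ^ d" for x by (simp add: g_def c0 V_def)
  obtain a0 b0 where ab0: "a0 * f v0 $ 2 + b0 * f v0 $ 3 \<noteq> 0" "T a0 b0 \<noteq> 0"
  proof -
    have p1: "polyfun (\<lambda>v. v $ 1 * f v0 $ 2 + v $ 2 * f v0 $ 3)" by (intro polyfun_intros polyfun_nth polyfun_const)
    have p2: "polyfun (\<lambda>v. T (v $ 1) (v $ 2))" by (intro bform_polyfun[OF bform_T] polyfun_nth)
    have n1: "\<exists>v :: complex^3. v $ 1 * f v0 $ 2 + v $ 2 * f v0 $ 3 \<noteq> 0"
      using line_image(2)[OF yz] unfolding v0_def
      by (cases "f (v3 0 y z) $ 2 = 0") (auto intro: exI[of _ "v3 0 1 0"] exI[of _ "v3 1 0 0"])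
    have n2: "\<exists>v :: complex^3. T (v $ 1) (v $ 2) \<noteq> 0" using T0 by (intro exI[of _ "v3 \<alpha>0 \<beta>0 0"]) simp
    obtain v :: "complex^3" where "v $ 1 * f v0 $ 2 + v $ 2 * f v0 $ 3 \<noteq> 0 \<and> T (v $ 1) (v $ 2) \<noteq> 0"
      using polyfun_common_ne_0[OF p1 p2 n1 n2] by blast
    thus ?thesis using that[of "v $ 1" "v $ 2"] by blast
  qed
  define A where "A x = E (g x 1) (g x 2) (g x 3) a0 b0" for x
  define B where "B x = E x y z (N2 (V x) a0 b0) (N3 (V x) a0 b0)" for x
  define A0 where "A0 = - ((a0 * f v0 $ 2 + b0 * f v0 $ 3) * T a0 b0)"
  define B0 where "B0 = - ((N2 v0 a0 b0 * y + N3 v0 a0 b0 * z) * T (N2 v0 a0 b0) (N3 v0 a0 b0))"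
  have LA: "(A \<longlongrightarrow> A0) (at 0)"
  proof -
    have "(A \<longlongrightarrow> f v0 $ 1 * S a0 b0 - (a0 * f v0 $ 2 + b0 * f v0 $ 3) * T a0 b0) (at 0)"
      unfolding A_def[abs_def] Exp g_def by (intro tendsto_intros LP)
    moreover have "f v0 $ 1 = 0" using line_image(1)[OF yz] by (simp add: v0_def)
    ultimately show ?thesis by (simp add: A0_def)
  qed
  have LB: "(B \<longlongrightarrow> B0) (at 0)"
  proof -
    have "(B \<longlongrightarrow> 0 * S (N2 v0 a0 b0) (N3 v0 a0 b0) - (N2 v0 a0 b0 * y + N3 v0 a0 b0 * z) * T (N2 v0 a0 b0) (N3 v0 a0 b0)) (at 0)"
      unfolding B_def[abs_def] Exp by (intro tendsto_intros LN Lb[OF bS] Lb[OF bform_T])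
    thus ?thesis by (simp add: B0_def)
  qed
  have A0: "A0 \<noteq> 0" using ab0 by (simp add: A0_def)
  have id: "(x * S (M2 x \<sigma>) (M3 x \<sigma>) - (M2 x \<sigma> * y + M3 x \<sigma> * z) * (x * \<rho> x \<sigma>) ^ 2 * K' (M2 x \<sigma>) (M3 x \<sigma>)) * A x =
     B x * (c0 * x ^ d * S (s + x * \<sigma> * e) (t + x * \<sigma> * f') -
       ((s + x * \<sigma> * e) * g x 2 + (t + x * \<sigma> * f') * g x 3) * (x * \<sigma>) ^ 2 * K (s + x * \<sigma> * e) (t + x * \<sigma> * f'))" for x \<sigma>
  proof -
    have b1: "(s + x * \<sigma> * e) * t - (t + x * \<sigma> * f') * s = x * \<sigma>"
    proof -
      have "(s + x * \<sigma> * e) * t - (t + x * \<sigma> * f') * s = x * \<sigma> * (e * t - f' * s)" by (simp add: algebra_simps)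
      thus ?thesis by (simp add: e)
    qed
    have "E x y z (M2 x \<sigma>) (M3 x \<sigma>) * A x = B x * E (g x 1) (g x 2) (g x 3) (s + x * \<sigma> * e) (t + x * \<sigma> * f')"
      using E_identity[of "V x" "s + x * \<sigma> * e" "t + x * \<sigma> * f'" a0 b0]
      by (simp add: A_def B_def M2_def M3_def g_def V_def)
    thus ?thesis unfolding Exp T'[of "M2 x \<sigma>"] br T[of "s + x * \<sigma> * e"] b1 g1 by (simp add: mult.assoc)
  qed
  have dpow: "x ^ d = x * (x * (x * x ^ (d - 3)))" for x :: complex
  proof -
    have "x ^ d = x ^ 3 * x ^ (d - 3)" using d3 by (simp flip: power_add)
    thus ?thesis by (simp add: power3_eq_cube mult.assoc)
  qed
  \<comment> \<open>the identity divided by \<open>x\<close>, at \<open>\<sigma> = 0\<close> and in the limit \<open>x \<rightarrow> 0\<close>\<close>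
  have S0: "S s' t' = 0"
  proof -
    define L where "L x = (S (M2 x 0) (M3 x 0) - (M2 x 0 * y + M3 x 0 * z) * (x * \<rho> x 0 ^ 2) * K' (M2 x 0) (M3 x 0)) * A x" for x
    define R where "R x = B x * (c0 * (x * (x * x ^ (d - 3))) * S (s + x * 0 * e) (t + x * 0 * f'))" for x
    have eq: "L x = R x" if "x \<noteq> 0" for x
    proof -
      have "x * L x = x * R x" using id[of x 0] unfolding L_def R_def dpow[of x]
        by (simp add: algebra_simps power2_eq_square)
      thus ?thesis using that by simp
    qed
    have LL: "(L \<longlongrightarrow> (S s' t' - (s' * y + t' * z) * (0 * (poly r 0 + 0 * \<delta>) ^ 2) * K' s' t') * A0) (at 0)"
      unfolding L_def[abs_def] by (intro tendsto_intros LM L\<rho> LA Lb[OF bS] Lb[OF bK'])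
    have LR: "(R \<longlongrightarrow> B0 * (c0 * (0 * (0 * 0 ^ (d - 3))) * S s t)) (at 0)"
      unfolding R_def[abs_def] by (intro tendsto_intros LB Lb[OF bS] lin)
    have "(S s' t' - (s' * y + t' * z) * (0 * (poly r 0 + 0 * \<delta>) ^ 2) * K' s' t') * A0 =
        B0 * (c0 * (0 * (0 * 0 ^ (d - 3))) * S s t)"
      by (rule LIM_unique[OF Lim_transform_eventually[OF LL eventually_mono[OF eventually_neq_at_within eq]] LR])
    thus ?thesis using A0 by simp
  qed
  obtain m where m: "n = Suc (Suc m)" using n2 by (metis Suc_1 Suc_le_D le_Suc_eq not_less_eq_eq numeral_2_eq_2)
  obtain S1 where S1: "bform (Suc m) S1" "\<And>a b. S a b = (a * t' - b * s') * S1 a b"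
    using bform_div[of "Suc m" S s' t'] bS m S0 st' by metis
  define \<eta> where "\<eta> = poly r 0"
  define \<theta> where "\<theta> = (s' * y + t' * z) * K' s' t'"
  define \<kappa> where "\<kappa> = B0 * ((s * f v0 $ 2 + t * f v0 $ 3) * K s t)"
  \<comment> \<open>since \<open>(s', t')\<close> is a zero of \<open>S\<close>, the identity can be divided by \<open>x\<^sup>2\<close> before \<open>x\<close> tends to 0\<close>
  have second: "((\<eta> + \<sigma> * \<delta>) * S1 s' t' - (\<eta> + \<sigma> * \<delta>) ^ 2 * \<theta>) * A0 = - (\<kappa> * \<sigma> ^ 2)" for \<sigma>
  proof -
    define L where "L x = (\<rho> x \<sigma> * S1 (M2 x \<sigma>) (M3 x \<sigma>) - (M2 x \<sigma> * y + M3 x \<sigma> * z) * \<rho> x \<sigma> ^ 2 * K' (M2 x \<sigma>) (M3 x \<sigma>)) * A x" for x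
    define R where "R x = B x * (c0 * (x * x ^ (d - 3)) * S (s + x * \<sigma> * e) (t + x * \<sigma> * f') -
       ((s + x * \<sigma> * e) * g x 2 + (t + x * \<sigma> * f') * g x 3) * \<sigma> ^ 2 * K (s + x * \<sigma> * e) (t + x * \<sigma> * f'))" for x
    have eq: "L x = R x" if "x \<noteq> 0" for x
    proof -
      have "x * (x * L x) = x * (x * R x)" using id[of x \<sigma>] unfolding L_def R_def dpow[of x] S1(2)[of "M2 x \<sigma>"] br
        by (simp add: algebra_simps power2_eq_square)
      thus ?thesis using that by simp
    qed
    have LL: "(L \<longlongrightarrow> ((poly r 0 + \<sigma> * \<delta>) * S1 s' t' - (s' * y + t' * z) * (poly r 0 + \<sigma> * \<delta>) ^ 2 * K' s' t') * A0) (at 0)"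
      unfolding L_def[abs_def] by (intro tendsto_intros LM L\<rho> LA Lb[OF S1(1)] Lb[OF bK'])
    have LR: "(R \<longlongrightarrow> B0 * (c0 * (0 * 0 ^ (d - 3)) * S s t - (s * f v0 $ 2 + t * f v0 $ 3) * \<sigma> ^ 2 * K s t)) (at 0)"
      unfolding R_def[abs_def] g_def by (intro tendsto_intros LB Lb[OF bS] Lb[OF K] lin LP)
    have "((poly r 0 + \<sigma> * \<delta>) * S1 s' t' - (s' * y + t' * z) * (poly r 0 + \<sigma> * \<delta>) ^ 2 * K' s' t') * A0 =
        B0 * (c0 * (0 * 0 ^ (d - 3)) * S s t - (s * f v0 $ 2 + t * f v0 $ 3) * \<sigma> ^ 2 * K s t)"
      by (rule LIM_unique[OF Lim_transform_eventually[OF LL eventually_mono[OF eventually_neq_at_within eq]] LR])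
    thus ?thesis by (simp add: \<eta>_def \<theta>_def \<kappa>_def algebra_simps)
  qed
  have "S1 s' t' = 0"
  proof -
    \<comment> \<open>right hand side is even in \<open>\<rho>\<close>, because \<open>\<rho> = 0\<close> shows that \<open>\<kappa>\<close> or \<open>\<eta>\<close> vanishes\<close>
    have s1: "(\<rho> * S1 s' t' - \<rho> ^ 2 * \<theta>) * A0 = - (\<kappa> * ((\<rho> - \<eta>) / \<delta>) ^ 2)" for \<rho>
      using second[of "(\<rho> - \<eta>) / \<delta>"] d0 by simp
    have k\<eta>: "\<kappa> = 0 \<or> \<eta> = 0" using s1[of 0] d0 by simp
    have "\<kappa> * ((1 - \<eta>) / \<delta>) ^ 2 = \<kappa> * ((- 1 - \<eta>) / \<delta>) ^ 2" using k\<eta> by (auto simp: power_divide)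
    hence "(1 * S1 s' t' - 1 ^ 2 * \<theta>) * A0 = ((- 1) * S1 s' t' - (- 1) ^ 2 * \<theta>) * A0"
      using s1[of 1] s1[of "- 1"] by metis
    thus ?thesis using A0 by simp
  qed
  then obtain S2 where S2: "bform m S2" "\<And>a b. S1 a b = (a * t' - b * s') * S2 a b"
    using bform_div[OF S1(1) _ st'] by metis
  show False
  proof (rule not_divisible_by_square[OF st', of "\<lambda>w a b. S2 a b + w * K' a b"])
    show "polyfun (\<lambda>v. S2 (v $ 2) (v $ 3) + v $ 1 * K' (v $ 2) (v $ 3))"
      by (intro polyfun_add polyfun_mult polyfun_nth bform_polyfun[OF S2(1)] bform_polyfun[OF bK'])
    show "F (v3 w \<alpha> \<beta>) = (\<alpha> * t' - \<beta> * s') ^ 2 * (S2 \<alpha> \<beta> + w * K' \<alpha> \<beta>)" for w \<alpha> \<beta>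
    proof -
      have 1: "F (v3 w \<alpha> \<beta>) = S \<alpha> \<beta> + w * T \<alpha> \<beta>" using k1 by (simp add: F_eq S_def)
      show ?thesis unfolding 1 S1(2)[of \<alpha> \<beta>] S2(2)[of \<alpha> \<beta>] T'[of \<alpha> \<beta>]
        by (simp add: algebra_simps power2_eq_square)
    qed
  qed
qed

subsection \<open>There are exactly two tangents\<close>

text \<open>The zeros of \<open>T\<close> are distinct by \<open>no_double_tangent\<close>. Suppose there are \<open>m \<ge> 3\<close>. By \<open>T_identity\<close>
  the map \<open>(N2, N3)\<close> sends the \<open>i\<close>-th zero to a multiple \<open>\<mu> i\<close> of another one, with an index that does
  not depend on the point; different zeros have different indices, because the determinant \<open>J2\<close> is
  not identically zero. At a point where \<open>J2\<close> vanishes, at most one \<open>\<mu> i\<close> is nonzero, so \<open>(N2, N3)\<close>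
  vanishes in two independent directions. By Euler's formula \<open>f\<close> vanishes at that point.\<close>

lemma two_tangents:
  obtains \<kappa> s t s' t' where "n - k = 2" "\<kappa> \<noteq> 0" "s * t' \<noteq> t * s'"
    "\<And>a b. T a b = \<kappa> * (a * t - b * s) * (a * t' - b * s')"
proof -
  define m where "m = n - k"
  have m2: "m \<ge> 2" using multiplicity_ge_2 by (simp add: m_def)
  obtain \<kappa> s t where st': "\<And>j. s j \<noteq> 0 \<or> t j \<noteq> (0::complex)"
    "\<And>a b. T a b = \<kappa> * (\<Prod>j<n - k. a * t j - b * s j)" by (rule bform_factor[OF bform_T], rule that)
  note st = st'[folded m_def]
  have k0: "\<kappa> \<noteq> 0" using T_ne_0 st(2) by auto
  have dist: "s i * t j \<noteq> t i * s j" if ij: "i < m" "j < m" "i \<noteq> j" for i j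
  proof
    assume eq: "s i * t j = t i * s j"
    obtain c where c: "s j = c * s i" "t j = c * t i"
    proof (cases "s i = 0")
      case True
      hence "t i \<noteq> 0" using st(1)[of i] by simp
      moreover have "s j = 0" using eq True \<open>t i \<noteq> 0\<close> by simp
      ultimately show ?thesis using that[of "t j / t i"] True by simp
    next
      case False
      have "t j = s j / s i * t i" using eq False by (simp add: field_simps)
      thus ?thesis using that[of "s j / s i"] False by simp
    qed
    define K where "K a b = c * \<kappa> * (\<Prod>l\<in>{..<m}-{i,j}. a * t l - b * s l)" for a b
    have card: "card ({..<m} - {i, j}) = n - k - 2" using ij by (subst card_Diff_subset) (auto simp: m_def)
    have bK: "bform (n - k - 2) K" unfolding K_def[abs_def] card[symmetric]
      by (intro bform_cmult bform_prod) simp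
    have "T a b = (a * t i - b * s i) ^ 2 * K a b" for a b
    proof -
      have "(\<Prod>j<m. a * t j - b * s j) = (a * t i - b * s i) * ((a * t j - b * s j) * (\<Prod>l\<in>{..<m}-{i}-{j}. a * t l - b * s l))"
        using ij by (subst prod.remove[of "{..<m}" i], simp, simp, subst prod.remove[of "{..<m}-{i}" j]) auto
      moreover have "{..<m}-{i}-{j} = {..<m}-{i,j}" by auto
      moreover have "a * t j - b * s j = c * (a * t i - b * s i)" by (simp add: c algebra_simps)
      ultimately show ?thesis by (simp add: st(2) K_def power2_eq_square mult_ac)
    qed
    thus False by (rule no_double_tangent[OF st(1) bK])
  qed
  have "m = 2"
  proof (rule ccontr)
    assume "m \<noteq> 2"
    hence m3: "m \<ge> 3" using m2 by simp
    have N0: "N2 0 a b = 0" "N3 0 a b = 0" for a b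
    proof -
      have h: "homog (d - 1) (\<lambda>v. gP v $ i)" "homog (d - 1) (\<lambda>v. gQ v $ i)" for i
        using tform_gP tform_gQ by (auto simp: tform_def)
      have "gP 0 $ i = 0" "gQ 0 $ i = 0" for i using homog_zero[OF h(1)] homog_zero[OF h(2)] d2 by auto
      thus "N2 0 a b = 0" "N3 0 a b = 0" by (simp_all add: N2_def N3_def)
    qed
    obtain \<alpha>0 \<beta>0 where T0: "T \<alpha>0 \<beta>0 \<noteq> 0" using T_ne_0 by blast
    have Tz: "T (s i) (t i) = 0" if "i < m" for i
      unfolding st(2) using that by (auto simp: mult.commute intro!: prod_zero bexI[of _ i])
    have root: "\<exists>j<m. \<forall>y z. N2 (v3 0 y z) (s i) (t i) * t j - N3 (v3 0 y z) (s i) (t i) * s j = 0" if i: "i < m" for i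
    proof (rule ccontr)
      assume no: "\<not> ?thesis"
      define h where "h j v = N2 (v3 0 (v $ 2) (v $ 3)) (s i) (t i) * t j - N3 (v3 0 (v $ 2) (v $ 3)) (s i) (t i) * s j" for j and v :: "complex^3"
      have "\<exists>v. \<forall>j\<in>{..<m}. h j v \<noteq> 0"
      proof (rule polyfun_prod_ne_0)
        have "polyfun (\<lambda>v. N2 v (s i) (t i))" "polyfun (\<lambda>v. N3 v (s i) (t i))" by (intro polyfun_N polyfun_const)+
        from polyfun_v3[OF this(1) polyfun_const polyfun_nth polyfun_nth] polyfun_v3[OF this(2) polyfun_const polyfun_nth polyfun_nth]
        show "polyfun (h j)" for j
          unfolding h_def[abs_def] by (intro polyfun_diff polyfun_mult polyfun_const)
        show "\<exists>v. h j v \<noteq> 0" if j: "j \<in> {..<m}" for j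
        proof -
          obtain y z where "N2 (v3 0 y z) (s i) (t i) * t j - N3 (v3 0 y z) (s i) (t i) * s j \<noteq> 0"
            using no j by blast
          thus ?thesis by (intro exI[of _ "v3 0 y z"]) (simp add: h_def)
        qed
      qed simp
      then obtain v where v: "\<And>j. j < m \<Longrightarrow> h j v \<noteq> 0" by auto
      define y z where "y = v $ 2" and "z = v $ 3"
      have "y \<noteq> 0 \<or> z \<noteq> 0"
      proof (rule ccontr)
        assume "\<not> ?thesis"
        hence "v3 0 y z = 0" by (simp add: cvec3_eq_iff)
        hence "h 0 v = 0" by (simp add: h_def y_def z_def N0)
        thus False using v[of 0] m2 by simp
      qed
      from T_identity[OF this refl, of "s i" "t i" \<alpha>0 \<beta>0]
      have "T (N2 (v3 0 y z) (s i) (t i)) (N3 (v3 0 y z) (s i) (t i)) = 0" using Tz[OF i] T0 by simp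
      hence "(\<Prod>j<m. h j v) = 0" using k0 unfolding st(2) h_def y_def z_def by simp
      thus False using v by (auto simp: prod_zero_iff)
    qed
    then obtain \<sigma> where \<sigma>: "\<And>i. i < m \<Longrightarrow> \<sigma> i < m" "\<And>i y z. i < m \<Longrightarrow>
       N2 (v3 0 y z) (s i) (t i) * t (\<sigma> i) - N3 (v3 0 y z) (s i) (t i) * s (\<sigma> i) = 0" by metis
    \<comment> \<open>the image of each root is a multiple of the root chosen for it\<close>
    have mult: "\<exists>\<mu>. N2 (v3 0 y z) (s i) (t i) = \<mu> * s (\<sigma> i) \<and> N3 (v3 0 y z) (s i) (t i) = \<mu> * t (\<sigma> i)" if i: "i < m" for i y z
    proof (cases "s (\<sigma> i) = 0")
      case True
      thus ?thesis using \<sigma>(2)[OF i, of y z] st(1)[of "\<sigma> i"]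
        by (intro exI[of _ "N3 (v3 0 y z) (s i) (t i) / t (\<sigma> i)"]) auto
    next
      case False
      thus ?thesis using \<sigma>(2)[OF i, of y z]
        by (intro exI[of _ "N2 (v3 0 y z) (s i) (t i) / s (\<sigma> i)"]) (simp add: field_simps)
    qed
    have inj: "\<sigma> i \<noteq> \<sigma> j" if ij: "i < m" "j < m" "i \<noteq> j" for i j
    proof
      assume eq: "\<sigma> i = \<sigma> j"
      obtain y z where J: "J2 (v3 0 y z) \<noteq> 0" by (rule J2_nonzero)
      obtain \<mu> \<nu> where "N2 (v3 0 y z) (s i) (t i) = \<mu> * s (\<sigma> i)" "N3 (v3 0 y z) (s i) (t i) = \<mu> * t (\<sigma> i)"
        "N2 (v3 0 y z) (s j) (t j) = \<nu> * s (\<sigma> j)" "N3 (v3 0 y z) (s j) (t j) = \<nu> * t (\<sigma> j)"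
        using mult[OF ij(1), of y z] mult[OF ij(2), of y z] by blast
      hence "J2 (v3 0 y z) * (s i * t j - t i * s j) = 0"
        unfolding N_det[of _ "s i" "t i" "s j" "t j", symmetric] by (simp add: eq)
      thus False using J dist[OF ij] by simp
    qed
    obtain y z where yz: "y \<noteq> 0 \<or> z \<noteq> 0" "J2 (v3 0 y z) = 0" by (rule J2_zero)
    define v where "v = v3 0 y z"
    obtain \<mu> where \<mu>: "\<And>i. i < m \<Longrightarrow> N2 v (s i) (t i) = \<mu> i * s (\<sigma> i) \<and> N3 v (s i) (t i) = \<mu> i * t (\<sigma> i)"
      using mult[of _ y z] unfolding v_def by metis
    have mm: "\<mu> i * \<mu> j = 0" if ij: "i < m" "j < m" "i \<noteq> j" for i j
    proof -
      have "N2 v (s i) (t i) * N3 v (s j) (t j) - N3 v (s i) (t i) * N2 v (s j) (t j) = 0"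
        unfolding N_det using yz(2) by (simp add: v_def)
      moreover have "N2 v (s i) (t i) * N3 v (s j) (t j) - N3 v (s i) (t i) * N2 v (s j) (t j) =
         (\<mu> i * \<mu> j) * (s (\<sigma> i) * t (\<sigma> j) - t (\<sigma> i) * s (\<sigma> j))"
        using \<mu>[OF ij(1)] \<mu>[OF ij(2)] by (simp add: algebra_simps)
      ultimately show ?thesis using dist[OF \<sigma>(1)[OF ij(1)] \<sigma>(1)[OF ij(2)] inj[OF ij]] by simp
    qed
    obtain i j where ij: "i < m" "j < m" "i \<noteq> j" "\<mu> i = 0" "\<mu> j = 0"
    proof -
      have "\<mu> 0 * \<mu> 1 = 0" "\<mu> 0 * \<mu> 2 = 0" "\<mu> 1 * \<mu> 2 = 0" using mm m3 by auto
      hence "(\<mu> 0 = 0 \<and> \<mu> 1 = 0) \<or> (\<mu> 0 = 0 \<and> \<mu> 2 = 0) \<or> (\<mu> 1 = 0 \<and> \<mu> 2 = 0)" by auto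
      moreover have "0 < m" "1 < m" "2 < m" using m3 by auto
      ultimately show ?thesis using that[of 0 1] that[of 0 2] that[of 1 2] by auto
    qed
    have z: "N2 v (s i) (t i) = 0" "N3 v (s i) (t i) = 0" "N2 v (s j) (t j) = 0" "N3 v (s j) (t j) = 0"
      using \<mu>[OF ij(1)] \<mu>[OF ij(2)] ij by auto
    have vanish: "x = 0 \<and> x' = 0" if "s i * x + t i * x' = 0" "s j * x + t j * x' = 0" for x x'
    proof -
      have "(s i * t j - t i * s j) * x = t j * (s i * x + t i * x') - t i * (s j * x + t j * x')"
        "(s i * t j - t i * s j) * x' = s i * (s j * x + t j * x') - s j * (s i * x + t i * x')"
        by (simp_all add: algebra_simps)
      hence "(s i * t j - t i * s j) * x = 0" "(s i * t j - t i * s j) * x' = 0"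
        unfolding that by simp_all
      thus ?thesis using dist[OF ij(1-3)] by simp
    qed
    have "gP v $ 2 = 0 \<and> gQ v $ 2 = 0" "gP v $ 3 = 0 \<and> gQ v $ 3 = 0"
      using z vanish unfolding N2_def N3_def by blast+
    hence "of_nat d * f v $ 2 = 0" "of_nat d * f v $ 3 = 0"
      unfolding eulerP[symmetric] eulerQ[symmetric] by (simp_all add: v_def)
    thus False using line_image(2)[OF yz(1)] d1 by (simp add: v_def)
  qed
  hence "(\<Prod>j<m. a * t j - b * s j) = (a * t 0 - b * s 0) * (a * t 1 - b * s 1)" for a b
    by (simp add: numeral_2_eq_2)
  hence "T a b = \<kappa> * (a * t 0 - b * s 0) * (a * t 1 - b * s 1)" for a b
    by (simp add: st(2) mult.assoc)
  moreover have "s 0 * t 1 \<noteq> t 0 * s 1" using dist[of 0 1] \<open>m = 2\<close> by simp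
  ultimately show ?thesis using that[of \<kappa> "s 0" "t 1" "t 0" "s 1"] k0 \<open>m = 2\<close> by (simp add: m_def)
qed

end

definition indep :: "complex^3 \<Rightarrow> complex^3 \<Rightarrow> complex^3 \<Rightarrow> bool" where
  "indep a b c \<longleftrightarrow> (\<forall>u. dot a u = 0 \<longrightarrow> dot b u = 0 \<longrightarrow> dot c u = 0 \<longrightarrow> u = 0)"

definition normal_form :: "nat \<Rightarrow> (complex^3 \<Rightarrow> complex) \<Rightarrow> bool" where
  "normal_form n F \<longleftrightarrow>
    (\<exists>a b c \<kappa>. n = 2 \<and> indep a b c \<and> \<kappa> \<noteq> 0 \<and> (\<forall>u. F u = \<kappa> * dot a u * dot b u)) \<or>
    (\<exists>a b c p q. n = 3 \<and> indep a b c \<and>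
       (\<forall>u. F u = dot a u * dot b u * dot c u + p * dot a u ^ 3 + q * dot b u ^ 3))"

lemma indepI_det: assumes "dot a (crs b c) \<noteq> 0" shows "indep a b c"
  unfolding indep_def
proof (intro allI impI)
  fix u assume u: "dot a u = 0" "dot b u = 0" "dot c u = 0"
  have "crs b c \<noteq> 0" using assms by (auto simp: dot_lin)
  then obtain k where k: "u = k *s crs b c" using orth_crs[of u b c] u by (auto simp: dot_commute)
  hence "k = 0" using u(1) assms by (simp add: dot_lin)
  thus "u = 0" using k by simp
qed

lemma indep_det: assumes "indep a b c" shows "dot a (crs b c) \<noteq> 0"
proof
  assume z: "dot a (crs b c) = 0"
  have kill: "u = 0" if "dot a u = 0" "dot b u = 0" "dot c u = 0" for u using assms that by (auto simp: indep_def)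
  have z': "dot c (crs a b) = 0" "dot b (crs a c) = 0" using z by (simp_all add: dot_def crs_def algebra_simps)
  have bc: "crs b c = 0" and ab: "crs a b = 0" and ac: "crs a c = 0"
    using z z' by (auto intro!: kill)
  have orth: "\<exists>p. p \<noteq> 0 \<and> dot p x = 0" for x :: "complex^3"
  proof (cases "x = 0")
    case True
    thus ?thesis by (intro exI[of _ "v3 1 0 0"]) (simp add: dot_def cvec3_eq_iff)
  qed (use exists_orth in blast)
  show False
  proof (cases "b = 0")
    case False
    then obtain k l where "c = k *s b" "a = l *s b" using bc ab crs_eq_0_commute parallel_iff by blast
    moreover obtain p where "p \<noteq> 0" "dot p b = 0" using orth by blast
    ultimately show False using kill[of p] by (simp add: dot_lin dot_commute)
  next
    case b: True
    show False
    proof (cases "a = 0")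
      case False
      then obtain k where "c = k *s a" using ac parallel_iff by blast
      moreover obtain p where "p \<noteq> 0" "dot p a = 0" using orth by blast
      ultimately show False using kill[of p] b by (simp add: dot_lin dot_commute)
    next
      case True
      obtain p where "p \<noteq> 0" "dot p c = 0" using orth by blast
      thus False using kill[of p] b True by (simp add: dot_lin dot_commute)
    qed
  qed
qed

context fixed_web begin

text \<open>If \<open>k = 1\<close>, the equation is a cubic \<open>S + w \<kappa> a b\<close> where \<open>S\<close> is a binary cubic form in \<open>a\<close> and \<open>b\<close>. Its two
  mixed terms are absorbed into the third linear form \<open>cc\<close>.\<close>

lemma fixed_normal_form: "normal_form n F"
proof -
  obtain \<kappa> s t s' t' where st: "n - k = 2" "\<kappa> \<noteq> 0" "s * t' \<noteq> t * s'"
    "\<And>a b. T a b = \<kappa> * (a * t - b * s) * (a * t' - b * s')" by (rule two_tangents, rule that)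
  define a b where "a = v3 0 t (- s)" and "b = v3 0 t' (- s')"
  have ab: "dot a v = v $ 2 * t - v $ 3 * s" "dot b v = v $ 2 * t' - v $ 3 * s'" for v
    by (simp_all add: a_def b_def dot_def mult.commute)
  have F: "F v = (if k = 0 then T (v $ 2) (v $ 3) else C 0 (v $ 2) (v $ 3) + v $ 1 * T (v $ 2) (v $ 3))" for v
    using F_eq[of "v $ 1" "v $ 2" "v $ 3"] by simp
  show ?thesis
  proof (cases "k = 0")
    case True
    have "dot a (crs b (v3 1 0 0)) \<noteq> 0" using st(3) by (simp add: a_def b_def dot_def crs_def algebra_simps)
    hence "indep a b (v3 1 0 0)" by (rule indepI_det)
    moreover have "F u = \<kappa> * dot a u * dot b u" for u by (simp add: F True st(4) ab)
    moreover have "n = 2" using st(1) True by simp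
    ultimately show ?thesis unfolding normal_form_def using st(2) by blast
  next
    case False
    hence k1: "k = 1" using k_le_1 by simp
    hence n3: "n = 3" using st(1) by simp
    define \<Delta> where "\<Delta> = t * s' - s * t'"
    have D0: "\<Delta> \<noteq> 0" using st(3) by (simp add: \<Delta>_def)
    define S where "S x y = C 0 (x * (s' / \<Delta>) + y * (- s / \<Delta>)) (x * (t' / \<Delta>) + y * (- t / \<Delta>))" for x y
    have "bform (n - 0) S" unfolding S_def[abs_def] by (rule bform_subst[OF bform_C]) simp
    hence "bform 3 S" by (simp add: n3)
    then obtain c where c: "\<And>x y. S x y = (\<Sum>i\<le>3. c i * x ^ i * y ^ (3 - i))" by (rule bform_coeffs) blast
    have S: "C 0 (v $ 2) (v $ 3) = S (dot a v) (dot b v)" for v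
    proof -
      have "dot a v * (s' / \<Delta>) + dot b v * (- s / \<Delta>) = v $ 2 * \<Delta> / \<Delta>"
           "dot a v * (t' / \<Delta>) + dot b v * (- t / \<Delta>) = v $ 3 * \<Delta> / \<Delta>"
        unfolding ab by (simp_all add: \<Delta>_def diff_divide_distrib algebra_simps)
      thus ?thesis using D0 by (simp add: S_def)
    qed
    define cc where "cc = v3 \<kappa> 0 0 + c 2 *s a + c 1 *s b"
    have dc: "dot cc v = \<kappa> * v $ 1 + c 2 * dot a v + c 1 * dot b v" for v
      by (simp add: cc_def dot_lin) (simp add: dot_def)
    have "F v = dot a v * dot b v * dot cc v + c 3 * dot a v ^ 3 + c 0 * dot b v ^ 3" for v
    proof -
      have "F v = S (dot a v) (dot b v) + v $ 1 * (\<kappa> * dot a v * dot b v)"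
        using k1 S by (simp add: F st(4) ab)
      also have "S (dot a v) (dot b v) = c 0 * dot b v ^ 3 + c 1 * dot a v * dot b v ^ 2 + c 2 * dot a v ^ 2 * dot b v + c 3 * dot a v ^ 3"
        unfolding c by (simp add: numeral_3_eq_3 numeral_2_eq_2)
      finally show ?thesis unfolding dc by (simp add: algebra_simps power2_eq_square)
    qed
    moreover have "indep a b cc"
    proof -
      have "v = 0" if z: "dot a v = 0" "dot b v = 0" "dot cc v = 0" for v
      proof -
        have "v $ 1 = 0" using z st(2) by (simp add: dc)
        moreover have "indep a b (v3 1 0 0)"
          using st(3) by (intro indepI_det) (simp add: a_def b_def dot_def crs_def algebra_simps)
        ultimately show ?thesis using z unfolding indep_def by (simp add: dot_def[of "v3 1 0 0"])
      qed
      thus ?thesis by (simp add: indep_def)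
    qed
    ultimately show ?thesis unfolding normal_form_def using n3 by blast
  qed
qed

end

section \<open>Webs in other coordinates\<close>

text \<open>The dual change of coordinates acts on points: \<open>L\<close> is, up to the factor \<open>\<delta>\<close>, inverse to the
  transpose \<open>tr\<close> of \<open>lin3 p q r\<close>, and \<open>f\<close> is conjugated accordingly.\<close>

lemma web_lin3:
  assumes "web n d F f" and D: "dot p (crs q r) \<noteq> 0"
  obtains g where "web n d (\<lambda>v. F (lin3 p q r v)) g" "\<And>u w. maps g u w \<longleftrightarrow> maps f (lin3 p q r u) (lin3 p q r w)"
proof -
  interpret web n d F f by fact
  define \<delta> where "\<delta> = dot p (crs q r)"
  define L where "L = lin3 (crs q r) (crs r p) (crs p q)"
  define tr where "tr v = v3 (dot p v) (dot q v) (dot r v)" for v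
  define g where "g v = tr (f (L v))" for v
  have LtL: "dot (lin3 p q r u) (L v) = \<delta> * dot u v" for u v
    by (simp add: L_def \<delta>_def lin3_def dot_def crs_def algebra_simps)
  have dtr: "dot u (tr v) = dot (lin3 p q r u) v" for u v
    by (simp add: tr_def lin3_def dot_def algebra_simps)
  have Ltr: "L (tr v) = \<delta> *s v" for v
    by (simp add: L_def tr_def \<delta>_def lin3_def dot_def crs_def cvec3_eq_iff algebra_simps)
  have maps: "maps g u w \<longleftrightarrow> maps f (lin3 p q r u) (lin3 p q r w)" for u w
  proof
    assume m: "maps g u w"
    show "maps f (lin3 p q r u) (lin3 p q r w)" unfolding maps_def
    proof (intro allI impI)
      fix v assume v: "dot (lin3 p q r u) v = 0"
      hence "dot w (g (tr v)) = 0" using m by (simp add: maps_def dtr)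
      hence "dot (lin3 p q r w) (f (\<delta> *s v)) = 0" by (simp add: g_def dtr Ltr)
      thus "dot (lin3 p q r w) (f v) = 0" using D by (simp add: pmap_scale[OF f] dot_lin \<delta>_def)
    qed
  next
    assume m: "maps f (lin3 p q r u) (lin3 p q r w)"
    show "maps g u w" unfolding maps_def
    proof (intro allI impI)
      fix v assume "dot u v = 0"
      hence "dot (lin3 p q r u) (L v) = 0" by (simp add: LtL)
      thus "dot w (g v) = 0" using m by (simp add: maps_def g_def dtr)
    qed
  qed
  have "web n d (\<lambda>v. F (lin3 p q r v)) g"
  proof
    show "tform n (\<lambda>v. F (lin3 p q r v))" by (rule tform_lin3[OF F])
    show "sqfree (\<lambda>v. F (lin3 p q r v))" by (rule sqfree_lin3[OF sq D])
    show "n \<ge> 2" "d \<ge> 1" by (rule n2, rule d1)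
    show "pmap d g" unfolding pmap_def
    proof (intro conjI allI impI)
      fix i
      have t: "tform d (\<lambda>v. dot w (f (L v)))" for w
        unfolding L_def by (rule tform_lin3[OF tform_pullback[OF f]])
      show "tform d (\<lambda>v. g v $ i)" using exhaust_3[of i] t by (auto simp: g_def tr_def)
    next
      fix v assume "g v = 0"
      hence "\<delta> *s f (L v) = 0" using Ltr[of "f (L v)"] by (simp add: g_def L_def lin3_def)
      hence "f (L v) = 0" using D by (simp add: \<delta>_def cvec3_eq_iff)
      hence Lv: "L v = 0" by (rule pmap_eq_0[OF f])
      have "dot u v = dot u 0" for u using LtL[of u v] D by (simp add: Lv \<delta>_def dot_lin)
      hence "dot v u = dot 0 u" for u by (simp add: dot_commute)
      thus "v = 0" by (rule dot_ext)
    qed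
    fix u assume u: "u \<noteq> 0" "F (lin3 p q r u) = 0"
    have "lin3 p q r u \<noteq> 0" using lin3_inj[OF D] u(1) by blast
    then obtain w where w: "w \<noteq> 0" "F w = 0" "maps f (lin3 p q r u) w" using inv u(2) by blast
    have "lin3 p q r (coords3 p q r w) = w" by (rule lin3_coords3[OF D])
    moreover from this have "coords3 p q r w \<noteq> 0" using w(1) by (auto simp: lin3_def)
    ultimately show "\<exists>w. w \<noteq> 0 \<and> F (lin3 p q r w) = 0 \<and> maps g u w"
      using w by (intro exI[of _ "coords3 p q r w"]) (simp add: maps)
  qed
  thus ?thesis using maps that by blast
qed

lemma grad_lin3_zero:
  assumes "polyfun F" "grad F (lin3 p q r v) = 0" shows "grad (\<lambda>v. F (lin3 p q r v)) v = 0"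
proof (rule grad_unique)
  show "polyfun (\<lambda>v. F (lin3 p q r v))" unfolding lin3_def
    by (rule polyfun_compose[OF assms(1)]) (auto intro!: polyfun_intros)
  fix t
  have "lin3 p q r (v + s *s t) = lin3 p q r v + s *s lin3 p q r t" for s
    by (simp add: lin3_def cvec3_eq_iff algebra_simps)
  thus "((\<lambda>s. F (lin3 p q r (v + s *s t))) has_field_derivative dot 0 t) (at 0)"
    using grad_field_derivative[OF assms(1), of "lin3 p q r v" "lin3 p q r t"] assms(2) by (simp add: dot_lin)
qed

lemma normal_form_lin3:
  assumes "normal_form n (\<lambda>v. F (lin3 p q r v))" "dot p (crs q r) \<noteq> 0" shows "normal_form n F"
proof -
  define A where "A x = (1 / dot p (crs q r)) *s lin3 (crs q r) (crs r p) (crs p q) x" for x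
  have A: "dot x (coords3 p q r u) = dot (A x) u" for x u
    by (simp add: A_def coords3_def lin3_def dot_lin) (simp add: dot_def algebra_simps add_divide_distrib)
  have F: "F u = F (lin3 p q r (coords3 p q r u))" for u by (simp add: lin3_coords3[OF assms(2)])
  have ind: "indep (A a) (A b) (A c)" if "indep a b c" for a b c
    unfolding indep_def
  proof (intro allI impI)
    fix u assume "dot (A a) u = 0" "dot (A b) u = 0" "dot (A c) u = 0"
    hence "coords3 p q r u = 0" using that unfolding A[symmetric] indep_def by blast
    hence "lin3 p q r (coords3 p q r u) = 0" by (simp add: lin3_def)
    thus "u = 0" by (simp add: lin3_coords3[OF assms(2)])
  qed
  from assms(1) show ?thesis unfolding normal_form_def
  proof (elim disjE exE conjE)
    fix a b c \<kappa> assume *: "n = 2" "indep a b c" "\<kappa> \<noteq> 0" "\<forall>u. F (lin3 p q r u) = \<kappa> * dot a u * dot b u"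
    have "F u = \<kappa> * dot (A a) u * dot (A b) u" for u using *(4)[rule_format, of "coords3 p q r u"] F[of u] by (simp add: A)
    thus "(\<exists>a b c \<kappa>. n = 2 \<and> indep a b c \<and> \<kappa> \<noteq> 0 \<and> (\<forall>u. F u = \<kappa> * dot a u * dot b u)) \<or>
    (\<exists>a b c p q. n = 3 \<and> indep a b c \<and>
       (\<forall>u. F u = dot a u * dot b u * dot c u + p * dot a u ^ 3 + q * dot b u ^ 3))"
      using * ind by blast
  next
    fix a b c p' q' assume *: "n = 3" "indep a b c" "\<forall>u. F (lin3 p q r u) = dot a u * dot b u * dot c u + p' * dot a u ^ 3 + q' * dot b u ^ 3"
    have "F u = dot (A a) u * dot (A b) u * dot (A c) u + p' * dot (A a) u ^ 3 + q' * dot (A b) u ^ 3" for u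
      using *(3)[rule_format, of "coords3 p q r u"] F[of u] by (simp add: A)
    thus "(\<exists>a b c \<kappa>. n = 2 \<and> indep a b c \<and> \<kappa> \<noteq> 0 \<and> (\<forall>u. F u = \<kappa> * dot a u * dot b u)) \<or>
    (\<exists>a b c p q. n = 3 \<and> indep a b c \<and>
       (\<forall>u. F u = dot a u * dot b u * dot c u + p * dot a u ^ 3 + q * dot b u ^ 3))"
      using * ind by blast
  qed
qed

theorem singular_web_normal_form:
  assumes "web n d F f" "d \<ge> 2" "l \<noteq> 0" "grad F l = 0"
  shows "normal_form n F"
proof -
  interpret web n d F f by fact
  obtain D g where g: "web n D F g" "D \<ge> 3" "maps g l l" "\<And>u. u \<noteq> 0 \<Longrightarrow> maps g u l \<Longrightarrow> crs u l = 0"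
    by (rule totally_invariant_iterate[OF assms(2-4)], rule that)
  obtain q r where qr: "dot l (crs q r) \<noteq> 0" using exists_basis[OF assms(3)] .
  obtain h where h: "web n D (\<lambda>v. F (lin3 l q r v)) h" "\<And>u w. maps h u w \<longleftrightarrow> maps g (lin3 l q r u) (lin3 l q r w)"
    by (rule web_lin3[OF g(1) qr], rule that)
  interpret h: web n D "\<lambda>v. F (lin3 l q r v)" h by fact
  have le: "lin3 l q r e1 = l" by (simp add: e1_def)
  have "fixed_web n D (\<lambda>v. F (lin3 l q r v)) h"
  proof
    show "3 \<le> D" by (rule g(2))
    show "grad (\<lambda>v. F (lin3 l q r v)) e1 = 0" by (rule grad_lin3_zero[OF pF]) (simp add: le assms(4))
    fix u assume u: "u \<noteq> 0" "maps h u e1"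
    have "lin3 l q r u \<noteq> 0" using lin3_inj[OF qr] u(1) by blast
    moreover have "maps g (lin3 l q r u) l" using u(2) h(2) le by simp
    ultimately have "crs (lin3 l q r u) l = 0" by (rule g(4))
    hence "crs l (lin3 l q r u) = 0" using crs_eq_0_commute by blast
    then obtain c where "lin3 l q r u = c *s l" using parallel_iff[OF assms(3)] by blast
    hence "lin3 l q r (u - c *s e1) = 0" by (simp add: lin3_diff e1_def) (simp add: lin3_def)
    hence "u - c *s e1 = 0" by (rule lin3_inj[OF qr])
    hence "u = c *s e1" by simp
    thus "crs u e1 = 0" by (simp add: crs_lin)
  qed
  then interpret h: fixed_web n D "\<lambda>v. F (lin3 l q r v)" h .
  show ?thesis by (rule normal_form_lin3[OF h.fixed_normal_form qr])
qed

section \<open>Reducible forms and linear factors\<close>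

lemma linear_form: assumes "tform 1 h" obtains r where "h = dot r"
proof -
  have h: "polyfun h" "homog 1 h" using assms by (auto simp: tform_def)
  have "h t = dot (grad h 0) t" for t
  proof (rule DERIV_unique)
    have "h (0 + s *s t) = s * h t" for s using homogD[OF h(2), of s t] by simp
    thus "((\<lambda>s. h (0 + s *s t)) has_field_derivative h t) (at 0)"
      by (auto intro!: derivative_eq_intros)
  qed (rule grad_field_derivative[OF h(1)])
  thus ?thesis using that by blast
qed

lemma grad_mult_common_zero:
  assumes "polyfun A" "polyfun B" "A l = 0" "B l = 0" shows "grad (\<lambda>v. A v * B v) l = 0"
proof (rule grad_unique)
  show "polyfun (\<lambda>v. A v * B v)" using assms by (intro polyfun_mult)
  fix t
  show "((\<lambda>s. A (l + s *s t) * B (l + s *s t)) has_field_derivative dot 0 t) (at 0)"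
    using DERIV_mult[OF grad_field_derivative[OF assms(1), of l t] grad_field_derivative[OF assms(2), of l t]] assms(3,4)
    by (simp add: dot_lin)
qed

lemma nonunit_factors:
  assumes "homogeneous n G" "G \<noteq> 0" "G = A * B" "\<not> A dvd 1" "\<not> B dvd 1"
  obtains a b where "tform a (eval3 A)" "tform b (eval3 B)" "a + b = n" "a \<ge> 1" "b \<ge> 1"
proof -
  have e: "eval3 G = (\<lambda>v. eval3 A v * eval3 B v)" by (simp add: assms(3) eval3_mult fun_eq_iff)
  have hn: "homog n (\<lambda>v. eval3 A v * eval3 B v)" using homogeneous_imp_homog[OF assms(1)] by (simp only: e)
  have ne: "\<exists>v. eval3 A v * eval3 B v \<noteq> 0" using eval3_eq_0_iff[of G] assms(2) unfolding e by blast
  obtain a b where ab: "tform a (eval3 A)" "tform b (eval3 B)" "a + b = n"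
    by (rule factors_of_form[OF polyfun_eval3 polyfun_eval3 hn ne])
  have deg: "k \<ge> 1" if t: "tform k (eval3 H)" and H: "\<not> H dvd 1" "H \<noteq> 0" for k H
  proof (rule ccontr)
    assume "\<not> k \<ge> 1"
    hence "k = 0" by simp
    hence "homog 0 (eval3 H)" using t by (simp add: tform_def)
    hence "eval3 H v = eval3 H 0" for v by (rule homog_0_const)
    thus False using eval3_unit_iff[of H] H by blast
  qed
  have "A \<noteq> 0" "B \<noteq> 0" using assms(2,3) by auto
  thus ?thesis using that[OF ab] deg[OF ab(1)] deg[OF ab(2)] assms(4,5) by blast
qed

lemma not_unit_if_form: assumes "homogeneous n G" "n \<ge> 1" shows "\<not> G dvd 1"
proof
  assume "G dvd 1"
  then obtain c where c: "\<And>v. eval3 G v = c" "G \<noteq> 0" using eval3_unit_iff[of G] by blast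
  moreover have "eval3 G 0 = 0" using homog_zero[OF homogeneous_imp_homog[OF assms(1)] assms(2)] .
  ultimately show False using eval3_eq_0_iff[of G] by simp
qed

text \<open>Two factors of positive degree have a common zero, where their product is singular; in degree 3
  one of them is linear.\<close>

lemma reducible_form_singular:
  assumes "homogeneous n G" "n \<ge> 1" "G \<noteq> 0" "\<not> irreducible G"
  obtains l where "n \<ge> 2" "l \<noteq> 0" "grad (eval3 G) l = 0"
    "n = 3 \<Longrightarrow> \<exists>r. r \<noteq> 0 \<and> (\<forall>u. dot r u = 0 \<longrightarrow> eval3 G u = 0)"
proof -
  obtain A B where AB: "G = A * B" "\<not> A dvd 1" "\<not> B dvd 1"
    using assms(3,4) not_unit_if_form[OF assms(1,2)] by (auto simp: irreducible_def)
  obtain a b where ab: "tform a (eval3 A)" "tform b (eval3 B)" "a + b = n" "a \<ge> 1" "b \<ge> 1"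
    by (rule nonunit_factors[OF assms(1,3) AB], rule that)
  have e: "eval3 G = (\<lambda>v. eval3 A v * eval3 B v)" by (simp add: AB(1) eval3_mult fun_eq_iff)
  obtain l where l: "l \<noteq> 0" "eval3 A l = 0" "eval3 B l = 0"
    using common_zero_of_forms[OF ab(1,2,4,5)] by blast
  have lin: "\<exists>r. r \<noteq> 0 \<and> (\<forall>u. dot r u = 0 \<longrightarrow> eval3 H u = 0)" if H: "tform 1 (eval3 H)" "H \<noteq> 0" for H
  proof -
    obtain r where r: "eval3 H = dot r" by (rule linear_form[OF H(1)])
    have "r \<noteq> 0" using H(2) eval3_eq_0_iff[of H] by (auto simp: r dot_lin)
    thus ?thesis using r by auto
  qed
  have "A \<noteq> 0" "B \<noteq> 0" using assms(3) AB(1) by auto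
  have "\<exists>r. r \<noteq> 0 \<and> (\<forall>u. dot r u = 0 \<longrightarrow> eval3 G u = 0)" if "n = 3"
  proof -
    have "a = 1 \<or> b = 1" using ab(3-5) that by linarith
    hence "tform 1 (eval3 A) \<or> tform 1 (eval3 B)" using ab by blast
    thus ?thesis
    proof
      assume "tform 1 (eval3 A)"
      then obtain r where "r \<noteq> 0" "\<And>u. dot r u = 0 \<Longrightarrow> eval3 A u = 0" using lin[OF _ \<open>A \<noteq> 0\<close>] by blast
      thus ?thesis by (intro exI[of _ r]) (simp add: e)
    next
      assume "tform 1 (eval3 B)"
      then obtain r where "r \<noteq> 0" "\<And>u. dot r u = 0 \<Longrightarrow> eval3 B u = 0" using lin[OF _ \<open>B \<noteq> 0\<close>] by blast
      thus ?thesis by (intro exI[of _ r]) (simp add: e)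
    qed
  qed
  moreover have "grad (eval3 G) l = 0"
    unfolding e by (rule grad_mult_common_zero[OF polyfun_eval3 polyfun_eval3 l(2,3)])
  moreover have "n \<ge> 2" using ab(3-5) by linarith
  ultimately show ?thesis using that[of l] l(1) by blast
qed

lemma indep_common_zero: "indep a b c \<Longrightarrow> dot a u = 0 \<Longrightarrow> dot b u = 0 \<Longrightarrow> dot c u = 0 \<Longrightarrow> u = 0"
  by (simp add: indep_def)

lemma plane_point: obtains v where "v \<noteq> 0" "dot r v = 0" "dot a v = 0"
  using zero_on_plane[OF tform_dot[of a], of r] by auto

text \<open>Let \<open>v\<close> be the point of the line \<open>r\<close> on \<open>a = 0\<close>. If neither coefficient vanishes, then \<open>b\<close> vanishes at
  \<open>v\<close> too. Comparing the values at \<open>w\<close> and \<open>w + v\<close>, where \<open>w\<close> is the point of the line on \<open>c = 0\<close>,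
  shows that \<open>a\<close> and \<open>b\<close> vanish at \<open>w\<close> as well.\<close>

lemma cubic_plane:
  assumes F: "\<And>u. dot r u = 0 \<Longrightarrow> dot a u * dot b u * dot c u + p * dot a u ^ 3 + q * dot b u ^ 3 = 0"
    and "indep a b c"
  shows "p = 0 \<or> q = 0"
proof (rule ccontr)
  assume "\<not> ?thesis"
  hence pq: "p \<noteq> 0" "q \<noteq> 0" by auto
  obtain v where v: "v \<noteq> 0" "dot r v = 0" "dot a v = 0" by (rule plane_point)
  have bv: "dot b v = 0" using F[OF v(2)] pq v(3) by simp
  have cv: "dot c v \<noteq> 0" using indep_common_zero[OF assms(2) v(3) bv] v(1) by blast
  obtain w where w: "w \<noteq> 0" "dot r w = 0" "dot c w = 0" by (rule plane_point)
  have "dot r (w + v) = 0" using v w by (simp add: dot_lin)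
  from F[OF this] have 1: "dot a w * dot b w * dot c v + p * dot a w ^ 3 + q * dot b w ^ 3 = 0"
    using v bv w by (simp add: dot_lin)
  have 2: "p * dot a w ^ 3 + q * dot b w ^ 3 = 0" using F[OF w(2)] w(3) by simp
  have "dot a w * dot b w = 0" using 1 2 cv by (simp add: add.assoc)
  hence "dot a w = 0" "dot b w = 0" using 2 pq by auto
  thus False using indep_common_zero[OF assms(2) _ _ w(3)] w(1) by blast
qed

text \<open>The same argument as for the cubic: at the point \<open>v\<close> of the line on \<open>a = 0\<close> one of \<open>b\<close> and \<open>c\<close>
  vanishes, and comparing the values at \<open>w\<close> and \<open>w + v\<close> produces a common zero of all three forms.\<close>

lemma conic_no_plane:
  assumes G: "\<And>u. dot r u = 0 \<Longrightarrow> dot b u * dot c u + s * dot a u ^ 2 = 0" and "s \<noteq> 0" "indep a b c"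
  shows False
proof -
  have gen: False if G: "\<And>u. dot r u = 0 \<Longrightarrow> dot b u * dot c u + s * dot a u ^ 2 = 0" and ind: "indep a b c"
    and v: "v \<noteq> 0" "dot r v = 0" "dot a v = 0" "dot b v = 0" for b c v
  proof -
    have cv: "dot c v \<noteq> 0" using indep_common_zero[OF ind v(3,4)] v(1) by blast
    obtain w where w: "w \<noteq> 0" "dot r w = 0" "dot c w = 0" by (rule plane_point)
    have aw: "dot a w = 0" using G[OF w(2)] w(3) assms(2) by simp
    have "dot r (w + v) = 0" using v w by (simp add: dot_lin)
    from G[OF this] have "dot b w = 0" using v w cv aw by (simp add: dot_lin)
    thus False using indep_common_zero[OF ind aw _ w(3)] w(1) by blast
  qed
  obtain v where v: "v \<noteq> 0" "dot r v = 0" "dot a v = 0" by (rule plane_point)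
  have "dot b v = 0 \<or> dot c v = 0" using G[OF v(2)] v(3) by simp
  thus False
  proof
    assume "dot b v = 0" thus False using gen[OF G assms(3) v] by blast
  next
    assume "dot c v = 0"
    moreover have "indep a c b" using assms(3) by (auto simp: indep_def)
    moreover have "\<And>u. dot r u = 0 \<Longrightarrow> dot c u * dot b u + s * dot a u ^ 2 = 0" using G by (simp add: mult.commute)
    ultimately show False using gen[of c b v] v by blast
  qed
qed

lemma irreducible_conic_equation:
  assumes "s \<noteq> 0" "indep a b c"
  obtains g where "homogeneous 2 g" "irreducible g" "\<And>u. eval3 g u = dot b u * dot c u + s * dot a u ^ 2"
proof -
  define G where "G u = dot b u * dot c u + s * dot a u ^ 2" for u
  have "polyfun (dot u)" for u using tform_dot[of u] by (simp add: tform_def)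
  hence "polyfun G" unfolding G_def[abs_def] by (intro polyfun_add polyfun_mult polyfun_const polyfun_power)
  then obtain g where g: "G = eval3 g" by (auto simp: polyfun_def)
  have "homog 2 G" by (simp add: homog_def G_def dot_lin power2_eq_square algebra_simps)
  hence hom: "homogeneous 2 g" unfolding g by (rule homog_imp_homogeneous)
  have no_plane: False if "\<And>u. dot r u = 0 \<Longrightarrow> eval3 g u = 0" for r
    using conic_no_plane[OF _ assms, of r] that unfolding g[symmetric] G_def by blast
  have "g \<noteq> 0" using no_plane by force
  have "irreducible g"
  proof (rule irreducibleI)
    show "g \<noteq> 0" by fact
    show "\<not> g dvd 1" using not_unit_if_form[OF hom] by simp
    fix x y assume xy: "g = x * y"
    show "x dvd 1 \<or> y dvd 1"
    proof (rule ccontr)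
      assume "\<not> ?thesis"
      hence nu: "\<not> x dvd 1" "\<not> y dvd 1" by auto
      obtain i j where "tform i (eval3 x)" "tform j (eval3 y)" "i + j = 2" "i \<ge> 1" "j \<ge> 1"
        by (rule nonunit_factors[OF hom \<open>g \<noteq> 0\<close> xy nu], rule that)
      moreover from this have "i = 1" by simp
      ultimately obtain r where r: "eval3 x = dot r" using linear_form by metis
      have "eval3 g u = 0" if "dot r u = 0" for u using that by (simp add: xy eval3_mult r)
      thus False by (rule no_plane)
    qed
  qed
  thus ?thesis using that[OF hom] unfolding g[symmetric] G_def by blast
qed

section \<open>Points and lines of the projective plane\<close>

text \<open>The point with homogeneous coordinates \<open>v\<close>; unspecified for \<open>v = 0\<close>.\<close>

definition pt :: "complex^3 \<Rightarrow> proj_plane" where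
  "pt v = Abs_proj_plane (range (\<lambda>c. c *s v))"

lemma Rep_pt: assumes "v \<noteq> 0" shows "Rep_proj_plane (pt v) = range (\<lambda>c. c *s v)"
proof -
  have "range (\<lambda>c. c *s v) = vec.span {v}" by (simp add: vec.span_singleton)
  moreover have "vec.dim (vec.span {v}) = 1"
    using assms by (simp add: vec.dim_span vec.dim_eq_card_independent vec.independent_insert)
  ultimately have "range (\<lambda>c. c *s v) \<in> {V. vec.subspace V \<and> vec.dim V = 1}" by simp
  thus ?thesis unfolding pt_def by (rule Abs_proj_plane_inverse)
qed

lemma mem_Rep_pt: "v \<noteq> 0 \<Longrightarrow> w \<in> Rep_proj_plane (pt v) \<longleftrightarrow> (\<exists>c. w = c *s v)"
  by (auto simp: Rep_pt)

lemma pt_eqI: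
  assumes "w \<in> Rep_proj_plane p" "w \<noteq> 0" shows "p = pt w"
proof -
  have V: "vec.subspace (Rep_proj_plane p)" "vec.dim (Rep_proj_plane p) = 1" using Rep_proj_plane[of p] by auto
  have "vec.span {w} = Rep_proj_plane p"
  proof (rule vec.subspace_dim_equal)
    show "vec.span {w} \<subseteq> Rep_proj_plane p" using assms V by (intro vec.span_minimal) auto
    have "vec.dim (vec.span {w}) = 1"
      using assms by (simp add: vec.dim_span vec.dim_eq_card_independent vec.independent_insert)
    thus "vec.dim (Rep_proj_plane p) \<le> vec.dim (vec.span {w})" using V by simp
  qed (use V in simp_all)
  hence "Rep_proj_plane p = Rep_proj_plane (pt w)" by (simp add: Rep_pt[OF assms(2)] vec.span_singleton)
  thus ?thesis by (simp add: Rep_proj_plane_inject)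
qed

lemma ptE: obtains v where "v \<noteq> 0" "p = pt v"
proof -
  have V: "vec.subspace (Rep_proj_plane p)" "vec.dim (Rep_proj_plane p) = 1" using Rep_proj_plane[of p] by auto
  obtain v where "v \<in> Rep_proj_plane p" "v \<noteq> 0"
    using V(2) vec.dim_eq_0[of "Rep_proj_plane p"] by auto
  thus ?thesis using that pt_eqI by blast
qed

lemma pt_eq_iff: assumes "u \<noteq> 0" "v \<noteq> 0" shows "pt u = pt v \<longleftrightarrow> crs v u = 0"
proof -
  have "pt u = pt v \<longleftrightarrow> u \<in> Rep_proj_plane (pt v)"
    using pt_eqI[of u "pt v"] assms mem_Rep_pt[OF assms(1), of u] by (metis vec.scale_one)
  thus ?thesis using parallel_iff[OF assms(2), of u] mem_Rep_pt[OF assms(2), of u] by simp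
qed

lemma set_eq_ptI: "(\<And>v. v \<noteq> 0 \<Longrightarrow> pt v \<in> A \<longleftrightarrow> pt v \<in> B) \<Longrightarrow> A = B"
  by (metis ptE subsetI subset_antisym)

lemma mem_zero_set: assumes "homogeneous n F" "v \<noteq> 0" shows "pt v \<in> zero_set F \<longleftrightarrow> eval3 F v = 0"
proof -
  have "pt v \<in> zero_set F \<longleftrightarrow> (\<forall>c. c ^ n * eval3 F v = 0)"
    by (simp add: zero_set_def Rep_pt[OF assms(2)] homogD[OF homogeneous_imp_homog[OF assms(1)]])
  thus ?thesis by (auto dest: spec[of _ 1])
qed

lemma mem_line_of: assumes "u \<noteq> 0" "v \<noteq> 0" shows "pt v \<in> line_of (pt u) \<longleftrightarrow> dot u v = 0"
proof -
  have "pt v \<in> line_of (pt u) \<longleftrightarrow> (\<forall>c c'. c * (c' * dot u v) = 0)"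
    unfolding line_of_def dot_sum[symmetric] by (simp add: Rep_pt assms dot_lin)
  thus ?thesis by (metis mult_1 mult_zero_right)
qed

lemma is_line_line_of [simp]: "is_line (line_of l)" by (auto simp: is_line_def)

lemma line_of_ne: assumes "indep a b c" shows "line_of (pt a) \<noteq> line_of (pt b)"
proof -
  define v where "v = crs b c"
  have d: "dot a v \<noteq> 0" "dot b v = 0" using indep_det[OF assms] by (simp_all add: v_def)
  hence "v \<noteq> 0" "a \<noteq> 0" by (auto simp: dot_lin)
  moreover have "b \<noteq> 0" using d by (auto simp: v_def crs_lin dot_lin)
  ultimately show ?thesis using mem_line_of d by metis
qed

lemma indep_nonzero: assumes "indep a b c" shows "a \<noteq> 0" "b \<noteq> 0" "c \<noteq> 0"
  using indep_det[OF assms] by (auto simp: dot_lin crs_lin)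

lemma indep_perm: assumes "indep a b c" shows "indep b a c" "indep a c b" "indep b c a"
  using assms by (auto simp: indep_def)

lemma indep_crs: assumes "indep a b c" shows "crs a b \<noteq> 0"
proof -
  have "dot c (crs a b) = dot a (crs b c)" by (simp add: dot_def crs_def algebra_simps)
  thus ?thesis using indep_det[OF assms] by (auto simp: dot_lin)
qed

lemma orth_two_iff: assumes "crs a b \<noteq> 0" "v \<noteq> 0" shows "dot a v = 0 \<and> dot b v = 0 \<longleftrightarrow> pt v = pt (crs a b)"
proof
  assume "dot a v = 0 \<and> dot b v = 0"
  then obtain k where "v = k *s crs a b" using orth_crs[of v a b] assms(1) by (auto simp: dot_commute)
  hence "crs (crs a b) v = 0" by (simp add: crs_lin)
  thus "pt v = pt (crs a b)" unfolding pt_eq_iff[OF assms(2,1)] .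
next
  assume "pt v = pt (crs a b)"
  then obtain k where "v = k *s crs a b" using pt_eq_iff[OF assms(2,1)] parallel_iff[OF assms(1)] by auto
  thus "dot a v = 0 \<and> dot b v = 0" by (simp add: dot_lin)
qed

text \<open>The conic \<open>b c + s a\<^sup>2\<close> meets the line \<open>a = 0\<close> where \<open>b = 0\<close> or \<open>c = 0\<close>.\<close>

lemma conic_and_line:
  assumes F: "homogeneous n F" "\<And>u. eval3 F u = dot a u * (dot b u * dot c u + s * dot a u ^ 2)"
    and s: "s \<noteq> 0" and ind: "indep a b c"
  shows "\<exists>D L. irreducible_conic D \<and> is_line L \<and> card (D \<inter> L) = 2 \<and> zero_set F = D \<union> L"
proof -
  obtain g where g: "homogeneous 2 g" "irreducible g" "\<And>u. eval3 g u = dot b u * dot c u + s * dot a u ^ 2"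
    by (rule irreducible_conic_equation[OF s ind], rule that)
  note a0 = indep_nonzero(1)[OF ind] and ab = indep_crs[OF ind] and ac = indep_crs[OF indep_perm(2)[OF ind]]
  have "zero_set F = zero_set g \<union> line_of (pt a)"
  proof (rule set_eq_ptI)
    fix v :: "complex^3" assume v: "v \<noteq> 0"
    show "pt v \<in> zero_set F \<longleftrightarrow> pt v \<in> zero_set g \<union> line_of (pt a)"
      using mem_zero_set[OF F(1) v] mem_zero_set[OF g(1) v] mem_line_of[OF a0 v] by (auto simp: F(2) g(3))
  qed
  moreover have "zero_set g \<inter> line_of (pt a) = {pt (crs a b), pt (crs a c)}"
  proof (rule set_eq_ptI)
    fix v :: "complex^3" assume v: "v \<noteq> 0"
    have "pt v \<in> zero_set g \<inter> line_of (pt a) \<longleftrightarrow> dot a v = 0 \<and> dot b v = 0 \<or> dot a v = 0 \<and> dot c v = 0"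
      using mem_zero_set[OF g(1) v] mem_line_of[OF a0 v] by (auto simp: g(3))
    thus "pt v \<in> zero_set g \<inter> line_of (pt a) \<longleftrightarrow> pt v \<in> {pt (crs a b), pt (crs a c)}"
      unfolding orth_two_iff[OF ab v] orth_two_iff[OF ac v] by simp
  qed
  moreover have "pt (crs a b) \<noteq> pt (crs a c)"
  proof
    assume "pt (crs a b) = pt (crs a c)"
    hence "dot c (crs a b) = 0" using orth_two_iff[OF ac ab] by simp
    hence "crs a b = 0" using indep_common_zero[OF ind] by simp
    thus False using ab by simp
  qed
  ultimately have "card (zero_set g \<inter> line_of (pt a)) = 2" "zero_set F = zero_set g \<union> line_of (pt a)" by simp_all
  thus ?thesis using g unfolding irreducible_conic_def by (metis is_line_line_of)
qed

theorem theoremB: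
  fixes f :: "proj_plane \<Rightarrow> proj_plane" and d :: nat and C :: "dual_plane set"
  assumes "d \<ge> 2"
    and "holomorphic_map d f"
    and "reduced_curve C"
    and "web_invariant f C"
    and "reducible_curve C"
  shows "(\<exists>L1 L2. is_line L1 \<and> is_line L2 \<and> L1 \<noteq> L2 \<and> C = L1 \<union> L2) \<or>
    (\<exists>L1 L2 L3. is_line L1 \<and> is_line L2 \<and> is_line L3 \<and>
       L1 \<noteq> L2 \<and> L1 \<noteq> L3 \<and> L2 \<noteq> L3 \<and> L1 \<inter> L2 \<inter> L3 = {} \<and> C = L1 \<union> L2 \<union> L3) \<or>
    (\<exists>D L. irreducible_conic D \<and> is_line L \<and> card (D \<inter> L) = 2 \<and> C = D \<union> L)"
proof -
  obtain F n where F: "n \<ge> 1" "homogeneous n F" "squarefree F" "C = zero_set F" "\<not> irreducible F"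
    using assms(5) unfolding reducible_curve_def reduced_equation_def by blast
  have "F \<noteq> 0" using F(3) by auto
  obtain l where l: "n \<ge> 2" "l \<noteq> 0" "grad (eval3 F) l = 0"
    "n = 3 \<Longrightarrow> \<exists>r. r \<noteq> 0 \<and> (\<forall>u. dot r u = 0 \<longrightarrow> eval3 F u = 0)"
    by (rule reducible_form_singular[OF F(2,1) \<open>F \<noteq> 0\<close> F(5)], rule that)
  obtain P Q R where PQR: "homogeneous d P" "homogeneous d Q" "homogeneous d R"
    "{v. eval3 P v = 0 \<and> eval3 Q v = 0 \<and> eval3 R v = 0} = {0}"
    "\<forall>p. \<forall>v\<in>Rep_proj_plane p. v \<noteq> 0 \<longrightarrow> v3 (eval3 P v) (eval3 Q v) (eval3 R v) \<in> Rep_proj_plane (f p)"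
    using assms(2) unfolding holomorphic_map_def v3_def by (elim exE conjE)
  define fh where "fh v = v3 (eval3 P v) (eval3 Q v) (eval3 R v)" for v
  have fh0: "fh v = 0 \<longleftrightarrow> v = 0" for v
    using PQR(4) by (auto simp: fh_def cvec3_eq_iff[of "v3 _ _ _"])
  have f_pt: "f (pt v) = pt (fh v)" if "v \<noteq> 0" for v
  proof (rule pt_eqI)
    have "v \<in> Rep_proj_plane (pt v)" using mem_Rep_pt[OF that, of v] by (metis vec.scale_one)
    thus "fh v \<in> Rep_proj_plane (f (pt v))" unfolding fh_def using PQR(5) that by blast
  qed (simp add: fh0 that)
  have "web n d (eval3 F) fh"
  proof
    show "tform n (eval3 F)" using homogeneous_imp_homog[OF F(2)] by (simp add: tform_def)
    show "sqfree (eval3 F)" using F(3) by (simp add: sqfree_iff_squarefree)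
    show "n \<ge> 2" "d \<ge> 1" using l(1) assms(1) by auto
    have "tform d (\<lambda>v. fh v $ i)" for i
      using exhaust_3[of i] PQR(1-3) by (auto simp: fh_def tform_def homogeneous_imp_homog)
    thus "pmap d fh" by (simp add: pmap_def fh0)
    fix u :: "complex^3" assume u: "u \<noteq> 0" "eval3 F u = 0"
    hence "pt u \<in> C" using mem_zero_set[OF F(2) u(1)] F(4) by simp
    then obtain l' where l': "l' \<in> C" "f ` line_of (pt u) = line_of l'"
      using assms(4) unfolding web_invariant_def by blast
    obtain w where w: "w \<noteq> 0" "l' = pt w" by (rule ptE)
    have "maps fh u w" unfolding maps_def
    proof (intro allI impI)
      fix v assume v: "dot u v = 0"
      show "dot w (fh v) = 0"
      proof (cases "v = 0")
        case True
        hence "fh v = 0" by (simp add: fh0)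
        thus ?thesis by (simp add: dot_lin)
      next
        case False
        hence "pt v \<in> line_of (pt u)" using mem_line_of[OF u(1) False] v by simp
        hence "f (pt v) \<in> f ` line_of (pt u)" by (rule imageI)
        hence "pt (fh v) \<in> line_of (pt w)" by (simp only: l'(2) w(2) f_pt[OF False])
        thus ?thesis using mem_line_of[OF w(1), of "fh v"] False by (simp add: fh0)
      qed
    qed
    moreover have "eval3 F w = 0" using l'(1) mem_zero_set[OF F(2) w(1)] F(4) w(2) by simp
    ultimately show "\<exists>w. w \<noteq> 0 \<and> eval3 F w = 0 \<and> maps fh u w" using w(1) by blast
  qed
  hence "normal_form n (eval3 F)" by (rule singular_web_normal_form[OF _ assms(1) l(2,3)])
  thus ?thesis unfolding normal_form_def
  proof (elim disjE exE conjE)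
    fix a b c \<kappa> assume ind: "indep a b c" and k: "\<kappa> \<noteq> 0" "\<forall>u. eval3 F u = \<kappa> * dot a u * dot b u"
    have "C = line_of (pt a) \<union> line_of (pt b)" unfolding F(4)
    proof (rule set_eq_ptI)
      fix v :: "complex^3" assume v: "v \<noteq> 0"
      show "pt v \<in> zero_set F \<longleftrightarrow> pt v \<in> line_of (pt a) \<union> line_of (pt b)"
        using mem_zero_set[OF F(2) v] mem_line_of[OF _ v] indep_nonzero[OF ind] k by simp
    qed
    hence "is_line (line_of (pt a)) \<and> is_line (line_of (pt b)) \<and> line_of (pt a) \<noteq> line_of (pt b) \<and>
        C = line_of (pt a) \<union> line_of (pt b)" using line_of_ne[OF ind] by simp
    thus ?thesis by (intro disjI1 exI)
  next
    fix a b c p q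
    assume n: "n = 3" and ind: "indep a b c"
      and eq: "\<forall>u. eval3 F u = dot a u * dot b u * dot c u + p * dot a u ^ 3 + q * dot b u ^ 3"
    obtain r where "\<forall>u. dot r u = 0 \<longrightarrow> eval3 F u = 0" using l(4)[OF n] by blast
    hence "p = 0 \<or> q = 0" using eq by (intro cubic_plane[OF _ ind, of r]) auto
    then consider "p = 0" "q = 0" | "p \<noteq> 0" "q = 0" | "p = 0" "q \<noteq> 0" by blast
    thus ?thesis
    proof cases
      case 1
      note L = mem_line_of[OF indep_nonzero(1)[OF ind]] mem_line_of[OF indep_nonzero(2)[OF ind]]
        mem_line_of[OF indep_nonzero(3)[OF ind]]
      have "C = line_of (pt a) \<union> line_of (pt b) \<union> line_of (pt c)" unfolding F(4)
      proof (rule set_eq_ptI)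
        fix v :: "complex^3" assume v: "v \<noteq> 0"
        show "pt v \<in> zero_set F \<longleftrightarrow> pt v \<in> line_of (pt a) \<union> line_of (pt b) \<union> line_of (pt c)"
          using mem_zero_set[OF F(2) v] L[OF v] eq 1 by simp
      qed
      moreover have "line_of (pt a) \<inter> line_of (pt b) \<inter> line_of (pt c) = {}"
      proof (rule set_eq_ptI)
        fix v :: "complex^3" assume v: "v \<noteq> 0"
        show "pt v \<in> line_of (pt a) \<inter> line_of (pt b) \<inter> line_of (pt c) \<longleftrightarrow> pt v \<in> {}"
          using L[OF v] indep_common_zero[OF ind, of v] v by auto
      qed
      ultimately have "is_line (line_of (pt a)) \<and> is_line (line_of (pt b)) \<and> is_line (line_of (pt c)) \<and>
          line_of (pt a) \<noteq> line_of (pt b) \<and> line_of (pt a) \<noteq> line_of (pt c) \<and> line_of (pt b) \<noteq> line_of (pt c) \<and>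
          line_of (pt a) \<inter> line_of (pt b) \<inter> line_of (pt c) = {} \<and>
          C = line_of (pt a) \<union> line_of (pt b) \<union> line_of (pt c)"
        using line_of_ne[OF ind] line_of_ne[OF indep_perm(2)[OF ind]] line_of_ne[OF indep_perm(3)[OF ind]]
        by (intro conjI is_line_line_of)
      thus ?thesis by (intro disjI2[OF disjI1] exI)
    next
      case 2
      have "eval3 F u = dot a u * (dot b u * dot c u + p * dot a u ^ 2)" for u
        by (simp add: eq[rule_format] 2 power2_eq_square power3_eq_cube algebra_simps)
      from conic_and_line[OF F(2) this 2(1) ind] show ?thesis unfolding F(4) by blast
    next
      case 3
      have "eval3 F u = dot b u * (dot a u * dot c u + q * dot b u ^ 2)" for u
        by (simp add: eq[rule_format] 3 power2_eq_square power3_eq_cube algebra_simps)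
      from conic_and_line[OF F(2) this 3(2) indep_perm(1)[OF ind]] show ?thesis unfolding F(4) by blast
    qed
  qed
qed

end
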